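(* The Multiobjective Spanner (MSp) problem is BUCO-hard even on degree-3 bounded outerplanar graphs: if there is an output-polynomial algorithm solving MSp on all instances whose graph is degree-3 bounded and outerplanar, then there is an output-polynomial algorithm for the BUCO problem.
   Context: MSp: the input is a connected, undirected graph $G=(V,E)$ with edge-weight functions $c_1\colon E\to\mathbb{Z}$ and $c_2\colon E\to\mathbb{N}_+$. A feasible solution (spanner) is a set $S\subseteq E$ such that $(V,S)$ is connected, with value vector $f(S)=(f_1(S),f_2(S))^\mathsf{T}$, $f_1(S)=\sum_{e\in S}c_1(e)$ and $f_2(S)=\max_{u,v\in V,\,u\neq v}\frac{d^S_{c_2}(u,v)}{d^E_{c_2}(u,v)}$, where $d^F_{c_2}(u,v)$ is the $c_2$-length of a shortest $u$-$v$-path in $(V,F)$. For value vectors $y\neq y'$, $y$ is dominated by $y'$ if $y'\le y$ componentwise; the non-dominated set $\mathcal{Y}_N$ consists of the value vectors not dominated by any value vector of a feasible solution, and solving an instance means outputting $\mathcal{Y}_N$. BUCO (Biobjective Unconstrained Combinatorial Optimization): the input is $c^1,c^2\in\mathbb{N}^n$; feasible solutions are $x\in\{0,1\}^n$ with value vector $(-(c^1)^\mathsf{T}x,(c^2)^\mathsf{T}x)^\mathsf{T}$; the task is to output the non-dominated set of these value vectors. An algorithm is output-polynomial if it outputs every element of $\mathcal{Y}_N$ exactly once in time polynomial in the input size and the size of $\mathcal{Y}_N$. A graph is degree-3 bounded if all vertex degrees are at most 3, and outerplanar if it has a drawing with all vertices on the outer face. *)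

theory Defs
  imports "HOL-Analysis.Analysis" "HOL-Computational_Algebra.Polynomial"
begin

section \<open>Non-dominated sets\<close>

definition dominates :: "'a::order \<times> 'b::order \<Rightarrow> 'a \<times> 'b \<Rightarrow> bool" where
  "dominates y' y \<longleftrightarrow> y' \<noteq> y \<and> fst y' \<le> fst y \<and> snd y' \<le> snd y"

definition nondominated :: "('a::order \<times> 'b::order) set \<Rightarrow> ('a \<times> 'b) set" where
  "nondominated Y = {y \<in> Y. \<not> (\<exists>y' \<in> Y. dominates y' y)}"


section \<open>Graphs\<close>

text \<open>An edge is the two-element set of its end vertices.\<close>

definition simple_graph :: "'v set \<Rightarrow> 'v set set \<Rightarrow> bool" where
  "simple_graph V E \<longleftrightarrow> finite V \<and> (\<forall>e\<in>E. e \<subseteq> V \<and> card e = 2)"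

definition is_path :: "'v set set \<Rightarrow> 'v \<Rightarrow> 'v \<Rightarrow> 'v list \<Rightarrow> bool" where
  "is_path F u v p \<longleftrightarrow> p \<noteq> [] \<and> hd p = u \<and> last p = v \<and> distinct p \<and>
     (\<forall>i. Suc i < length p \<longrightarrow> {p ! i, p ! Suc i} \<in> F)"

definition graph_connected :: "'v set \<Rightarrow> 'v set set \<Rightarrow> bool" where
  "graph_connected V F \<longleftrightarrow> (\<forall>u\<in>V. \<forall>v\<in>V. \<exists>p. is_path F u v p)"

definition path_weight :: "('v set \<Rightarrow> nat) \<Rightarrow> 'v list \<Rightarrow> nat" where
  "path_weight c p = (\<Sum>i<length p - 1. c {p ! i, p ! Suc i})"

text \<open>Only meaningful if \<open>u\<close> and \<open>v\<close> are connected by a path with edges in \<open>F\<close>.\<close>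

definition graph_dist :: "('v set \<Rightarrow> nat) \<Rightarrow> 'v set set \<Rightarrow> 'v \<Rightarrow> 'v \<Rightarrow> nat" where
  "graph_dist c F u v = (LEAST l. \<exists>p. is_path F u v p \<and> path_weight c p = l)"

definition degree_bounded :: "nat \<Rightarrow> 'v set \<Rightarrow> 'v set set \<Rightarrow> bool" where
  "degree_bounded k V E \<longleftrightarrow> (\<forall>v\<in>V. card {e \<in> E. v \<in> e} \<le> k)"

text \<open>A drawing places the vertices at distinct points \<open>pos v\<close> and draws every edge \<open>e\<close> as a
  simple curve \<open>curve e\<close>; curves meet vertices and each other only in common end points.\<close>

definition plane_drawing ::
  "'v set \<Rightarrow> 'v set set \<Rightarrow> ('v \<Rightarrow> complex) \<Rightarrow> ('v set \<Rightarrow> real \<Rightarrow> complex) \<Rightarrow> bool" where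
  "plane_drawing V E pos curve \<longleftrightarrow>
     inj_on pos V \<and>
     (\<forall>e\<in>E. arc (curve e) \<and> {pathstart (curve e), pathfinish (curve e)} = pos ` e) \<and>
     (\<forall>e\<in>E. \<forall>v\<in>V. pos v \<in> path_image (curve e) \<longrightarrow> v \<in> e) \<and>
     (\<forall>e\<in>E. \<forall>e'\<in>E. e \<noteq> e' \<longrightarrow>
        path_image (curve e) \<inter> path_image (curve e') \<subseteq> pos ` (e \<inter> e'))"

text \<open>The drawing of a finite graph is compact, so \<open>outside\<close> is exactly its unbounded face.\<close>

definition outerplanar :: "'v set \<Rightarrow> 'v set set \<Rightarrow> bool" where
  "outerplanar V E \<longleftrightarrow>
     (\<exists>pos curve. plane_drawing V E pos curve \<and>
        (\<forall>v\<in>V. pos v \<in> frontier (outside (pos ` V \<union> (\<Union>e\<in>E. path_image (curve e))))))"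


section \<open>Multiobjective spanners\<close>

record msp =
  verts :: "nat set"
  edges :: "nat set set"
  cost1 :: "nat set \<Rightarrow> int"
  cost2 :: "nat set \<Rightarrow> nat"

text \<open>With fewer than two vertices the maximum defining the stretch would range over the empty
  set, so such graphs are not instances.\<close>

definition msp_instance :: "msp \<Rightarrow> bool" where
  "msp_instance G \<longleftrightarrow> simple_graph (verts G) (edges G) \<and> 2 \<le> card (verts G) \<and>
     graph_connected (verts G) (edges G) \<and> (\<forall>e \<in> edges G. 0 < cost2 G e)"

definition spanner :: "msp \<Rightarrow> nat set set \<Rightarrow> bool" where
  "spanner G S \<longleftrightarrow> S \<subseteq> edges G \<and> graph_connected (verts G) S"

definition total_cost :: "msp \<Rightarrow> nat set set \<Rightarrow> int" where
  "total_cost G S = (\<Sum>e\<in>S. cost1 G e)"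

definition stretch :: "msp \<Rightarrow> nat set set \<Rightarrow> rat" where
  "stretch G S = Max {of_nat (graph_dist (cost2 G) S u v) /
                      of_nat (graph_dist (cost2 G) (edges G) u v)
                      | u v. u \<in> verts G \<and> v \<in> verts G \<and> u \<noteq> v}"

definition msp_values :: "msp \<Rightarrow> (int \<times> rat) set" where
  "msp_values G = {(total_cost G S, stretch G S) | S. spanner G S}"


section \<open>Biobjective unconstrained combinatorial optimization\<close>

definition buco_instance :: "nat list \<times> nat list \<Rightarrow> bool" where
  "buco_instance = (\<lambda>(c1, c2). length c1 = length c2)"

definition buco_values :: "nat list \<times> nat list \<Rightarrow> (int \<times> int) set" where
  "buco_values = (\<lambda>(c1, c2).
     {(- int (\<Sum>i<length c1. c1 ! i * x ! i), int (\<Sum>i<length c1. c2 ! i * x ! i))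
      | x :: nat list. length x = length c1 \<and> set x \<subseteq> {0, 1}})"


section \<open>A machine model\<close>

text \<open>While programs over binary trees with unit cost for each elementary operation
  (Jones, Computability and Complexity from a Programming Perspective, 1997). The model is
  polynomially equivalent to Turing machines. A Turing machine step is a constant number of
  operations on tapes stored as lists. Conversely, a Turing machine can keep the store as a
  directed acyclic graph, to which every operation adds at most one node; printing the final
  tree then costs time polynomial in the size of the output.\<close>

datatype data = Leaf | Node data data

datatype expr = Var nat | LeafE | NodeE expr expr | Fst expr | Snd expr

datatype com =
    Assign nat expr
  | Seq com com
  | Cond expr com com
  | While expr com

type_synonym store = "nat \<Rightarrow> data"

fun left :: "data \<Rightarrow> data" where
  "left Leaf = Leaf"
| "left (Node a b) = a"

fun right :: "data \<Rightarrow> data" where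
  "right Leaf = Leaf"
| "right (Node a b) = b"

primrec eval_expr :: "expr \<Rightarrow> store \<Rightarrow> data" where
  "eval_expr (Var x) s = s x"
| "eval_expr LeafE s = Leaf"
| "eval_expr (NodeE a b) s = Node (eval_expr a s) (eval_expr b s)"
| "eval_expr (Fst a) s = left (eval_expr a s)"
| "eval_expr (Snd a) s = right (eval_expr a s)"

primrec expr_cost :: "expr \<Rightarrow> nat" where
  "expr_cost (Var x) = 1"
| "expr_cost LeafE = 1"
| "expr_cost (NodeE a b) = expr_cost a + expr_cost b + 1"
| "expr_cost (Fst a) = expr_cost a + 1"
| "expr_cost (Snd a) = expr_cost a + 1"

text \<open>\<open>exec c s t s'\<close>: started in \<open>s\<close>, the program \<open>c\<close> halts in \<open>s'\<close> after time \<open>t\<close>.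
  \<open>Leaf\<close> represents false, every other tree true.\<close>

inductive exec :: "com \<Rightarrow> store \<Rightarrow> nat \<Rightarrow> store \<Rightarrow> bool" where
  Assign: "exec (Assign x e) s (expr_cost e + 1) (s(x := eval_expr e s))"
| Seq: "exec c s t s' \<Longrightarrow> exec d s' t' s'' \<Longrightarrow> exec (Seq c d) s (t + t') s''"
| CondTrue: "eval_expr e s \<noteq> Leaf \<Longrightarrow> exec c s t s' \<Longrightarrow>
    exec (Cond e c d) s (expr_cost e + 1 + t) s'"
| CondFalse: "eval_expr e s = Leaf \<Longrightarrow> exec d s t s' \<Longrightarrow>
    exec (Cond e c d) s (expr_cost e + 1 + t) s'"
| WhileTrue: "eval_expr e s \<noteq> Leaf \<Longrightarrow> exec c s t s' \<Longrightarrow> exec (While e c) s' t' s'' \<Longrightarrow>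
    exec (While e c) s (expr_cost e + 1 + t + t') s''"
| WhileFalse: "eval_expr e s = Leaf \<Longrightarrow> exec (While e c) s (expr_cost e + 1) s"

lemma exec_deterministic:
  assumes "exec c s t s'" and "exec c s u r"
  shows "u = t \<and> r = s'"
  using assms
proof (induction arbitrary: u r rule: exec.induct)
  case Assign
  then show ?case by (auto elim: exec.cases)
next
  case Seq
  from Seq.prems show ?case by cases (use Seq.IH in blast)+
next
  case CondTrue
  from CondTrue.prems show ?case by cases (use CondTrue in blast)+
next
  case CondFalse
  from CondFalse.prems show ?case by cases (use CondFalse in blast)+
next
  case WhileTrue
  from WhileTrue.prems show ?case by cases (use WhileTrue in blast)+
next
  case WhileFalse
  from WhileFalse.prems show ?case by cases (use WhileFalse in blast)+
qed

definition input_store :: "data \<Rightarrow> store" where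
  "input_store d = (\<lambda>_. Leaf)(0 := d)"

definition computes_in_time :: "com \<Rightarrow> data \<Rightarrow> data \<Rightarrow> nat \<Rightarrow> bool" where
  "computes_in_time c d r t \<longleftrightarrow> (\<exists>s. exec c (input_store d) t s \<and> s 0 = r)"


section \<open>Encodings\<close>

text \<open>Numbers are written in binary, least significant bit first and without leading zeros.\<close>

fun bits :: "nat \<Rightarrow> bool list" where
  "bits n = (if n = 0 then [] else odd n # bits (n div 2))"

declare bits.simps [simp del]

definition enc_bool :: "bool \<Rightarrow> data" where
  "enc_bool b = (if b then Node Leaf Leaf else Leaf)"

definition enc_pair :: "('a \<Rightarrow> data) \<Rightarrow> ('b \<Rightarrow> data) \<Rightarrow> 'a \<times> 'b \<Rightarrow> data" where
  "enc_pair f g p = Node (f (fst p)) (g (snd p))"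

primrec enc_list :: "('a \<Rightarrow> data) \<Rightarrow> 'a list \<Rightarrow> data" where
  "enc_list f [] = Leaf"
| "enc_list f (x # xs) = Node (f x) (enc_list f xs)"

definition enc_nat :: "nat \<Rightarrow> data" where
  "enc_nat n = enc_list enc_bool (bits n)"

definition enc_int :: "int \<Rightarrow> data" where
  "enc_int z = enc_pair enc_bool enc_nat (z < 0, nat \<bar>z\<bar>)"

text \<open>Rationals are encoded by numerator and positive denominator in lowest terms.\<close>

definition enc_rat :: "rat \<Rightarrow> data" where
  "enc_rat q = enc_pair enc_int enc_int (quotient_of q)"

text \<open>A graph is given by a list of its vertices and a list of its edges \<open>(u, v, a, b)\<close> with
  their two costs \<open>a\<close> and \<open>b\<close>, each edge occurring once in one of its two orientations.\<close>

definition msp_code :: "msp \<Rightarrow> data \<Rightarrow> bool" where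
  "msp_code G d \<longleftrightarrow>
     (\<exists>(vs :: nat list) (es :: (nat \<times> nat \<times> int \<times> nat) list).
        distinct vs \<and> set vs = verts G \<and>
        distinct (map (\<lambda>(u, v, a, b). {u, v}) es) \<and>
        (\<lambda>(u, v, a, b). {u, v}) ` set es = edges G \<and>
        (\<forall>(u, v, a, b) \<in> set es. a = cost1 G {u, v} \<and> b = cost2 G {u, v}) \<and>
        d = enc_pair (enc_list enc_nat)
              (enc_list (enc_pair enc_nat (enc_pair enc_nat (enc_pair enc_int enc_nat))))
              (vs, es))"

definition buco_code :: "nat list \<times> nat list \<Rightarrow> data \<Rightarrow> bool" where
  "buco_code I d \<longleftrightarrow> d = enc_pair (enc_list enc_nat) (enc_list enc_nat) I"


section \<open>Output-polynomial algorithms\<close>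

text \<open>\<open>code i d\<close> says that \<open>d\<close> is an encoding of the instance \<open>i\<close>, \<open>Y i\<close> is the set of values
  to be listed, and \<open>enc\<close> encodes single values. A univariate polynomial in the sum of the two
  parameters is as general as a polynomial in two variables with natural coefficients.\<close>

definition output_polynomial ::
  "com \<Rightarrow> ('i \<Rightarrow> bool) \<Rightarrow> ('i \<Rightarrow> data \<Rightarrow> bool) \<Rightarrow> ('i \<Rightarrow> 'y set) \<Rightarrow> ('y \<Rightarrow> data) \<Rightarrow> bool" where
  "output_polynomial c inst code Y enc \<longleftrightarrow>
     (\<exists>p :: nat poly. \<forall>i d. inst i \<and> code i d \<longrightarrow>
        (\<exists>ys t. computes_in_time c d (enc_list enc ys) t \<and>
           distinct ys \<and> set ys = Y i \<and>
           t \<le> poly p (size d + card (Y i))))"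

definition solves_msp :: "com \<Rightarrow> (msp \<Rightarrow> bool) \<Rightarrow> bool" where
  "solves_msp c P \<longleftrightarrow>
     output_polynomial c (\<lambda>G. msp_instance G \<and> P G) msp_code
       (\<lambda>G. nondominated (msp_values G)) (enc_pair enc_int enc_rat)"

definition solves_buco :: "com \<Rightarrow> bool" where
  "solves_buco c \<longleftrightarrow>
     output_polynomial c buco_instance buco_code
       (\<lambda>I. nondominated (buco_values I)) (enc_pair enc_int enc_int)"

end

(*
  A BUCO instance with n items becomes a Hamiltonian cycle with chords. Item i is a triangle
  a_i, p_i, b_i. Its shortcut a_i b_i has costs (c1_i, 2), the detour through p_i has costs
  (-c1_i, 2 c2_i + 2). The triangles are linked in a chain, and a closing edge of costs (M, 2)
  with large M joins the two ends. Edges with nonpositive first cost can be added to any solution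
  without making it worse, so only the shortcuts and the closing edge are real choices, and
  x_i = 1 means that the shortcut of item i is left out.

  Without the closing edge the stretch is attained by the two ends of the chain. The connecting
  edges are chosen such that the value of x is (- c1 x, 2^(m+n) + c2 x), with 2^m larger than
  the sums of c1 and c2. With the closing edge the first value is positive and the stretch is 1
  or 1 + c2_i for some i, so at most n + 1 further nondominated points arise. They are recognized
  by their sign, and subtracting 2^(m+n) from the others means deleting the top bit.
*)

theory Submission
  imports Defs
begin

section \<open>Composing polynomial-time programs\<close>

text \<open>The obstacle is that stretch is a maximum while the second BUCO objective is a sum. The
  closing edge is short and its ends are otherwise joined only along the whole chain, so its single
  quotient adds up all detours. For this quotient to be the maximum it has to reach every
  \<open>1 + d i\<close>; that is the purpose of the long constant part of the chain. A connecting
  edge of length \<open>2 * base m i\<close> together with a shortcut of length 2 adds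
  \<open>2 * 2 ^ (m + i)\<close>, which doubles the constant part with every item. Hence the
  constant part ends up as a power of two although the program only ever prepends bits. Both ways
  through a triangle have even length, so the relevant quotients are natural numbers and the
  numerator alone determines the value. The number of additional nondominated points has to be
  bounded because the given algorithm may spend time polynomial in the size of its own output, while
  the reduction is charged only for the BUCO output.\<close>

lemma poly_nat_mono: "m \<le> n \<Longrightarrow> poly p m \<le> poly p n" for p :: "nat poly"
  by (induction p) (auto intro!: add_mono mult_mono)

text \<open>Bounds stay arbitrary functions, so that the introduction rules discharge them by their
  syntactic shape and no explicit polynomial has to be written down.\<close>

definition poly_bounded :: "(nat \<Rightarrow> nat) \<Rightarrow> bool" where
  "poly_bounded f \<longleftrightarrow> (\<exists>p. \<forall>n. f n \<le> poly p n)"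

lemma poly_bounded_const: "poly_bounded (\<lambda>_. k)"
  unfolding poly_bounded_def by (rule exI[of _ "[:k:]"]) simp

lemma poly_bounded_id: "poly_bounded (\<lambda>n. n)"
  unfolding poly_bounded_def by (rule exI[of _ "[:0, 1:]"]) simp

lemma poly_bounded_add:
  assumes "poly_bounded f" and "poly_bounded g"
  shows "poly_bounded (\<lambda>n. f n + g n)"
proof -
  obtain p q where "\<forall>n. f n \<le> poly p n" and "\<forall>n. g n \<le> poly q n"
    using assms unfolding poly_bounded_def by blast
  then have "\<forall>n. f n + g n \<le> poly (p + q) n" by (simp add: add_mono)
  then show ?thesis unfolding poly_bounded_def by blast
qed

lemma poly_bounded_mult:
  assumes "poly_bounded f" and "poly_bounded g"
  shows "poly_bounded (\<lambda>n. f n * g n)"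
proof -
  obtain p q where "\<forall>n. f n \<le> poly p n" and "\<forall>n. g n \<le> poly q n"
    using assms unfolding poly_bounded_def by blast
  then have "\<forall>n. f n * g n \<le> poly (p * q) n" by (simp add: mult_mono)
  then show ?thesis unfolding poly_bounded_def by blast
qed

lemma poly_bounded_poly:
  assumes "poly_bounded f"
  shows "poly_bounded (\<lambda>n. poly p (f n))"
proof -
  obtain q where "\<forall>n. f n \<le> poly q n"
    using assms unfolding poly_bounded_def by blast
  then have "\<forall>n. poly p (f n) \<le> poly (pcompose p q) n"
    by (simp add: poly_pcompose poly_nat_mono)
  then show ?thesis unfolding poly_bounded_def by blast
qed

lemmas poly_bounded_intros =
  poly_bounded_const poly_bounded_id poly_bounded_add poly_bounded_mult poly_bounded_poly

lemma poly_boundedE: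
  assumes "poly_bounded f"
  obtains p where "\<And>n. f n \<le> poly p n"
  using assms unfolding poly_bounded_def by blast


section \<open>Variables of a program and independence of the rest of the store\<close>

primrec expr_vars_below :: "nat \<Rightarrow> expr \<Rightarrow> bool" where
  "expr_vars_below k (Var x) \<longleftrightarrow> x < k"
| "expr_vars_below k LeafE \<longleftrightarrow> True"
| "expr_vars_below k (NodeE a b) \<longleftrightarrow> expr_vars_below k a \<and> expr_vars_below k b"
| "expr_vars_below k (Fst a) \<longleftrightarrow> expr_vars_below k a"
| "expr_vars_below k (Snd a) \<longleftrightarrow> expr_vars_below k a"

primrec vars_below :: "nat \<Rightarrow> com \<Rightarrow> bool" where
  "vars_below k (Assign x e) \<longleftrightarrow> x < k \<and> expr_vars_below k e"
| "vars_below k (Seq c d) \<longleftrightarrow> vars_below k c \<and> vars_below k d"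
| "vars_below k (Cond e c d) \<longleftrightarrow> expr_vars_below k e \<and> vars_below k c \<and> vars_below k d"
| "vars_below k (While e c) \<longleftrightarrow> expr_vars_below k e \<and> vars_below k c"

lemma expr_vars_below_mono: "expr_vars_below k e \<Longrightarrow> k \<le> l \<Longrightarrow> expr_vars_below l e"
  by (induction e) auto

lemma vars_below_mono: "vars_below k c \<Longrightarrow> k \<le> l \<Longrightarrow> vars_below l c"
  by (induction c) (auto intro: expr_vars_below_mono)

lemma ex_expr_vars_below: "\<exists>k. expr_vars_below k e"
proof (induction e)
  case (NodeE a b)
  then obtain k l where "expr_vars_below k a" "expr_vars_below l b" by blast
  then have "expr_vars_below (max k l) (NodeE a b)" by (auto intro: expr_vars_below_mono)
  then show ?case by blast
qed (auto intro: exI[of _ "Suc _"])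

lemma ex_vars_below: "\<exists>k. vars_below k c"
proof (induction c)
  case (Assign x e)
  obtain k where "expr_vars_below k e" using ex_expr_vars_below by blast
  then have "vars_below (max k (Suc x)) (Assign x e)" by (auto intro: expr_vars_below_mono)
  then show ?case by blast
next
  case (Seq c d)
  then obtain k l where "vars_below k c" "vars_below l d" by blast
  then have "vars_below (max k l) (Seq c d)" by (auto intro: vars_below_mono)
  then show ?case by blast
next
  case (Cond e c d)
  then obtain k l where "vars_below k c" "vars_below l d" by blast
  moreover obtain j where "expr_vars_below j e" using ex_expr_vars_below by blast
  ultimately have "vars_below (max j (max k l)) (Cond e c d)"
    by (auto intro: vars_below_mono expr_vars_below_mono)
  then show ?case by blast
next
  case (While e c)
  then obtain k where "vars_below k c" by blast
  moreover obtain j where "expr_vars_below j e" using ex_expr_vars_below by blast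
  ultimately have "vars_below (max j k) (While e c)"
    by (auto intro: vars_below_mono expr_vars_below_mono)
  then show ?case by blast
qed

lemma exec_unchanged:
  assumes "exec c s t s'" and "vars_below k c" and "k \<le> x"
  shows "s' x = s x"
  using assms by (induction rule: exec.induct) auto

lemma eval_expr_cong:
  "expr_vars_below k e \<Longrightarrow> (\<And>x. x < k \<Longrightarrow> s x = r x) \<Longrightarrow> eval_expr e s = eval_expr e r"
  by (induction e) auto

text \<open>The given algorithm is only known to work from \<open>input_store\<close>. When it is
  run as a part of a larger program, the store agrees with \<open>input_store\<close> merely on the
  variables that the algorithm mentions.\<close>

lemma exec_cong:
  assumes "exec c s t s'" and "vars_below k c" and "\<And>x. x < k \<Longrightarrow> s x = r x"
  shows "\<exists>r'. exec c r t r' \<and> (\<forall>x<k. s' x = r' x)"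
  using assms
proof (induction arbitrary: r rule: exec.induct)
  case (Assign x e s)
  have "eval_expr e s = eval_expr e r"
    using Assign.prems eval_expr_cong[of k e s r] by simp
  then show ?case using Assign exec.Assign[of x e r] by (intro exI conjI) auto
next
  case (Seq c s t s' d t' s'')
  then obtain r' where r': "exec c r t r'" "\<forall>x<k. s' x = r' x" by force
  then obtain r'' where "exec d r' t' r''" "\<forall>x<k. s'' x = r'' x" using Seq by force
  with r' show ?case using exec.Seq by blast
next
  case (CondTrue e s c t s' d)
  have "eval_expr e s = eval_expr e r"
    using CondTrue.prems eval_expr_cong[of k e s r] by simp
  moreover obtain r' where "exec c r t r'" "\<forall>x<k. s' x = r' x" using CondTrue by force
  ultimately show ?case using CondTrue exec.CondTrue[of e r c t r' d] by metis
next
  case (CondFalse e s d t s' c)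
  have "eval_expr e s = eval_expr e r"
    using CondFalse.prems eval_expr_cong[of k e s r] by simp
  moreover obtain r' where "exec d r t r'" "\<forall>x<k. s' x = r' x" using CondFalse by force
  ultimately show ?case using CondFalse exec.CondFalse[of e r d t r' c] by metis
next
  case (WhileTrue e s c t s' t' s'')
  have e: "eval_expr e s = eval_expr e r"
    using WhileTrue.prems eval_expr_cong[of k e s r] by simp
  obtain r' where r': "exec c r t r'" "\<forall>x<k. s' x = r' x" using WhileTrue by force
  then obtain r'' where "exec (While e c) r' t' r''" "\<forall>x<k. s'' x = r'' x"
    using WhileTrue by force
  with r' e show ?case using WhileTrue exec.WhileTrue[of e r c t r' t' r''] by metis
next
  case (WhileFalse e s c)
  have "eval_expr e s = eval_expr e r"
    using WhileFalse.prems eval_expr_cong[of k e s r] by simp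
  then show ?case using WhileFalse exec.WhileFalse[of e r c] by metis
qed


text \<open>Programs must cope with arbitrary initial contents of their auxiliary variables, so that
  they can be composed. The size bound is not implied by the time bound, since trees share
  subtrees.\<close>

definition ptime :: "(data \<Rightarrow> data) \<Rightarrow> bool" where
  "ptime f \<longleftrightarrow> (\<exists>c p. \<forall>s. \<exists>t s'. exec c s t s' \<and> s' 0 = f (s 0) \<and>
     t \<le> poly p (size (s 0)) \<and> size (f (s 0)) \<le> poly p (size (s 0)))"

lemma ptimeI:
  assumes "\<And>s. \<exists>t s'. exec c s t s' \<and> s' 0 = f (s 0) \<and> t \<le> b (size (s 0))"
    and "\<And>d. size (f d) \<le> b' (size d)" and "poly_bounded b" and "poly_bounded b'"
  shows "ptime f"
proof -
  obtain p q where "\<And>n. b n \<le> poly p n" and "\<And>n. b' n \<le> poly q n"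
    using assms(3,4) by (auto elim!: poly_boundedE)
  then have "\<And>n. b n \<le> poly (p + q) n" and "\<And>n. b' n \<le> poly (p + q) n"
    by (auto intro: trans_le_add1 trans_le_add2)
  then show ?thesis unfolding ptime_def using assms(1,2) by (meson le_trans)
qed

text \<open>The variables from \<open>k\<close> on survive a call of \<open>c\<close>, so
  \<open>k\<close> and \<open>Suc k\<close> can hold saved values. \<open>0 < k\<close> keeps them
  apart from variable 0, which carries argument and result.\<close>

lemma ptimeE:
  assumes "ptime f"
  obtains c p k where "vars_below k c" and "0 < k"
    and "\<And>s. \<exists>t s'. exec c s t s' \<and> s' 0 = f (s 0) \<and> (\<forall>x\<ge>k. s' x = s x) \<and> t \<le> poly p (size (s 0))"
    and "\<And>d. size (f d) \<le> poly p (size d)"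
proof -
  obtain c p where cp: "\<And>s. \<exists>t s'. exec c s t s' \<and> s' 0 = f (s 0) \<and>
     t \<le> poly p (size (s 0)) \<and> size (f (s 0)) \<le> poly p (size (s 0))"
    using assms unfolding ptime_def by blast
  obtain k where "vars_below k c" using ex_vars_below by blast
  then have k: "vars_below (Suc k) c" by (rule vars_below_mono) simp
  have "size (f d) \<le> poly p (size d)" for d
    using cp[of "\<lambda>_. d"] by blast
  moreover have "\<exists>t s'. exec c s t s' \<and> s' 0 = f (s 0) \<and> (\<forall>x\<ge>Suc k. s' x = s x) \<and>
      t \<le> poly p (size (s 0))" for s
    using cp[of s] exec_unchanged[OF _ k] by blast
  ultimately show ?thesis using that k by blast
qed

lemma ptime_expr:
  assumes "\<And>s. f (s 0) = eval_expr e s" and "\<And>d. size (f d) \<le> size d + k"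
  shows "ptime f"
proof (rule ptimeI)
  show "\<exists>t s'. exec (Assign 0 e) s t s' \<and> s' 0 = f (s 0) \<and> t \<le> (\<lambda>_. expr_cost e + 1) (size (s 0))" for s
    using exec.Assign[of 0 e s] assms(1)[of s] by - (intro exI conjI, assumption, auto)
  show "size (f d) \<le> (\<lambda>n. n + k) (size d)" for d using assms(2) by simp
qed (intro poly_bounded_intros)+

lemma size_left: "size (left d) \<le> size d" by (cases d) auto
lemma size_right: "size (right d) \<le> size d" by (cases d) auto

lemma ptime_id: "ptime (\<lambda>d. d)"
  by (rule ptime_expr[where e = "Var 0" and k = 0]) auto

lemma ptime_Leaf: "ptime (\<lambda>d. Leaf)"
  by (rule ptime_expr[where e = "LeafE" and k = 0]) auto

lemma ptime_left0: "ptime left"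
  by (rule ptime_expr[where e = "Fst (Var 0)" and k = 0]) (auto simp: size_left)

lemma ptime_right0: "ptime right"
  by (rule ptime_expr[where e = "Snd (Var 0)" and k = 0]) (auto simp: size_right)

text \<open>The size bound in \<open>ptime\<close> pays off here: the running time of the second
  program is measured in the size of the intermediate tree.\<close>

lemma ptime_comp:
  assumes "ptime g" and "ptime f"
  shows "ptime (\<lambda>d. g (f d))"
proof -
  obtain c p where c: "\<And>s. \<exists>t s'. exec c s t s' \<and> s' 0 = f (s 0) \<and> t \<le> poly p (size (s 0))"
    and p: "\<And>d. size (f d) \<le> poly p (size d)" using assms(2) by (elim ptimeE) blast
  obtain c' p' where c': "\<And>s. \<exists>t s'. exec c' s t s' \<and> s' 0 = g (s 0) \<and> t \<le> poly p' (size (s 0))"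
    and p': "\<And>d. size (g d) \<le> poly p' (size d)" using assms(1) by (elim ptimeE) blast
  have *: "poly p' (size (f d)) \<le> poly p' (poly p (size d))" for d
    by (intro poly_nat_mono p)
  show ?thesis
  proof (rule ptimeI)
    fix s
    obtain t s' where 1: "exec c s t s'" "s' 0 = f (s 0)" "t \<le> poly p (size (s 0))"
      using c by blast
    obtain t' s'' where 2: "exec c' s' t' s''" "s'' 0 = g (s' 0)" "t' \<le> poly p' (size (s' 0))"
      using c' by blast
    have "t + t' \<le> poly p (size (s 0)) + poly p' (poly p (size (s 0)))"
      using 1 2 *[of "s 0"] by auto
    then show "\<exists>t s''. exec (Seq c c') s t s'' \<and> s'' 0 = g (f (s 0)) \<and>
        t \<le> (\<lambda>n. poly p n + poly p' (poly p n)) (size (s 0))"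
      using exec.Seq[OF 1(1) 2(1)] 1 2 by auto
  next
    show "size (g (f d)) \<le> (\<lambda>n. poly p' (poly p n)) (size d)" for d
      using p'[of "f d"] *[of d] by simp
  qed (intro poly_bounded_intros)+
qed

lemmas ptime_left = ptime_comp[OF ptime_left0]
lemmas ptime_right = ptime_comp[OF ptime_right0]

lemma exec_copy: "exec (Assign x (Var y)) s 2 (s(x := s y))"
  using exec.Assign[of x "Var y" s] by (simp add: numeral_eq_Suc)

lemma ptime_Node:
  assumes "ptime f" and "ptime g"
  shows "ptime (\<lambda>d. Node (f d) (g d))"
proof -
  obtain c p k where k: "0 < k" and c: "\<And>s. \<exists>t s'. exec c s t s' \<and> s' 0 = f (s 0) \<and>
      (\<forall>x\<ge>k. s' x = s x) \<and> t \<le> poly p (size (s 0))"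
    and p: "\<And>d. size (f d) \<le> poly p (size d)" using assms(1) by (elim ptimeE) blast
  obtain c' p' k' where k': "0 < k'" and c': "\<And>s. \<exists>t s'. exec c' s t s' \<and> s' 0 = g (s 0) \<and>
      (\<forall>x\<ge>k'. s' x = s x) \<and> t \<le> poly p' (size (s 0))"
    and p': "\<And>d. size (g d) \<le> poly p' (size d)" using assms(2) by (elim ptimeE) blast
  define K where "K = max k k'"
  have K: "0 < K" "k \<le> K" "k' \<le> K" using k by (auto simp: K_def)
  \<comment> \<open>\<open>K\<close> keeps the argument and \<open>Suc K\<close> the first result
    while \<open>c'\<close> runs; both lie above the variables of \<open>c\<close> and
    \<open>c'\<close>.\<close>
  define C where "C = Seq (Assign K (Var 0)) (Seq c (Seq (Assign (Suc K) (Var 0))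
    (Seq (Assign 0 (Var K)) (Seq c' (Assign 0 (NodeE (Var (Suc K)) (Var 0)))))))"
  show ?thesis
  proof (rule ptimeI)
    fix s
    obtain t1 s1 where 1: "exec c (s(K := s 0)) t1 s1" "s1 0 = f (s 0)"
      "\<forall>x\<ge>k. s1 x = (s(K := s 0)) x" "t1 \<le> poly p (size (s 0))"
      using c[of "s(K := s 0)"] K by auto
    obtain t2 s2 where 2: "exec c' (s1(Suc K := s1 0, 0 := s1 K)) t2 s2" "s2 0 = g (s1 K)"
      "\<forall>x\<ge>k'. s2 x = (s1(Suc K := s1 0, 0 := s1 K)) x" "t2 \<le> poly p' (size (s1 K))"
      using c'[of "s1(Suc K := s1 0, 0 := s1 K)"] K by auto
    have s1K: "s1 K = s 0" using 1(3) K by auto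
    have s2K: "s2 (Suc K) = f (s 0)" using 1(2) 2(3) K by auto
    have last: "exec (Assign 0 (NodeE (Var (Suc K)) (Var 0))) s2 4 (s2(0 := Node (s2 (Suc K)) (s2 0)))"
      using exec.Assign[of 0 "NodeE (Var (Suc K)) (Var 0)" s2] by (simp add: numeral_eq_Suc)
    have "exec (Assign 0 (Var K)) (s1(Suc K := s1 0)) 2 (s1(Suc K := s1 0, 0 := s1 K))"
      using exec_copy[of 0 K "s1(Suc K := s1 0)"] by simp
    note exec.Seq[OF exec_copy exec.Seq[OF 1(1) exec.Seq[OF exec_copy exec.Seq[OF this
      exec.Seq[OF 2(1) last]]]], folded C_def]
    then show "\<exists>t s'. exec C s t s' \<and> s' 0 = Node (f (s 0)) (g (s 0)) \<and>
       t \<le> (\<lambda>n. 10 + poly p n + poly p' n) (size (s 0))"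
      using 1 2 s1K s2K by - (intro exI conjI, assumption, auto)
  next
    show "size (Node (f d) (g d)) \<le> (\<lambda>n. poly p n + poly p' n + 1) (size d)" for d
      using p[of d] p'[of d] by auto
  qed (intro poly_bounded_intros)+
qed

lemma ptime_if:
  assumes "ptime h" and "ptime f" and "ptime g"
  shows "ptime (\<lambda>d. if h d = Leaf then f d else g d)"
proof -
  obtain c p k where k: "0 < k" and c: "\<And>s. \<exists>t s'. exec c s t s' \<and> s' 0 = h (s 0) \<and>
      (\<forall>x\<ge>k. s' x = s x) \<and> t \<le> poly p (size (s 0))"
    using assms(1) by (elim ptimeE) blast
  obtain c' p' where c': "\<And>s. \<exists>t s'. exec c' s t s' \<and> s' 0 = f (s 0) \<and> t \<le> poly p' (size (s 0))"
    and p': "\<And>d. size (f d) \<le> poly p' (size d)" using assms(2) by (elim ptimeE) blast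
  obtain c'' p'' where c'': "\<And>s. \<exists>t s'. exec c'' s t s' \<and> s' 0 = g (s 0) \<and> t \<le> poly p'' (size (s 0))"
    and p'': "\<And>d. size (g d) \<le> poly p'' (size d)" using assms(3) by (elim ptimeE) blast
  define C where "C = Seq (Assign k (Var 0)) (Seq c (Seq (Assign (Suc k) (Var 0))
    (Seq (Assign 0 (Var k)) (Cond (Var (Suc k)) c'' c'))))"
  show ?thesis
  proof (rule ptimeI)
    fix s
    obtain t1 s1 where 1: "exec c (s(k := s 0)) t1 s1" "s1 0 = h (s 0)"
      "\<forall>x\<ge>k. s1 x = (s(k := s 0)) x" "t1 \<le> poly p (size (s 0))"
      using c[of "s(k := s 0)"] k by auto
    have s1k: "s1 k = s 0" using 1(3) k by auto
    define s2 where "s2 = s1(Suc k := s1 0, 0 := s1 k)"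
    have s2: "s2 0 = s 0" "s2 (Suc k) = h (s 0)" using s1k 1(2) by (auto simp: s2_def)
    obtain t2 s3 where 2: "exec c' s2 t2 s3" "s3 0 = f (s 0)" "t2 \<le> poly p' (size (s 0))"
      using c'[of s2] s2 by auto
    obtain t3 s4 where 3: "exec c'' s2 t3 s4" "s4 0 = g (s 0)" "t3 \<le> poly p'' (size (s 0))"
      using c''[of s2] s2 by auto
    have "\<exists>t s'. exec (Cond (Var (Suc k)) c'' c') s2 t s' \<and>
        s' 0 = (if h (s 0) = Leaf then f (s 0) else g (s 0)) \<and>
        t \<le> 2 + poly p' (size (s 0)) + poly p'' (size (s 0))"
    proof (cases "h (s 0) = Leaf")
      case True
      then have "exec (Cond (Var (Suc k)) c'' c') s2 (2 + t2) s3"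
        using exec.CondFalse[of "Var (Suc k)" s2 c' t2 s3 c''] 2 s2 by simp
      then show ?thesis using 2 True by - (intro exI conjI, assumption, auto)
    next
      case False
      then have "exec (Cond (Var (Suc k)) c'' c') s2 (2 + t3) s4"
        using exec.CondTrue[of "Var (Suc k)" s2 c'' t3 s4 c'] 3 s2 by simp
      then show ?thesis using 3 False by - (intro exI conjI, assumption, auto)
    qed
    then obtain t s' where t: "exec (Cond (Var (Suc k)) c'' c') s2 t s'"
        "s' 0 = (if h (s 0) = Leaf then f (s 0) else g (s 0))"
        "t \<le> 2 + poly p' (size (s 0)) + poly p'' (size (s 0))" by blast
    have "exec (Assign 0 (Var k)) (s1(Suc k := s1 0)) 2 s2"
      using exec_copy[of 0 k "s1(Suc k := s1 0)"] by (simp add: s2_def)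
    note exec.Seq[OF exec_copy exec.Seq[OF 1(1) exec.Seq[OF exec_copy exec.Seq[OF this t(1)]]],
      folded C_def]
    then show "\<exists>t s'. exec C s t s' \<and> s' 0 = (if h (s 0) = Leaf then f (s 0) else g (s 0)) \<and>
       t \<le> (\<lambda>n. 8 + poly p n + poly p' n + poly p'' n) (size (s 0))"
      using 1 t by - (intro exI conjI, assumption, auto)
  next
    show "size (if h d = Leaf then f d else g d) \<le> (\<lambda>n. poly p' n + poly p'' n) (size d)" for d
      using p'[of d] p''[of d] by auto
  qed (intro poly_bounded_intros)+
qed

section \<open>Iteration along encoded lists\<close>

primrec items :: "data \<Rightarrow> data list" where
  "items Leaf = []"
| "items (Node a b) = a # items b"

lemma items_enc_list: "items (enc_list f xs) = map f xs"
  by (induction xs) auto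

lemma length_items: "length (items d) \<le> size d"
  by (induction d) auto

lemma size_items: "x \<in> set (items d) \<Longrightarrow> size x \<le> size d"
  by (induction d) auto

text \<open>This is the only loop needed for the translation. Polynomial growth of \<open>g\<close>
  in one step does not bound its iterates, since the accumulator could be squared each time;
  therefore a bound on the accumulator after every prefix is a hypothesis. It ranges over all trees,
  because \<open>items\<close> reads any tree as a list.\<close>

lemma ptime_foldl:
  assumes f: "ptime f" and h: "ptime h" and g: "ptime g" and b: "poly_bounded b"
    and size: "\<And>d i. i \<le> length (items (h d)) \<Longrightarrow>
      size (foldl (\<lambda>a x. g (Node a x)) (f d) (take i (items (h d)))) \<le> b (size d)"
  shows "ptime (\<lambda>d. foldl (\<lambda>a x. g (Node a x)) (f d) (items (h d)))"
proof -
  obtain q where q: "\<And>n. b n \<le> poly q n" using b unfolding poly_bounded_def by blast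
  obtain cf pf kf where kf: "0 < kf" and cf: "\<And>s. \<exists>t s'. exec cf s t s' \<and> s' 0 = f (s 0) \<and>
      (\<forall>x\<ge>kf. s' x = s x) \<and> t \<le> poly pf (size (s 0))"
    using f by (elim ptimeE) blast
  obtain ch ph kh where kh: "0 < kh" and ch: "\<And>s. \<exists>t s'. exec ch s t s' \<and> s' 0 = h (s 0) \<and>
      (\<forall>x\<ge>kh. s' x = s x) \<and> t \<le> poly ph (size (s 0))"
    and ph: "\<And>d. size (h d) \<le> poly ph (size d)" using h by (elim ptimeE) blast
  obtain cg pg kg where kg: "0 < kg" and cg: "\<And>s. \<exists>t s'. exec cg s t s' \<and> s' 0 = g (s 0) \<and>
      (\<forall>x\<ge>kg. s' x = s x) \<and> t \<le> poly pg (size (s 0))"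
    using g by (elim ptimeE) blast
  define K where "K = max kf (max kg kh)"
  have K: "0 < K" "kf \<le> K" "kg \<le> K" "kh \<le> K" using kf by (auto simp: K_def)
  let ?g = "\<lambda>a x. g (Node a x)"
  define body where "body = Seq (Assign 0 (NodeE (Var 0) (Fst (Var (Suc K)))))
      (Seq cg (Assign (Suc K) (Snd (Var (Suc K)))))"
  define loop where "loop = While (Var (Suc K)) body"
  \<comment> \<open>Stated for an arbitrary store, so that the induction can proceed on the unread
    part of the list, kept in \<open>Suc K\<close>. \<open>B\<close> bounds the accumulator after
    every prefix and \<open>L\<close> the unread list; both stay fixed during the induction.\<close>
  have loop: "\<exists>t s'. exec loop s t s' \<and> s' 0 = foldl ?g (s 0) (items (s (Suc K))) \<and>
      t \<le> 2 + length (items (s (Suc K))) * (poly pg (B + L + 1) + 10)"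
    if "\<And>i. i \<le> length (items (s (Suc K))) \<Longrightarrow>
          size (foldl ?g (s 0) (take i (items (s (Suc K))))) \<le> B"
      and "size (s (Suc K)) \<le> L" for s B L
    using that
  proof (induction "items (s (Suc K))" arbitrary: s)
    case Nil
    then have *: "s (Suc K) = Leaf" by (cases "s (Suc K)") auto
    then have "exec loop s 2 s" unfolding loop_def
      using exec.WhileFalse[of "Var (Suc K)" s body] by (simp add: numeral_eq_Suc)
    then show ?case using * by - (intro exI conjI, assumption, auto)
  next
    case (Cons x xs)
    then obtain l where l: "s (Suc K) = Node x l" and xs: "items l = xs"
      by (cases "s (Suc K)") auto
    define s1 where "s1 = s(0 := Node (s 0) x)"
    obtain t2 s2 where 2: "exec cg s1 t2 s2" "s2 0 = g (Node (s 0) x)"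
      "\<forall>x\<ge>kg. s2 x = s1 x" "t2 \<le> poly pg (size (Node (s 0) x))"
      using cg[of s1] by (auto simp: s1_def)
    define s3 where "s3 = s2(Suc K := l)"
    have s2K: "s2 (Suc K) = Node x l" using 2(3) K l by (auto simp: s1_def)
    have "exec (Assign 0 (NodeE (Var 0) (Fst (Var (Suc K))))) s 5 s1"
      using exec.Assign[of 0 "NodeE (Var 0) (Fst (Var (Suc K)))" s] by (simp add: s1_def l numeral_eq_Suc)
    moreover have "exec (Assign (Suc K) (Snd (Var (Suc K)))) s2 3 s3"
      using exec.Assign[of "Suc K" "Snd (Var (Suc K))" s2] by (simp add: s3_def s2K numeral_eq_Suc)
    ultimately have b: "exec body s (5 + (t2 + 3)) s3"
      unfolding body_def using 2(1) by (blast intro: exec.Seq)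
    have s3: "s3 0 = g (Node (s 0) x)" "s3 (Suc K) = l"
      using 2 by (auto simp: s3_def)
    have "size (foldl ?g (s3 0) (take i (items (s3 (Suc K))))) \<le> B"
      if "i \<le> length (items (s3 (Suc K)))" for i
      using Cons.prems(1)[of "Suc i"] that by (simp add: s3 l)
    moreover have "size (s3 (Suc K)) \<le> L" using Cons.prems(2) l s3 by simp
    ultimately obtain t s' where t: "exec loop s3 t s'" "s' 0 = foldl ?g (s3 0) xs"
      "t \<le> 2 + length xs * (poly pg (B + L + 1) + 10)"
      using Cons.hyps(1)[of s3] xs s3 by auto
    have "exec loop s (2 + (8 + t2) + t) s'"
      using exec.WhileTrue[of "Var (Suc K)" s body "8 + t2" s3 t s'] b t(1) l
      by (simp add: loop_def add.commute add.left_commute)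
    moreover have "s' 0 = foldl ?g (s 0) (items (s (Suc K)))"
      using t(2) s3 l xs by simp
    moreover have "t2 \<le> poly pg (B + L + 1)"
    proof -
      have "size (s 0) \<le> B" using Cons.prems(1)[of 0] by simp
      moreover have "size x \<le> L" using Cons.prems(2) l by simp
      ultimately show ?thesis
        using 2(4) poly_nat_mono[of "size (Node (s 0) x)" "B + L + 1" pg] by simp
    qed
    ultimately show ?case using t(3) l xs by - (intro exI conjI, assumption, auto)
  qed
  define C where "C = Seq (Assign K (Var 0)) (Seq ch (Seq (Assign (Suc K) (Var 0))
    (Seq (Assign 0 (Var K)) (Seq cf loop))))"
  show ?thesis
  proof (rule ptimeI)
    fix s :: store
    let ?n = "size (s 0)"
    obtain t1 s1 where 1: "exec ch (s(K := s 0)) t1 s1" "s1 0 = h (s 0)"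
      "\<forall>x\<ge>kh. s1 x = (s(K := s 0)) x" "t1 \<le> poly ph ?n"
      using ch[of "s(K := s 0)"] K by auto
    have s1K: "s1 K = s 0" using 1(3) K by auto
    define s2 where "s2 = s1(Suc K := s1 0, 0 := s1 K)"
    obtain t2 s3 where 2: "exec cf s2 t2 s3" "s3 0 = f (s 0)" "\<forall>x\<ge>kf. s3 x = s2 x"
      "t2 \<le> poly pf ?n"
      using cf[of s2] s1K by (auto simp: s2_def)
    have s3: "s3 (Suc K) = h (s 0)" using 2(3) 1(2) K by (auto simp: s2_def)
    have "size (s3 (Suc K)) \<le> poly ph ?n" using s3 ph by simp
    moreover have "size (foldl ?g (s3 0) (take i (items (s3 (Suc K))))) \<le> poly q ?n"
      if "i \<le> length (items (s3 (Suc K)))" for i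
      using size[of i "s 0"] q[of ?n] that s3 2(2) by simp
    ultimately obtain t s' where t: "exec loop s3 t s'"
      "s' 0 = foldl ?g (f (s 0)) (items (h (s 0)))"
      "t \<le> 2 + length (items (h (s 0))) * (poly pg (poly q ?n + poly ph ?n + 1) + 10)"
      using loop[of s3 "poly q ?n" "poly ph ?n"] s3 2(2) by auto
    have "length (items (h (s 0))) \<le> poly ph ?n" using length_items ph le_trans by blast
    then have t': "t \<le> 2 + poly ph ?n * (poly pg (poly q ?n + poly ph ?n + 1) + 10)"
      using t(3) by (meson add_left_mono le_trans mult_le_mono1)
    have "exec (Assign 0 (Var K)) (s1(Suc K := s1 0)) 2 s2"
      using exec_copy[of 0 K "s1(Suc K := s1 0)"] K by (simp add: s2_def)
    note exec.Seq[OF exec_copy exec.Seq[OF 1(1) exec.Seq[OF exec_copy exec.Seq[OF this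
      exec.Seq[OF 2(1) t(1)]]]], folded C_def]
    then show "\<exists>t s'. exec C s t s' \<and> s' 0 = foldl ?g (f (s 0)) (items (h (s 0))) \<and>
       t \<le> (\<lambda>n. 8 + poly ph n + poly pf n + poly ph n *
         (poly pg (poly q n + poly ph n + 1) + 10)) (size (s 0))"
      using 1 2 t(2) t' by - (intro exI conjI, assumption, auto)
  next
    show "size (foldl ?g (f d) (items (h d))) \<le> b (size d)" for d
      using size[of "length (items (h d))" d] by simp
  qed (intro poly_bounded_intros b)+
qed

text \<open>Restores what \<open>computes_in_time\<close> prescribes for the auxiliary variables and
  spares variable 0, which holds the input. The self-assignment in the base case serves as a skip
  command.\<close>

primrec clear :: "nat \<Rightarrow> com" where
  "clear 0 = Assign 0 (Var 0)"
| "clear (Suc k) = Seq (clear k) (Assign (Suc k) LeafE)"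

lemma exec_clear: "exec (clear k) s (2 + 2 * k) (\<lambda>x. if 0 < x \<and> x \<le> k then Leaf else s x)"
proof (induction k)
  case 0
  have "(\<lambda>x. if 0 < x \<and> x \<le> 0 then Leaf else s x) = s(0 := s 0)" by auto
  then show ?case using exec_copy[of 0 0 s] by simp
next
  case (Suc k)
  let ?s = "\<lambda>x. if 0 < x \<and> x \<le> k then Leaf else s x"
  have "exec (Assign (Suc k) LeafE) ?s 2 (?s(Suc k := Leaf))"
    using exec.Assign[of "Suc k" LeafE ?s] by (simp add: numeral_eq_Suc)
  moreover have "?s(Suc k := Leaf) = (\<lambda>x. if 0 < x \<and> x \<le> Suc k then Leaf else s x)"
    by (auto simp: le_Suc_eq)
  moreover have "2 + 2 * k + 2 = 2 + 2 * Suc k" by simp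
  ultimately show ?case using exec.Seq[OF Suc] by (metis clear.simps(2))
qed

text \<open>The output of the given algorithm has to be bounded separately, because its size as a tree
  is not bounded by the running time.\<close>

lemma output_polynomial_reduction:
  assumes c: "output_polynomial c inst code Y enc"
    and f: "ptime f" and g: "ptime g" and q: "poly_bounded q"
    and red: "\<And>i d. inst' i \<Longrightarrow> code' i d \<Longrightarrow>
      \<exists>j. inst j \<and> code j (f d) \<and> card (Y j) \<le> q (size d + card (Y' i)) \<and>
        (\<forall>ys. distinct ys \<and> set ys = Y j \<longrightarrow>
           size (enc_list enc ys) \<le> q (size d + card (Y' i)) \<and>
           (\<exists>ys'. g (enc_list enc ys) = enc_list enc' ys' \<and> distinct ys' \<and> set ys' = Y' i))"
  shows "\<exists>c'. output_polynomial c' inst' code' Y' enc'"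
proof -
  obtain p where p: "\<And>i d. inst i \<Longrightarrow> code i d \<Longrightarrow>
      \<exists>ys t. computes_in_time c d (enc_list enc ys) t \<and> distinct ys \<and> set ys = Y i \<and>
        t \<le> poly p (size d + card (Y i))"
    using c unfolding output_polynomial_def by blast
  obtain Q where Q: "\<And>n. q n \<le> poly Q n" using q unfolding poly_bounded_def by blast
  obtain cf pf where cf: "\<And>s. \<exists>t s'. exec cf s t s' \<and> s' 0 = f (s 0) \<and> t \<le> poly pf (size (s 0))"
    and pf: "\<And>d. size (f d) \<le> poly pf (size d)"
    using f by (elim ptimeE) blast
  obtain cg pg where cg: "\<And>s. \<exists>t s'. exec cg s t s' \<and> s' 0 = g (s 0) \<and> t \<le> poly pg (size (s 0))"
    using g by (elim ptimeE) blast
  obtain k where k: "vars_below k c" using ex_vars_below by blast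
  \<comment> \<open>The summands are the times of the translation, of clearing the variables, of the
    given algorithm on the translated instance, and of the decoder on the output.\<close>
  define b where "b n = poly pf n + (2 + 2 * k) + poly p (poly pf n + poly Q n) + poly pg (poly Q n)" for n
  have "poly_bounded b" unfolding b_def by (intro poly_bounded_intros)
  then obtain r where r: "\<And>n. b n \<le> poly r n" unfolding poly_bounded_def by blast
  define C where "C = Seq cf (Seq (clear k) (Seq c cg))"
  have "\<exists>ys t. computes_in_time C d (enc_list enc' ys) t \<and> distinct ys \<and> set ys = Y' i \<and>
      t \<le> poly r (size d + card (Y' i))" if i: "inst' i" "code' i d" for i d
  proof -
    let ?n = "size d + card (Y' i)"
    obtain j where j: "inst j" "code j (f d)" "card (Y j) \<le> q ?n"
      and out: "\<And>ys. distinct ys \<Longrightarrow> set ys = Y j \<Longrightarrow> size (enc_list enc ys) \<le> q ?n \<and>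
        (\<exists>ys'. g (enc_list enc ys) = enc_list enc' ys' \<and> distinct ys' \<and> set ys' = Y' i)"
      using red[OF i] by blast
    obtain ys t where ys: "distinct ys" "set ys = Y j" and t: "t \<le> poly p (size (f d) + card (Y j))"
      and comp: "computes_in_time c (f d) (enc_list enc ys) t"
      using p[OF j(1,2)] by blast
    obtain ys' where ys': "g (enc_list enc ys) = enc_list enc' ys'" "distinct ys'" "set ys' = Y' i"
      and size: "size (enc_list enc ys) \<le> q ?n"
      using out[OF ys] by blast
    obtain t1 s1 where 1: "exec cf (input_store d) t1 s1" "s1 0 = f d" "t1 \<le> poly pf (size d)"
      using cf[of "input_store d"] by (auto simp: input_store_def)
    define s2 where "s2 x = (if 0 < x \<and> x \<le> k then Leaf else s1 x)" for x
    have 2: "exec (clear k) s1 (2 + 2 * k) s2" unfolding s2_def[abs_def] by (rule exec_clear)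
    obtain s where s: "exec c (input_store (f d)) t s" "s 0 = enc_list enc ys"
      using comp by (auto simp: computes_in_time_def)
    \<comment> \<open>\<open>clear k\<close> resets the variables 1 to \<open>k\<close>, so the
      stores agree below \<open>Suc k\<close>. This range surely contains variable 0, whose final
      content is the output.\<close>
    have "vars_below (Suc k) c" using k by (rule vars_below_mono) simp
    moreover have "input_store (f d) x = s2 x" if "x < Suc k" for x
      using that 1(2) by (auto simp: input_store_def s2_def)
    ultimately obtain s3 where 3: "exec c s2 t s3" "s3 0 = enc_list enc ys"
      using exec_cong[OF s(1), of "Suc k" s2] s(2) by auto
    obtain t4 s4 where 4: "exec cg s3 t4 s4" "s4 0 = g (enc_list enc ys)"
        "t4 \<le> poly pg (size (enc_list enc ys))"
      using cg[of s3] 3(2) by auto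
    have "exec C (input_store d) (t1 + (2 + 2 * k + (t + t4))) s4"
      unfolding C_def by (intro exec.Seq[OF 1(1)] exec.Seq[OF 2] exec.Seq[OF 3(1) 4(1)])
    then have "computes_in_time C d (enc_list enc' ys') (t1 + (2 + 2 * k + (t + t4)))"
      using 4(2) ys'(1) by (auto simp: computes_in_time_def)
    moreover have "t1 + (2 + 2 * k + (t + t4)) \<le> b ?n"
    proof -
      have t1: "t1 \<le> poly pf ?n" using 1(3) poly_nat_mono[of "size d" ?n pf] by simp
      have "size (f d) \<le> poly pf ?n"
        using pf[of d] poly_nat_mono[of "size d" ?n pf] by simp
      then have "t \<le> poly p (poly pf ?n + poly Q ?n)"
        using t j(3) Q[of ?n] poly_nat_mono[of "size (f d) + card (Y j)" "poly pf ?n + poly Q ?n" p]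
        by simp
      moreover have "t4 \<le> poly pg (poly Q ?n)"
        using 4(3) size Q[of ?n] poly_nat_mono[of "size (enc_list enc ys)" "poly Q ?n" pg] by simp
      ultimately show ?thesis using t1 by (simp add: b_def)
    qed
    then have "t1 + (2 + 2 * k + (t + t4)) \<le> poly r ?n" using r[of ?n] by simp
    ultimately show ?thesis using ys'(2,3) by blast
  qed
  then show ?thesis unfolding output_polynomial_def by blast
qed

section \<open>Distances and stretch\<close>

lemma path_weight_Cons: "path_weight c (u # v # p) = c {u, v} + path_weight c (v # p)"
  by (simp add: path_weight_def sum.lessThan_Suc_shift del: sum.lessThan_Suc)

lemma path_weight_single [simp]: "path_weight c [u] = 0"
  by (simp add: path_weight_def)

lemma is_path_single: "is_path F u v [x] \<longleftrightarrow> x = u \<and> x = v"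
  by (auto simp: is_path_def)

lemma is_path_Cons:
  "is_path F u w (x # y # p) \<longleftrightarrow> x = u \<and> {x, y} \<in> F \<and> x \<notin> set (y # p) \<and> is_path F y w (y # p)"
proof -
  have "(\<forall>i. Suc i < length (x # y # p) \<longrightarrow> {(x # y # p) ! i, (x # y # p) ! Suc i} \<in> F) \<longleftrightarrow>
    {x, y} \<in> F \<and> (\<forall>i. Suc i < length (y # p) \<longrightarrow> {(y # p) ! i, (y # p) ! Suc i} \<in> F)"
    (is "?L \<longleftrightarrow> ?R")
  proof
    assume L: ?L
    have "{(y # p) ! i, (y # p) ! Suc i} \<in> F" if "Suc i < length (y # p)" for i
      using L[rule_format, of "Suc i"] that by simp
    then show ?R using L[rule_format, of 0] by simp
  next
    assume ?R
    then show ?L by (auto simp: less_Suc_eq_0_disj)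
  qed
  then show ?thesis unfolding is_path_def by auto
qed

lemma is_path_mono: "is_path F u v p \<Longrightarrow> F \<subseteq> F' \<Longrightarrow> is_path F' u v p"
  unfolding is_path_def by blast

lemma path_induct [consumes 1, case_names single Cons]:
  assumes "is_path F u w p"
    and "\<And>u. u = w \<Longrightarrow> P u [u]"
    and "\<And>u v p. {u, v} \<in> F \<Longrightarrow> u \<notin> set (v # p) \<Longrightarrow> is_path F v w (v # p) \<Longrightarrow> P v (v # p) \<Longrightarrow>
      P u (u # v # p)"
  shows "P u p"
  using assms(1)
proof (induction p arbitrary: u)
  case Nil
  then show ?case by (simp add: is_path_def)
next
  case (Cons x p)
  show ?case
  proof (cases p)
    case Nil
    then show ?thesis using Cons.prems assms(2) by (auto simp: is_path_single)
  next
    case (Cons y q)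
    then show ?thesis using Cons.prems Cons.IH[of y] assms(3) by (auto simp: is_path_Cons)
  qed
qed

section \<open>Reachability and distances\<close>

definition linked :: "'v set set \<Rightarrow> 'v \<Rightarrow> 'v \<Rightarrow> bool" where
  "linked F u v \<longleftrightarrow> (\<exists>p. is_path F u v p)"

lemma graph_connected_linked: "graph_connected V F \<longleftrightarrow> (\<forall>u\<in>V. \<forall>v\<in>V. linked F u v)"
  by (simp add: graph_connected_def linked_def)

lemma linked_refl [simp]: "linked F u u"
  unfolding linked_def using is_path_single by metis

lemma graph_dist_path:
  assumes "linked F u v"
  obtains p where "is_path F u v p" and "path_weight c p = graph_dist c F u v"
proof -
  have "\<exists>l p. is_path F u v p \<and> path_weight c p = l" using assms by (simp add: linked_def)
  from LeastI_ex[OF this] show ?thesis using that by (auto simp: graph_dist_def)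
qed

lemma graph_dist_le: "is_path F u v p \<Longrightarrow> graph_dist c F u v \<le> path_weight c p"
  unfolding graph_dist_def by (rule Least_le) blast

lemma graph_dist_self [simp]: "graph_dist c F u u = 0"
  using graph_dist_le[of F u u "[u]" c] by (simp add: is_path_single)

lemma path_suffix:
  assumes "is_path F v w p" and "u \<in> set p"
  shows "\<exists>q. is_path F u w q \<and> path_weight c q \<le> path_weight c p"
  using assms
proof (induction rule: path_induct)
  case (single v)
  then show ?case by (metis empty_iff empty_set is_path_single le_refl set_ConsD)
next
  case (Cons x y p)
  show ?case
  proof (cases "u = x")
    case True
    then have "is_path F u w (x # y # p)" using Cons by (simp add: is_path_Cons)
    then show ?thesis by blast
  next
    case False
    then obtain q where "is_path F u w q" "path_weight c q \<le> path_weight c (y # p)"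
      using Cons by auto
    then show ?thesis by (auto simp: path_weight_Cons intro: le_trans)
  qed
qed

text \<open>Paths must not repeat vertices. If \<open>u\<close> already lies on \<open>p\<close>,
  the suffix of \<open>p\<close> from \<open>u\<close> on is a path, and it is no heavier because
  weights are natural numbers.\<close>

lemma path_extend:
  assumes "{u, v} \<in> F" and "is_path F v w p"
  shows "\<exists>q. is_path F u w q \<and> path_weight c q \<le> c {u, v} + path_weight c p"
proof (cases "u \<in> set p")
  case True
  then show ?thesis using path_suffix[OF assms(2) True, of c] by (auto intro: le_trans)
next
  case False
  moreover obtain q where "p = v # q" using assms(2)
    by (cases p) (auto simp: is_path_def)
  ultimately have "is_path F u w (u # p)" "path_weight c (u # p) = c {u, v} + path_weight c p"
    using assms by (auto simp: is_path_Cons path_weight_Cons)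
  then show ?thesis by (metis le_refl)
qed

lemma linked_extend: "{u, v} \<in> F \<Longrightarrow> linked F v w \<Longrightarrow> linked F u w"
  using path_extend[where c = "\<lambda>_. 0"] unfolding linked_def by metis

lemma linked_edge: "{u, v} \<in> F \<Longrightarrow> linked F u v"
  by (rule linked_extend) auto

lemma linked_mono: "linked F u v \<Longrightarrow> F \<subseteq> F' \<Longrightarrow> linked F' u v"
  unfolding linked_def using is_path_mono by metis

lemma linked_trans:
  assumes "linked F u v" and "linked F v w"
  shows "linked F u w"
proof -
  obtain p where "is_path F u v p" using assms(1) by (auto simp: linked_def)
  then show ?thesis using assms(2) by (induction rule: path_induct) (auto intro: linked_extend)
qed

lemma linked_sym:
  assumes "linked F u v"
  shows "linked F v u"
proof -
  obtain p where "is_path F u v p" using assms by (auto simp: linked_def)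
  then show ?thesis
  proof (induction rule: path_induct)
    case (Cons x y p)
    then have "linked F y x" by (simp add: linked_edge insert_commute)
    then show ?case using Cons linked_trans by metis
  qed simp
qed

lemma graph_dist_extend:
  assumes "{u, v} \<in> F" and "linked F v w"
  shows "graph_dist c F u w \<le> c {u, v} + graph_dist c F v w"
proof -
  obtain p where "is_path F v w p" "path_weight c p = graph_dist c F v w"
    using assms(2) by (rule graph_dist_path)
  then show ?thesis using path_extend[OF assms(1), of w p c] graph_dist_le le_trans by metis
qed

lemma graph_dist_edge: "{u, v} \<in> F \<Longrightarrow> graph_dist c F u v \<le> c {u, v}"
  using graph_dist_extend[of u v F v c] by simp

lemma graph_dist_triangle:
  assumes "linked F u v" and "linked F v w"
  shows "graph_dist c F u w \<le> graph_dist c F u v + graph_dist c F v w"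
proof -
  have "graph_dist c F u w \<le> path_weight c p + graph_dist c F v w" if "is_path F u v p" for p
    using that
  proof (induction rule: path_induct)
    case (Cons x y p)
    have "linked F y v" using Cons(3) by (auto simp: linked_def)
    then have "linked F y w" using assms(2) by (rule linked_trans)
    then show ?case using graph_dist_extend[OF Cons(1), of w c] Cons(4)
      by (simp add: path_weight_Cons)
  qed simp
  then show ?thesis using graph_dist_path[OF assms(1)] by metis
qed

lemma graph_dist_mono:
  assumes "linked F u v" and "F \<subseteq> F'"
  shows "graph_dist c F' u v \<le> graph_dist c F u v"
  using graph_dist_path[OF assms(1)] is_path_mono[OF _ assms(2)] graph_dist_le by metis

text \<open>Instead of reversing a path as a list, each of its edges is turned round separately and
  the pieces are joined by the triangle inequality.\<close>

lemma graph_dist_sym: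
  assumes "linked F u v"
  shows "graph_dist c F u v = graph_dist c F v u"
proof -
  have le: "graph_dist c F w x \<le> graph_dist c F x w" if "linked F x w" for x w
  proof -
    have "graph_dist c F w x \<le> path_weight c q" if "is_path F x w q" for q
      using that
    proof (induction rule: path_induct)
      case (Cons x y q)
      have e: "{y, x} \<in> F" using Cons(1) by (simp add: insert_commute)
      have "linked F y w" using Cons(3) by (auto simp: linked_def)
      then have "graph_dist c F w x \<le> graph_dist c F w y + graph_dist c F y x"
        using graph_dist_triangle[OF linked_sym linked_edge[OF e]] by blast
      then show ?case using Cons(4) graph_dist_edge[OF e, of c]
        by (simp add: path_weight_Cons insert_commute)
    qed simp
    then show ?thesis using graph_dist_path[OF that] by metis
  qed
  show ?thesis using le[OF assms] le[OF linked_sym[OF assms]] by simp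
qed

text \<open>Weak duality for shortest paths: a potential that changes along every edge by at most
  the length of the edge certifies a lower bound on the distance. The lower bounds for the
  constructed graph are proved in this way.\<close>

lemma graph_dist_potential:
  fixes \<phi> :: "'v \<Rightarrow> int"
  assumes "linked F u v"
    and "\<And>x y. {x, y} \<in> F \<Longrightarrow> \<phi> x \<le> \<phi> y + int (c {x, y})"
  shows "\<phi> u \<le> \<phi> v + int (graph_dist c F u v)"
proof -
  have "\<phi> u \<le> \<phi> v + int (path_weight c p)" if "is_path F u v p" for p
    using that
  proof (induction rule: path_induct)
    case (Cons x y p)
    then show ?case using assms(2)[OF Cons(1)] by (simp add: path_weight_Cons)
  qed simp
  then show ?thesis using graph_dist_path[OF assms(1)] by metis
qed

lemma graph_dist_pos:
  assumes "linked F u v" and "u \<noteq> v" and "\<And>e. e \<in> F \<Longrightarrow> 0 < c e"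
  shows "0 < graph_dist c F u v"
proof -
  obtain p where p: "is_path F u v p" "path_weight c p = graph_dist c F u v"
    using assms(1) by (rule graph_dist_path)
  have "0 < path_weight c p" using p(1) assms(2)
    by (induction rule: path_induct) (auto simp: path_weight_Cons assms(3))
  then show ?thesis using p by simp
qed

section \<open>Stretch of the spanners of an instance\<close>

context
  fixes G :: msp
  assumes inst: "msp_instance G"
begin

lemma cost2_pos: "e \<in> edges G \<Longrightarrow> 0 < cost2 G e"
  using inst by (simp add: msp_instance_def)

lemma finite_verts: "finite (verts G)" and finite_edges: "finite (edges G)"
proof -
  show "finite (verts G)" using inst by (simp add: msp_instance_def simple_graph_def)
  moreover have "edges G \<subseteq> Pow (verts G)"
    using inst by (auto simp: msp_instance_def simple_graph_def)
  ultimately show "finite (edges G)" using finite_subset by blast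
qed

lemma spanner_linked: "spanner G S \<Longrightarrow> u \<in> verts G \<Longrightarrow> v \<in> verts G \<Longrightarrow> linked S u v"
  by (simp add: spanner_def graph_connected_linked)

lemma spanner_edges: "spanner G (edges G)"
  using inst by (simp add: spanner_def msp_instance_def)

lemma dist_edges_pos:
  assumes "u \<in> verts G" and "v \<in> verts G" and "u \<noteq> v"
  shows "0 < graph_dist (cost2 G) (edges G) u v"
  using graph_dist_pos[OF spanner_linked[OF spanner_edges assms(1,2)] assms(3)] cost2_pos by blast

lemma spanner_mono:
  assumes "spanner G S" and "S \<subseteq> S'" and "S' \<subseteq> edges G"
  shows "spanner G S'"
  using assms linked_mono[OF _ assms(2)] by (simp add: spanner_def graph_connected_linked)

lemma stretch_set_finite:
  "finite {of_nat (graph_dist (cost2 G) S u v) / of_nat (graph_dist (cost2 G) (edges G) u v) :: rat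
     | u v. u \<in> verts G \<and> v \<in> verts G \<and> u \<noteq> v}" (is "finite ?A")
proof -
  have "?A \<subseteq> (\<lambda>(u, v). of_nat (graph_dist (cost2 G) S u v) /
      of_nat (graph_dist (cost2 G) (edges G) u v)) ` (verts G \<times> verts G)" by auto
  then show ?thesis using finite_verts by (meson finite_SigmaI finite_imageI finite_subset)
qed

lemma stretch_ge:
  assumes "u \<in> verts G" and "v \<in> verts G" and "u \<noteq> v"
    and "r * of_nat (graph_dist (cost2 G) (edges G) u v) \<le> of_nat (graph_dist (cost2 G) S u v)"
  shows "r \<le> stretch G S"
proof -
  have "r \<le> of_nat (graph_dist (cost2 G) S u v) / of_nat (graph_dist (cost2 G) (edges G) u v)"
    using dist_edges_pos[OF assms(1-3)] assms(4) by (simp add: pos_le_divide_eq)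
  also have "\<dots> \<le> stretch G S"
    unfolding stretch_def by (rule Max_ge[OF stretch_set_finite]) (use assms in blast)
  finally show ?thesis .
qed

lemma ex_distinct_verts: "\<exists>u v. u \<in> verts G \<and> v \<in> verts G \<and> u \<noteq> v"
proof -
  have "\<not> is_singleton (verts G)" "verts G \<noteq> {}"
    using inst by (auto simp: msp_instance_def is_singleton_altdef)
  then show ?thesis by (metis is_singletonI')
qed

lemma stretch_le:
  assumes "\<And>u v. u \<in> verts G \<Longrightarrow> v \<in> verts G \<Longrightarrow> u \<noteq> v \<Longrightarrow>
    of_nat (graph_dist (cost2 G) S u v) \<le> r * of_nat (graph_dist (cost2 G) (edges G) u v)"
  shows "stretch G S \<le> r"
  unfolding stretch_def
proof (rule Max.boundedI[OF stretch_set_finite])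
  show "{of_nat (graph_dist (cost2 G) S u v) / of_nat (graph_dist (cost2 G) (edges G) u v) :: rat
     | u v. u \<in> verts G \<and> v \<in> verts G \<and> u \<noteq> v} \<noteq> {}"
    using ex_distinct_verts by blast
qed (use assms dist_edges_pos in \<open>auto simp: pos_divide_le_eq\<close>)

lemma stretch_ge_1:
  assumes "spanner G S"
  shows "1 \<le> stretch G S"
proof -
  obtain u v where uv: "u \<in> verts G" "v \<in> verts G" "u \<noteq> v" using ex_distinct_verts by blast
  then have "graph_dist (cost2 G) (edges G) u v \<le> graph_dist (cost2 G) S u v"
    using graph_dist_mono spanner_linked[OF assms] assms by (metis spanner_def)
  then show ?thesis using stretch_ge[OF uv, of 1 S] by simp
qed

text \<open>An edge need not be a shortest path, so only one direction holds.\<close>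

lemma stretch_le_edgewise:
  assumes S: "spanner G S"
    and r: "\<And>u v. {u, v} \<in> edges G \<Longrightarrow>
      of_nat (graph_dist (cost2 G) S u v) \<le> r * of_nat (cost2 G {u, v})"
  shows "stretch G S \<le> r"
proof (rule stretch_le)
  fix u v assume uv: "u \<in> verts G" "v \<in> verts G"
  have "of_nat (graph_dist (cost2 G) S u v) \<le> r * of_nat (path_weight (cost2 G) p)"
    if "is_path (edges G) u v p" for p
    using that
  proof (induction rule: path_induct)
    case (Cons x y p)
    have "x \<in> verts G" "y \<in> verts G"
      using Cons(1) inst by (auto simp: msp_instance_def simple_graph_def)
    then have "linked S x y" "linked S y v" using spanner_linked[OF S] uv by auto
    then have "rat_of_nat (graph_dist (cost2 G) S x v) \<le>
        of_nat (graph_dist (cost2 G) S x y) + of_nat (graph_dist (cost2 G) S y v)"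
      using graph_dist_triangle by (metis of_nat_add of_nat_mono)
    then show ?case using Cons(4) r[OF Cons(1)] by (simp add: path_weight_Cons algebra_simps)
  qed simp
  moreover obtain p where "is_path (edges G) u v p"
      "path_weight (cost2 G) p = graph_dist (cost2 G) (edges G) u v"
    using graph_dist_path[OF spanner_linked[OF spanner_edges uv]] by metis
  ultimately show "of_nat (graph_dist (cost2 G) S u v) \<le>
      r * of_nat (graph_dist (cost2 G) (edges G) u v)" by metis
qed

lemma stretch_mono:
  assumes "spanner G S" and "S \<subseteq> S'" and "S' \<subseteq> edges G"
  shows "stretch G S' \<le> stretch G S"
proof (rule stretch_le)
  fix u v assume uv: "u \<in> verts G" "v \<in> verts G" "u \<noteq> v"
  let ?d = "\<lambda>F. graph_dist (cost2 G) F u v"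
  have "?d S' \<le> ?d S" using graph_dist_mono[OF spanner_linked[OF assms(1) uv(1,2)] assms(2)] .
  then have "rat_of_nat (?d S') / of_nat (?d (edges G)) \<le> of_nat (?d S) / of_nat (?d (edges G))"
    by (simp add: divide_right_mono)
  also have "\<dots> \<le> stretch G S"
    using uv dist_edges_pos[OF uv] by (intro stretch_ge[OF uv]) simp
  finally show "of_nat (?d S') \<le> stretch G S * of_nat (?d (edges G))"
    using dist_edges_pos[OF uv] by (simp add: pos_divide_le_eq)
qed

lemma msp_value_improve:
  assumes S: "spanner G S" and B: "B \<subseteq> edges G" and cost: "\<And>e. e \<in> B \<Longrightarrow> cost1 G e \<le> 0"
  shows "spanner G (S \<union> B)" and "total_cost G (S \<union> B) \<le> total_cost G S"
    and "stretch G (S \<union> B) \<le> stretch G S"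
proof -
  have sub: "S \<union> B \<subseteq> edges G" using S B by (auto simp: spanner_def)
  show "spanner G (S \<union> B)" using spanner_mono[OF S _ sub] by blast
  show "stretch G (S \<union> B) \<le> stretch G S" using stretch_mono[OF S _ sub] by blast
  have "total_cost G (S \<union> B) = total_cost G S + total_cost G (B - S)"
    unfolding total_cost_def
    using sum.union_disjoint[of S "B - S"] finite_subset[OF sub finite_edges] by simp
  moreover have "total_cost G (B - S) \<le> 0"
    unfolding total_cost_def using cost by (intro sum_nonpos) auto
  ultimately show "total_cost G (S \<union> B) \<le> total_cost G S" by simp
qed

end

section \<open>Outerplanarity of noncrossing edge sets\<close>

text \<open>Vertices are placed on the parabola \<open>y = x\<^sup>2\<close> and edges are drawn as chords. The drawing lies
  in the convex set above the parabola, whose complement belongs to the outer face.\<close>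

definition parabola :: "nat \<Rightarrow> complex" where
  "parabola v = Complex (real v) ((real v)\<^sup>2)"

definition chord :: "nat set \<Rightarrow> real \<Rightarrow> complex" where
  "chord e = linepath (parabola (Min e)) (parabola (Max e))"

lemma parabola_eq_iff [simp]: "parabola u = parabola v \<longleftrightarrow> u = v"
  by (auto simp: parabola_def)

text \<open>The product in the last claim is the height of the chord above the parabola. It turns
  questions about meeting chords into algebra in \<open>Re z\<close>.\<close>

lemma segment_parabola:
  assumes "z \<in> closed_segment (parabola j) (parabola k)" and "j \<le> k"
  shows "real j \<le> Re z" and "Re z \<le> real k"
    and "Im z = (Re z)\<^sup>2 + (Re z - real j) * (real k - Re z)"
proof -
  obtain t where t: "0 \<le> t" "t \<le> 1" and z: "z = (1 - t) *\<^sub>R parabola j + t *\<^sub>R parabola k"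
    using assms(1) by (auto simp: closed_segment_def)
  have re: "Re z = (1 - t) * real j + t * real k"
    and im: "Im z = (1 - t) * (real j)\<^sup>2 + t * (real k)\<^sup>2"
    by (simp_all add: z parabola_def)
  have "Re z - real j = t * (real k - real j)" "real k - Re z = (1 - t) * (real k - real j)"
    by (simp_all add: re algebra_simps)
  moreover have "0 \<le> t * (real k - real j)" "0 \<le> (1 - t) * (real k - real j)"
    using t assms(2) by simp_all
  ultimately show "real j \<le> Re z" "Re z \<le> real k" by (metis diff_ge_0_iff_ge)+
  show "Im z = (Re z)\<^sup>2 + (Re z - real j) * (real k - Re z)"
    unfolding re im by (simp add: power2_eq_square algebra_simps)
qed

lemma segment_parabola_eqI:
  assumes "Im z = (Re z)\<^sup>2" and "Re z = real v"
  shows "z = parabola v"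
  using assms by (simp add: parabola_def complex_eq_iff)

text \<open>Over intervals that lie side by side, a common point must have the shared end as its
  abscissa. For nested intervals the outer chord exceeds the inner one in height at \<open>x\<close>
  by \<open>(j' - j) * (k - x) + (x - j') * (k - k')\<close>. Both terms are nonnegative, so chords
  that meet strictly inside the inner interval coincide.\<close>

lemma segments_parabola_meet:
  assumes z: "z \<in> closed_segment (parabola j) (parabola k)"
      "z \<in> closed_segment (parabola j') (parabola k')"
    and lt: "j < k" "j' < k'" and ne: "{j, k} \<noteq> {j', k'}"
    and order: "k \<le> j' \<or> j \<le> j' \<and> k' \<le> k"
  shows "z \<in> parabola ` ({j, k} \<inter> {j', k'})"
proof -
  let ?x = "Re z"
  note seg = segment_parabola[OF z(1) less_imp_le[OF lt(1)]]
    segment_parabola[OF z(2) less_imp_le[OF lt(2)]]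
  consider "k \<le> j'" | "j \<le> j'" "k' \<le> k" using order by blast
  then show ?thesis
  proof cases
    case 1
    then have "k = j'" "?x = real k" using seg by linarith+
    moreover have "z = parabola k" using seg \<open>?x = real k\<close> by (intro segment_parabola_eqI) auto
    ultimately show ?thesis by auto
  next
    case 2
    have eq: "(?x - real j) * (real k - ?x) = (?x - real j') * (real k' - ?x)"
      using seg by simp
    have "\<exists>v\<in>{j, k} \<inter> {j', k'}. ?x = real v"
    proof (cases "?x = real j' \<or> ?x = real k'")
      case True
      then show ?thesis
      proof
        assume x: "?x = real j'"
        then have "(real j' - real j) * (real k - real j') = 0" using eq by simp
        then have "j' = j \<or> k = j'" by auto
        then show ?thesis using x by auto
      next
        assume x: "?x = real k'"
        then have "(real k' - real j) * (real k - real k') = 0" using eq by simp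
        then have "k' = j \<or> k = k'" by auto
        then show ?thesis using x by auto
      qed
    next
      case False
      then have pos: "0 < ?x - real j'" "0 < real k' - ?x" using seg by linarith+
      have "(?x - real j) * (real k - ?x) - (?x - real j') * (real k' - ?x) =
          (real j' - real j) * (real k - ?x) + (?x - real j') * (real k - real k')"
        by (simp add: algebra_simps)
      moreover have "0 \<le> (real j' - real j) * (real k - ?x)"
        using 2 seg by simp
      moreover have "0 \<le> (?x - real j') * (real k - real k')" using 2 seg by simp
      ultimately have "(real j' - real j) * (real k - ?x) = 0"
        "(?x - real j') * (real k - real k') = 0" using eq by linarith+
      moreover have "real k - ?x > 0" using pos 2(2) by linarith
      ultimately have "j = j'" "k = k'" using pos by auto
      then show ?thesis using ne by simp
    qed
    then obtain v where v: "v \<in> {j, k} \<inter> {j', k'}" "?x = real v" by blast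
    moreover have "z = parabola v" using seg v by (intro segment_parabola_eqI) auto
    ultimately show ?thesis by blast
  qed
qed

lemma convex_above_parabola: "convex {z. (Re z)\<^sup>2 \<le> Im z}"
proof (rule convexI)
  fix x y :: complex and u v :: real
  assume x: "x \<in> {z. (Re z)\<^sup>2 \<le> Im z}" and y: "y \<in> {z. (Re z)\<^sup>2 \<le> Im z}"
    and uv: "0 \<le> u" "0 \<le> v" "u + v = 1"
  have v: "v = 1 - u" using uv by simp
  have "u * (Re x)\<^sup>2 + v * (Re y)\<^sup>2 - (u * Re x + v * Re y)\<^sup>2 = u * v * (Re x - Re y)\<^sup>2"
    unfolding v by (simp add: power2_eq_square algebra_simps)
  moreover have "0 \<le> u * v * (Re x - Re y)\<^sup>2" using uv by simp
  ultimately have "(u * Re x + v * Re y)\<^sup>2 \<le> u * (Re x)\<^sup>2 + v * (Re y)\<^sup>2" by linarith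
  also have "\<dots> \<le> u * Im x + v * Im y" using x y uv by (intro add_mono mult_left_mono) auto
  finally show "u *\<^sub>R x + v *\<^sub>R y \<in> {z. (Re z)\<^sup>2 \<le> Im z}" by simp
qed

lemma card_2_nat:
  fixes e :: "nat set"
  assumes "card e = 2"
  obtains j k where "e = {j, k}" "j < k"
  using assms by (metis card_2_iff insert_commute linorder_neqE_nat)

lemma path_image_chord:
  "j < k \<Longrightarrow> path_image (chord {j, k}) = closed_segment (parabola j) (parabola k)"
  by (simp add: chord_def)

lemma plane_drawing_chords:
  fixes E :: "nat set set"
  assumes E: "\<And>e. e \<in> E \<Longrightarrow> card e = 2"
    and nc: "\<And>j k j' k'. {j, k} \<in> E \<Longrightarrow> {j', k'} \<in> E \<Longrightarrow> \<not> (j < j' \<and> j' < k \<and> k < k')"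
  shows "plane_drawing V E parabola chord"
  unfolding plane_drawing_def
proof (intro conjI ballI impI)
  show "inj_on parabola V" by (simp add: inj_on_def)
next
  fix e assume "e \<in> E"
  then obtain j k where e: "e = {j, k}" "j < k" using E card_2_nat by metis
  show "arc (chord e)" using e by (simp add: chord_def)
  show "{pathstart (chord e), pathfinish (chord e)} = parabola ` e"
    using e by (simp add: chord_def)
next
  fix e v assume "e \<in> E" and v: "parabola v \<in> path_image (chord e)"
  then obtain j k where e: "e = {j, k}" "j < k" using E card_2_nat by metis
  have "parabola v \<in> closed_segment (parabola j) (parabola k)"
    using v e path_image_chord by simp
  from segment_parabola(3)[OF this] e have "(real v - real j) * (real k - real v) = 0"
    by (simp add: parabola_def)
  then show "v \<in> e" using e by auto
next
  fix e e' assume e: "e \<in> E" and e': "e' \<in> E" and ne: "e \<noteq> e'"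
  obtain j k where jk: "e = {j, k}" "j < k" using E[OF e] card_2_nat by metis
  obtain j' k' where jk': "e' = {j', k'}" "j' < k'" using E[OF e'] card_2_nat by metis
  show "path_image (chord e) \<inter> path_image (chord e') \<subseteq> parabola ` (e \<inter> e')"
  proof
    fix z assume "z \<in> path_image (chord e) \<inter> path_image (chord e')"
    then have z: "z \<in> closed_segment (parabola j) (parabola k)"
        "z \<in> closed_segment (parabola j') (parabola k')"
      using jk jk' path_image_chord by auto
    have "\<not> (j < j' \<and> j' < k \<and> k < k')" "\<not> (j' < j \<and> j < k' \<and> k' < k)"
      using nc e e' jk jk' by blast+
    then consider "k \<le> j' \<or> j \<le> j' \<and> k' \<le> k" | "k' \<le> j \<or> j' \<le> j \<and> k \<le> k'" by linarith
    then show "z \<in> parabola ` (e \<inter> e')"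
    proof cases
      case 1
      then show ?thesis using segments_parabola_meet[OF z jk(2) jk'(2)] ne jk jk' by simp
    next
      case 2
      then show ?thesis
        using segments_parabola_meet[OF z(2,1) jk'(2) jk(2)] ne jk jk' by (simp add: Int_commute)
    qed
  qed
qed

lemma outerplanar_noncrossing:
  fixes E :: "nat set set"
  assumes E: "\<And>e. e \<in> E \<Longrightarrow> card e = 2"
    and nc: "\<And>j k j' k'. {j, k} \<in> E \<Longrightarrow> {j', k'} \<in> E \<Longrightarrow> \<not> (j < j' \<and> j' < k \<and> k < k')"
  shows "outerplanar V E"
  unfolding outerplanar_def
proof (intro exI conjI ballI)
  show "plane_drawing V E parabola chord" using assms by (rule plane_drawing_chords)
next
  fix v assume v: "v \<in> V"
  define K where "K = parabola ` V \<union> (\<Union>e\<in>E. path_image (chord e))"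
  let ?P = "{z. (Re z)\<^sup>2 \<le> Im z}"
  have "parabola u \<in> ?P" for u by (simp add: parabola_def)
  then have "closed_segment (parabola j) (parabola k) \<subseteq> ?P" for j k
    using closed_segment_subset[OF _ _ convex_above_parabola] by blast
  then have "K \<subseteq> ?P" unfolding K_def using \<open>\<And>u. parabola u \<in> ?P\<close>
    by (auto simp: chord_def)
  then have out: "- ?P \<subseteq> outside K"
    using outside_mono[of K ?P] outside_convex[OF convex_above_parabola] by simp
  \<comment> \<open>The points vertically below a vertex leave the region above the parabola at once
    and converge to the vertex.\<close>
  have "parabola v \<in> closure (outside K)"
    unfolding closure_approachable
  proof (intro allI impI)
    fix \<epsilon> :: real assume "0 < \<epsilon>"
    let ?y = "parabola v - Complex 0 (\<epsilon> / 2)"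
    have "?y \<in> outside K" using out \<open>0 < \<epsilon>\<close> by (auto simp: parabola_def)
    moreover have "dist ?y (parabola v) < \<epsilon>"
      using \<open>0 < \<epsilon>\<close> by (simp add: dist_norm complex_norm)
    ultimately show "\<exists>y\<in>outside K. dist y (parabola v) < \<epsilon>" by blast
  qed
  moreover have "parabola v \<in> K" using v by (simp add: K_def)
  then have "parabola v \<notin> outside K" using outside_no_overlap[of K] by blast
  ultimately show "parabola v \<in> frontier (outside (parabola ` V \<union> (\<Union>e\<in>E. path_image (chord e))))"
    unfolding frontier_def K_def[symmetric] using interior_subset by blast
qed

section \<open>The graph of the reduction\<close>

text \<open>The binary representation of \<open>base m i\<close> consists of \<open>m + i\<close> ones, so the reduction can write
  down all vertex names and edge lengths without any arithmetic.\<close>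

definition base :: "nat \<Rightarrow> nat \<Rightarrow> nat" where
  "base m i = 2 ^ (m + i) - 1"

lemma Suc_base: "Suc (base m i) = 2 ^ (m + i)"
  by (simp add: base_def)

lemma base_Suc: "base m (Suc i) = 2 * base m i + 1"
  using Suc_base[of m i] Suc_base[of m "Suc i"] by simp

lemma base_strict_mono: "i < j \<Longrightarrow> base m i < base m j"
proof -
  assume "i < j"
  then have "(2::nat) ^ (m + i) < 2 ^ (m + j)" by simp
  then show ?thesis using Suc_base[of m i] Suc_base[of m j] by linarith
qed

lemma base_eq_iff [simp]: "base m i = base m j \<longleftrightarrow> i = j"
  using base_strict_mono[of i j m] base_strict_mono[of j i m] by (cases i j rule: linorder_cases) auto

text \<open>The factor 4 leaves different residues for the corners of a triangle and costs only two
  bits. As \<open>base m\<close> increases, the names increase along the chain, so the order of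
  numbers is the order on the Hamiltonian path. The names 0 and 1 remain free for its first two
  vertices when \<open>0 < m\<close>.\<close>

definition va :: "nat \<Rightarrow> nat \<Rightarrow> nat" where "va m i = 4 * base m i"
definition vp :: "nat \<Rightarrow> nat \<Rightarrow> nat" where "vp m i = 4 * base m i + 1"
definition vb :: "nat \<Rightarrow> nat \<Rightarrow> nat" where "vb m i = 4 * base m i + 2"

lemma vertex_eq_iff [simp]:
  "va m i = va m j \<longleftrightarrow> i = j" "vp m i = vp m j \<longleftrightarrow> i = j" "vb m i = vb m j \<longleftrightarrow> i = j"
  by (simp_all add: va_def vp_def vb_def)

lemma vertex_neq [simp]:
  "va m i \<noteq> vp m j" "va m i \<noteq> vb m j" "vp m i \<noteq> vb m j"
  "vp m i \<noteq> va m j" "vb m i \<noteq> va m j" "vb m i \<noteq> vp m j"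
  unfolding va_def vp_def vb_def by presburger+

type_synonym edge = "nat \<times> nat \<times> int \<times> nat"

text \<open>The first costs add up to zero, so the full edge set is neutral and leaving out the
  shortcut earns \<open>c i\<close>. The detour \<open>2 * d i + 2\<close> is split into two odd,
  hence positive lengths, and \<open>2 * d i + 1\<close> is the code of \<open>d i\<close> with one
  bit prepended.\<close>

definition gadget :: "nat \<Rightarrow> (nat \<Rightarrow> nat) \<Rightarrow> (nat \<Rightarrow> nat) \<Rightarrow> nat \<Rightarrow> edge list" where
  "gadget m c d i =
     [(va m i, vp m i, - int (c i), 1), (vp m i, vb m i, 0, 2 * d i + 1),
      (va m i, vb m i, int (c i), 2), (vb m i, va m (Suc i), 0, 2 * base m i)]"

text \<open>The initial lengths add up to \<open>2 * 2 ^ m\<close>, the starting value that the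
  gadgets then double. The intermediate vertex 1 saves an addition and keeps the chain from being
  parallel to the closing edge when there are no items. The newest gadget comes first because the
  program builds the list by prepending.\<close>

primrec chain_edges :: "nat \<Rightarrow> (nat \<Rightarrow> nat) \<Rightarrow> (nat \<Rightarrow> nat) \<Rightarrow> nat \<Rightarrow> edge list" where
  "chain_edges m c d 0 = [(0, 1, 0, 2), (1, va m 0, 0, 2 * base m 0)]"
| "chain_edges m c d (Suc i) = gadget m c d i @ chain_edges m c d i"

primrec chain_verts :: "nat \<Rightarrow> nat \<Rightarrow> nat list" where
  "chain_verts m 0 = [0, 1]"
| "chain_verts m (Suc i) = [va m i, vp m i, vb m i] @ chain_verts m i"

text \<open>The large first cost of the closing edge is the name of its end \<open>va m n\<close>, a
  number whose code is already at hand.\<close>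

definition edge_list :: "nat \<Rightarrow> (nat \<Rightarrow> nat) \<Rightarrow> (nat \<Rightarrow> nat) \<Rightarrow> nat \<Rightarrow> edge list" where
  "edge_list m c d n = (0, va m n, int (va m n), 2) # chain_edges m c d n"

definition vert_list :: "nat \<Rightarrow> nat \<Rightarrow> nat list" where
  "vert_list m n = va m n # chain_verts m n"

definition ends :: "edge \<Rightarrow> nat set" where
  "ends = (\<lambda>(u, v, a, b). {u, v})"

lemma ends_simp [simp]: "ends (u, v, a, b) = {u, v}"
  by (simp add: ends_def)

text \<open>A table lookup by the set of end vertices, since the costs of an instance are functions
  on such sets. Away from the listed edges the value is unspecified.\<close>

definition labels :: "edge list \<Rightarrow> nat set \<Rightarrow> int \<times> nat" where
  "labels es e = the (map_of (map (\<lambda>e. (ends e, snd (snd e))) es) e)"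

lemma labels_eq:
  assumes "distinct (map ends es)" and "(u, v, a, b) \<in> set es"
  shows "labels es {u, v} = (a, b)"
proof -
  have "distinct (map fst (map (\<lambda>e. (ends e, snd (snd e))) es))"
    using assms(1) by (simp add: o_def)
  moreover have "({u, v}, (a, b)) \<in> set (map (\<lambda>e. (ends e, snd (snd e))) es)"
    using assms(2) by (force intro: rev_image_eqI)
  ultimately show ?thesis unfolding labels_def using map_of_is_SomeI by fastforce
qed

definition msp_of :: "nat list \<Rightarrow> edge list \<Rightarrow> msp" where
  "msp_of vs es = \<lparr>verts = set vs, edges = ends ` set es,
     cost1 = \<lambda>e. fst (labels es e), cost2 = \<lambda>e. snd (labels es e)\<rparr>"

lemma msp_code_msp_of:
  assumes "distinct vs" and "distinct (map ends es)"
  shows "msp_code (msp_of vs es) (enc_pair (enc_list enc_nat)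
    (enc_list (enc_pair enc_nat (enc_pair enc_nat (enc_pair enc_int enc_nat)))) (vs, es))"
  unfolding msp_code_def
  using assms labels_eq[OF assms(2)]
  by (intro exI[of _ vs] exI[of _ es]) (auto simp: msp_of_def ends_def[abs_def])

text \<open>The \<open>Suc\<close> in the second bound forces \<open>0 < m\<close> and gives
  \<open>1 + d i \<le> base m i\<close>: a connecting edge is at least as long as the detour next to
  it.\<close>

locale buco_chain =
  fixes m n :: nat and c d :: "nat \<Rightarrow> nat"
  assumes sum_c: "(\<Sum>i<n. c i) < 2 ^ m" and sum_d: "Suc (\<Sum>i<n. d i) < 2 ^ m"
begin

abbreviation "a \<equiv> va m"
abbreviation "p \<equiv> vp m"
abbreviation "b \<equiv> vb m"

definition "G = msp_of (vert_list m n) (edge_list m c d n)"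
definition "closing = {0, a n}"
definition "shortcut i = {a i, b i}"

lemma base_ge_1: "1 \<le> base m i"
proof -
  have "(2::nat) \<le> 2 ^ m" using sum_d by simp
  also have "\<dots> \<le> 2 ^ (m + i)" by simp
  finally show ?thesis using Suc_base[of m i] by linarith
qed

lemma base_pos [simp]: "0 < base m i"
  using base_ge_1[of i] by simp

lemma a_ge: "4 \<le> a i" and a_less_p: "a i < p i" and p_less_b: "p i < b i"
  and b_less_a: "b i < a (Suc i)"
  using base_ge_1[of i] by (auto simp: va_def vp_def vb_def base_Suc)

lemma a_mono: "i \<le> j \<Longrightarrow> a i \<le> a j"
  using base_strict_mono[of i j m] by (cases "i = j") (auto simp: va_def)

lemma vertex_pos [simp]:
  "a i \<noteq> 0" "a i \<noteq> Suc 0" "p i \<noteq> 0" "p i \<noteq> Suc 0" "b i \<noteq> 0" "b i \<noteq> Suc 0"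
  "0 \<noteq> a i" "Suc 0 \<noteq> a i" "0 \<noteq> p i" "Suc 0 \<noteq> p i" "0 \<noteq> b i" "Suc 0 \<noteq> b i"
  using a_ge[of i] a_less_p[of i] p_less_b[of i] by linarith+

text \<open>Serves to prove the edges distinct: the edges of a new gadget end beyond
  \<open>a i\<close>, where no older edge ends, and the last conjunct separates the closing edge
  from the other edge at 0.\<close>

lemma chain_edges_bounds:
  "(u, v, x, y) \<in> set (chain_edges m c d i) \<Longrightarrow> u < v \<and> v \<le> a i \<and> (u = 0 \<longrightarrow> v = 1)"
proof (induction i)
  case 0
  then show ?case using a_ge[of 0] by auto
next
  case (Suc i)
  have "a i < p i" "p i < b i" "b i < a (Suc i)" by (fact a_less_p p_less_b b_less_a)+
  then show ?case using Suc by (auto simp: gadget_def)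
qed

lemma distinct_edges: "distinct (map ends (edge_list m c d n))"
proof -
  have old: "{u, v} \<notin> ends ` set (chain_edges m c d i)" if "u < v" "a i < v" for u v i
  proof
    assume "{u, v} \<in> ends ` set (chain_edges m c d i)"
    then obtain u' v' x y where "(u', v', x, y) \<in> set (chain_edges m c d i)" "{u, v} = {u', v'}"
      by (auto simp: ends_def)
    then show False using chain_edges_bounds[of u' v' x y i] that by (auto simp: doubleton_eq_iff)
  qed
  have "distinct (map ends (chain_edges m c d i))" for i
  proof (induction i)
    case 0
    then show ?case by (auto simp: doubleton_eq_iff)
  next
    case (Suc i)
    have "a i < p i" "p i < b i" "b i < a (Suc i)" by (fact a_less_p p_less_b b_less_a)+
    then show ?case using Suc old[of "a i" "p i" i] old[of "p i" "b i" i] old[of "a i" "b i" i]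
        old[of "b i" "a (Suc i)" i]
      by (auto simp: gadget_def doubleton_eq_iff)
  qed
  moreover have "{0, a n} \<notin> ends ` set (chain_edges m c d n)"
  proof
    assume "{0, a n} \<in> ends ` set (chain_edges m c d n)"
    then obtain u' v' x y where "(u', v', x, y) \<in> set (chain_edges m c d n)" "{0, a n} = {u', v'}"
      by (auto simp: ends_def)
    then show False using chain_edges_bounds[of u' v' x y n] by (auto simp: doubleton_eq_iff)
  qed
  ultimately show ?thesis by (simp add: edge_list_def)
qed

lemma distinct_verts: "distinct (vert_list m n)"
proof -
  have *: "v \<in> set (chain_verts m i) \<Longrightarrow> v < a i" for v i
  proof (induction i)
    case (Suc i)
    have "a i < p i" "p i < b i" "b i < a (Suc i)" by (fact a_less_p p_less_b b_less_a)+
    then show ?case using Suc by auto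
  qed (use a_ge[of 0] in auto)
  have "distinct (chain_verts m i)" for i
  proof (induction i)
    case (Suc i)
    then show ?case using *[of "a i" i] *[of "p i" i] *[of "b i" i] a_less_p[of i] p_less_b[of i]
      by auto
  qed simp
  then show ?thesis using *[of "a n" n] by (auto simp: vert_list_def)
qed

lemma set_chain_edges:
  "set (chain_edges m c d i) = {(0, 1, 0, 2), (1, a 0, 0, 2 * base m 0)} \<union>
     (\<Union>j<i. set (gadget m c d j))"
  by (induction i) (auto simp: lessThan_Suc)

lemma set_edge_list:
  "set (edge_list m c d n) = {(0, a n, int (a n), 2), (0, 1, 0, 2), (1, a 0, 0, 2 * base m 0)} \<union>
     (\<Union>i<n. {(a i, p i, - int (c i), 1), (p i, b i, 0, 2 * d i + 1),
       (a i, b i, int (c i), 2), (b i, a (Suc i), 0, 2 * base m i)})"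
  by (auto simp: edge_list_def set_chain_edges gadget_def)

lemma verts_G: "verts G = {0, 1, a n} \<union> (\<Union>i<n. {a i, p i, b i})"
proof -
  have "set (chain_verts m i) = {0, 1} \<union> (\<Union>j<i. {a j, p j, b j})" for i
    by (induction i) (auto simp: lessThan_Suc)
  then show ?thesis by (auto simp: G_def msp_of_def vert_list_def)
qed

lemma edges_G: "edges G = {closing, {0, 1}, {1, a 0}} \<union>
    (\<Union>i<n. {{a i, p i}, {p i, b i}, shortcut i, {b i, a (Suc i)}})"
  by (simp add: G_def msp_of_def set_edge_list closing_def shortcut_def image_Un image_UN)

lemma edge_costs:
  assumes "(u, v, x, y) \<in> set (edge_list m c d n)"
  shows "cost1 G {u, v} = x" and "cost2 G {u, v} = y"
  using labels_eq[OF distinct_edges assms] by (auto simp: G_def msp_of_def)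

lemma costs [simp]:
  "cost1 G closing = int (a n)" "cost2 G closing = 2"
  "cost2 G {0, a n} = 2"
  "cost1 G {0, 1} = 0" "cost2 G {0, 1} = 2"
  "cost1 G {1, a 0} = 0" "cost2 G {1, a 0} = 2 * base m 0"
  and gadget_costs [simp]:
  "i < n \<Longrightarrow> cost1 G {a i, p i} = - int (c i)" "i < n \<Longrightarrow> cost2 G {a i, p i} = 1"
  "i < n \<Longrightarrow> cost1 G {p i, b i} = 0" "i < n \<Longrightarrow> cost2 G {p i, b i} = 2 * d i + 1"
  "i < n \<Longrightarrow> cost1 G (shortcut i) = int (c i)" "i < n \<Longrightarrow> cost2 G (shortcut i) = 2"
  "i < n \<Longrightarrow> cost2 G {a i, b i} = 2"
  "i < n \<Longrightarrow> cost1 G {b i, a (Suc i)} = 0" "i < n \<Longrightarrow> cost2 G {b i, a (Suc i)} = 2 * base m i"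
  "cost1 G {0, Suc 0} = 0" "cost2 G {0, Suc 0} = 2"
  "cost1 G {Suc 0, a 0} = 0" "cost2 G {Suc 0, a 0} = 2 * base m 0"
  unfolding closing_def shortcut_def
  by (rule edge_costs; auto simp: set_edge_list)+

lemma edges_intros:
  "closing \<in> edges G" "{0, 1} \<in> edges G" "{1, a 0} \<in> edges G"
  unfolding edges_G by simp_all

lemma gadget_edges_intros:
  assumes "i < n"
  shows "{a i, p i} \<in> edges G" "{p i, b i} \<in> edges G" "shortcut i \<in> edges G"
    "{b i, a (Suc i)} \<in> edges G"
  unfolding edges_G by (rule UnI2, rule UN_I[of i]; simp add: assms)+

lemma edge_cases:
  assumes "e \<in> edges G"
  obtains "e = closing" | "e = {0, 1}" | "e = {1, a 0}"
    | i where "i < n" "e = {a i, p i}" | i where "i < n" "e = {p i, b i}"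
    | i where "i < n" "e = shortcut i" | i where "i < n" "e = {b i, a (Suc i)}"
proof -
  consider "e \<in> {closing, {0, 1}, {1, a 0}}"
    | i where "i < n" "e \<in> {{a i, p i}, {p i, b i}, shortcut i, {b i, a (Suc i)}}"
    using assms unfolding edges_G by auto
  then show ?thesis
  proof cases
    case 1
    then show ?thesis using that(1-3) by blast
  next
    case (2 i)
    then show ?thesis using that(4-7)[of i] by blast
  qed
qed

lemma edge_oriented:
  assumes "e \<in> edges G"
  obtains u v where "e = {u, v}" "u < v" "u \<in> verts G" "v \<in> verts G" "v \<le> a n"
proof -
  have "a i < p i" "p i < b i" "b i < a (Suc i)" "a i < b i" for i
    using a_less_p p_less_b b_less_a less_trans by blast+
  moreover have "a (Suc i) \<in> verts G" "p i \<le> a n" "b i \<le> a n" "a (Suc i) \<le> a n" if "i < n" for i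
    using that a_mono[of "Suc i" n] b_less_a[of i] p_less_b[of i]
    by (auto simp: verts_G)
  moreover have "a i \<in> verts G" "p i \<in> verts G" "b i \<in> verts G" "a 0 \<in> verts G" if "i < n" for i
    using that unfolding verts_G by auto
  moreover have "a 0 \<in> verts G" unfolding verts_G by (cases "n = 0") auto
  moreover have "0 \<in> verts G" "1 \<in> verts G" "a n \<in> verts G" by (simp_all add: verts_G)
  moreover have "1 < a 0" "0 < a n" "a 0 \<le> a n" "1 \<le> a n" using a_ge[of 0] a_ge[of n] a_mono[of 0 n] by auto
  ultimately show ?thesis
    by (cases rule: edge_cases[OF assms])
       (use that in \<open>force simp: closing_def shortcut_def\<close>)+
qed

text \<open>The Hamiltonian path from \<open>0\<close> to \<open>a n\<close> that takes every
  detour. Since it is connected, every edge set containing it is a spanner.\<close>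

definition "spine = edges G - {closing} - shortcut ` {..<n}"

lemma shortcut_eq_iff [simp]: "shortcut i = shortcut j \<longleftrightarrow> i = j"
  by (auto simp: shortcut_def doubleton_eq_iff)

lemma shortcut_neq_closing [simp]: "shortcut i \<noteq> closing" "closing \<noteq> shortcut i"
  by (auto simp: shortcut_def closing_def doubleton_eq_iff)

lemma spineI:
  assumes "e \<in> edges G" and "e \<noteq> closing" and "\<And>i. e \<noteq> shortcut i"
  shows "e \<in> spine"
  using assms by (auto simp: spine_def)

lemma spine_edges:
  "{0, 1} \<in> spine" "{1, a 0} \<in> spine"
  "i < n \<Longrightarrow> {a i, p i} \<in> spine" "i < n \<Longrightarrow> {p i, b i} \<in> spine"
  "i < n \<Longrightarrow> {b i, a (Suc i)} \<in> spine"
  by (rule spineI, (rule edges_intros gadget_edges_intros, assumption?)[1];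
      simp add: shortcut_def closing_def doubleton_eq_iff)+

lemma linked_spine_a: "i \<le> n \<Longrightarrow> linked spine 0 (a i)"
proof (induction i)
  case 0
  show ?case using linked_extend[OF spine_edges(1) linked_edge[OF spine_edges(2)]] .
next
  case (Suc i)
  then have i: "i < n" by simp
  then have "linked spine (a i) (a (Suc i))"
    by (intro linked_extend[OF spine_edges(3)] linked_extend[OF spine_edges(4)]
        linked_edge[OF spine_edges(5)])
  then show ?case using Suc linked_trans by auto
qed

lemma connected_spine: "graph_connected (verts G) spine"
proof -
  have "linked spine 0 v" if "v \<in> verts G" for v
  proof -
    have "linked spine 0 (a i)" "linked spine 0 (p i)" "linked spine 0 (b i)" if "i < n" for i
    proof -
      show a: "linked spine 0 (a i)" using linked_spine_a that by simp
      show p: "linked spine 0 (p i)"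
        using linked_trans[OF a linked_edge[OF spine_edges(3)[OF that]]] .
      show "linked spine 0 (b i)" using linked_trans[OF p linked_edge[OF spine_edges(4)[OF that]]] .
    qed
    then show ?thesis using that linked_spine_a[of n] linked_edge[OF spine_edges(1)]
      by (auto simp: verts_G)
  qed
  then show ?thesis unfolding graph_connected_linked using linked_sym linked_trans by metis
qed

lemma msp_instance_G: "msp_instance G"
  unfolding msp_instance_def
proof (intro conjI ballI)
  have "card e = 2" "e \<subseteq> verts G" if "e \<in> edges G" for e
    using that by (auto elim!: edge_oriented)
  then show "simple_graph (verts G) (edges G)"
    by (auto simp: simple_graph_def verts_G)
  have "card {0, a n} \<le> card (verts G)"
    by (rule card_mono) (auto simp: verts_G)
  then show "2 \<le> card (verts G)" by simp
  show "graph_connected (verts G) (edges G)"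
    using connected_spine linked_mono[of spine _ _ "edges G"]
    by (auto simp: graph_connected_linked spine_def)
next
  fix e assume "e \<in> edges G"
  then show "0 < cost2 G e"
    by (cases rule: edge_cases) simp_all
qed

section \<open>Outerplanarity and degrees of the constructed graph\<close>

lemma vertex_order: "a i < p i" "p i < b i" "b i < a (Suc i)" "a i < b i" "a i < a (Suc i)"
  "p i < a (Suc i)" "1 < a i" "1 < p i" "1 < b i"
  using a_less_p[of i] p_less_b[of i] b_less_a[of i] a_ge[of i] by linarith+

lemma edge_cases_oriented:
  assumes "{j, k} \<in> edges G" and "j < k"
  obtains "j = 0" "k = a n" | "j = 0" "k = 1" | "j = 1" "k = a 0"
    | i where "i < n" "j = a i" "k = p i" | i where "i < n" "j = p i" "k = b i"
    | i where "i < n" "j = a i" "k = b i" | i where "i < n" "j = b i" "k = a (Suc i)"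
proof -
  have *: "{j, k} = {u, v} \<Longrightarrow> u < v \<Longrightarrow> j = u \<and> k = v" for u v
    using assms(2) by (auto simp: doubleton_eq_iff)
  have pos: "0 < a n" "1 < a 0" using vertex_order(7) by (auto intro: less_trans)
  from assms(1) show ?thesis
  proof (cases rule: edge_cases)
    case 1
    then show ?thesis using that(1) *[of 0 "a n"] pos by (simp add: closing_def)
  next
    case 2
    then show ?thesis using that(2) *[of 0 1] by simp
  next
    case 3
    then show ?thesis using that(3) *[of 1 "a 0"] pos by simp
  next
    case (4 i)
    then show ?thesis using that(4) *[of "a i" "p i"] vertex_order[of i] by simp
  next
    case (5 i)
    then show ?thesis using that(5) *[of "p i" "b i"] vertex_order[of i] by simp
  next
    case (6 i)
    then show ?thesis using that(6) *[of "a i" "b i"] vertex_order[of i] by (simp add: shortcut_def)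
  next
    case (7 i)
    then show ?thesis using that(7) *[of "b i" "a (Suc i)"] vertex_order[of i] by simp
  qed
qed

text \<open>Names increase along the spine, so edges are intervals and crossing means interleaving.
  Every interval except that of the closing edge lies inside one gadget or before
  \<open>a 0\<close>. Inside a gadget the intervals are nested or side by side, and the closing edge
  encloses everything.\<close>

lemma noncrossing:
  assumes jk: "{j, k} \<in> edges G" and jk': "{j', k'} \<in> edges G"
  shows "\<not> (j < j' \<and> j' < k \<and> k < k')"
proof
  assume lt: "j < j' \<and> j' < k \<and> k < k'"
  then have "j < k" "j' < k'" by auto
  have an: "k' \<le> a n" using edge_oriented[OF jk'] \<open>j' < k'\<close> by (metis doubleton_eq_iff le_trans less_imp_le)
  have j': "j' \<le> 1 \<or> (\<exists>i<n. j' = a i \<and> (k' = p i \<or> k' = b i) \<or> j' = p i \<and> k' = b i \<or> j' = b i)"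
    using jk' \<open>j' < k'\<close> by (cases rule: edge_cases_oriented) auto
  have gadget: False if "a i \<le> j" "k \<le> a (Suc i)"
    and k: "j = a i \<and> k = p i \<or> j = p i \<and> k = b i \<or> j = a i \<and> k = b i \<or> j = b i \<and> k = a (Suc i)" for i
  proof -
    have "1 < j" using that vertex_order(7)[of i] by linarith
    then obtain i' where i': "j' = a i' \<and> (k' = p i' \<or> k' = b i') \<or> j' = p i' \<and> k' = b i' \<or> j' = b i'"
      using j' lt by auto
    \<comment> \<open>The ranges from \<open>a i\<close> to \<open>a (Suc i)\<close> of different
      gadgets share at most an end, whereas \<open>j'\<close> lies strictly between \<open>j\<close>
      and \<open>k\<close>.\<close>
    have "i' = i"
    proof (rule ccontr)
      assume "i' \<noteq> i"
      then have "a (Suc i') \<le> a i \<or> a (Suc i) \<le> a i'" using a_mono by (meson Suc_leI linorder_neqE_nat)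
      then show False using i' that vertex_order[of i'] lt by auto
    qed
    then show False using i' k lt vertex_order[of i] by auto
  qed
  have first: "a 0 \<le> j'" if ne: "\<not> j' \<le> 1"
  proof -
    obtain i where "j' = a i \<or> j' = p i \<or> j' = b i" using ne j' by auto
    then show ?thesis using a_mono[of 0 i] vertex_order[of i] by auto
  qed
  from jk \<open>j < k\<close> show False
  proof (cases rule: edge_cases_oriented)
    case 3
    then show ?thesis using lt first by auto
  next
    case (4 i)
    then show ?thesis using gadget[of i] vertex_order[of i] by auto
  next
    case (5 i)
    then show ?thesis using gadget[of i] vertex_order[of i] by auto
  next
    case (6 i)
    then show ?thesis using gadget[of i] vertex_order[of i] by auto
  next
    case (7 i)
    then show ?thesis using gadget[of i] vertex_order[of i] by auto
  qed (use lt an in auto)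
qed

lemma incident_subset:
  assumes "v \<in> closing \<Longrightarrow> closing \<in> T" "v \<in> {0, 1} \<Longrightarrow> {0, 1} \<in> T"
    "v \<in> {1, a 0} \<Longrightarrow> {1, a 0} \<in> T"
    "\<And>i. i < n \<Longrightarrow> v \<in> {a i, p i} \<Longrightarrow> {a i, p i} \<in> T"
    "\<And>i. i < n \<Longrightarrow> v \<in> {p i, b i} \<Longrightarrow> {p i, b i} \<in> T"
    "\<And>i. i < n \<Longrightarrow> v \<in> {a i, b i} \<Longrightarrow> shortcut i \<in> T"
    "\<And>i. i < n \<Longrightarrow> v \<in> {b i, a (Suc i)} \<Longrightarrow> {b i, a (Suc i)} \<in> T"
  shows "{e \<in> edges G. v \<in> e} \<subseteq> T"
proof
  fix e assume "e \<in> {e \<in> edges G. v \<in> e}"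
  then have "e \<in> edges G" "v \<in> e" by auto
  then show "e \<in> T"
  proof (cases rule: edge_cases)
    case (6 i)
    then show ?thesis using assms(6)[of i] \<open>v \<in> e\<close> by (simp add: shortcut_def)
  qed (use assms in blast)+
qed

lemma degree_bounded_G: "degree_bounded 3 (verts G) (edges G)"
  unfolding degree_bounded_def
proof
  fix v assume v: "v \<in> verts G"
  have card3: "card {e \<in> edges G. v \<in> e} \<le> 3" if "{e \<in> edges G. v \<in> e} \<subseteq> {x, y, z}" for x y z
  proof -
    have "card {e \<in> edges G. v \<in> e} \<le> card {x, y, z}" using that by (intro card_mono) auto
    also have "\<dots> \<le> 3" by (simp add: card_insert_if)
    finally show ?thesis .
  qed
  \<comment> \<open>\<open>prev i\<close> is the neighbour of \<open>a i\<close> on the spine in the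
    direction of 0. Below, sets with fewer than three edges are padded by repetition.\<close>
  define prev where "prev i = (if i = 0 then 1 else b (i - 1))" for i
  consider "v = 0" | "v = 1" | i where "i \<le> n" "v = a i" | i where "v = p i" | i where "v = b i"
    using v by (auto simp: verts_G)
  then show "card {e \<in> edges G. v \<in> e} \<le> 3"
  proof cases
    case 1
    have "{e \<in> edges G. v \<in> e} \<subseteq> {closing, {0, 1}, {0, 1}}"
      using 1 by (intro incident_subset) (auto simp: closing_def prev_def)
    then show ?thesis by (rule card3)
  next
    case 2
    have "{e \<in> edges G. v \<in> e} \<subseteq> {{0, 1}, {1, a 0}, {0, 1}}"
      using 2 by (intro incident_subset) (auto simp: closing_def prev_def)
    then show ?thesis by (rule card3)
  next
    case (3 i)
    show ?thesis
    proof (cases "i = n")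
      case True
      then have "{e \<in> edges G. v \<in> e} \<subseteq> {closing, {prev i, a i}, closing}"
        using 3 by (intro incident_subset) (auto simp: closing_def prev_def)
      then show ?thesis by (rule card3)
    next
      case False
      then have "{e \<in> edges G. v \<in> e} \<subseteq> {{prev i, a i}, {a i, p i}, shortcut i}"
        using 3 by (intro incident_subset) (auto simp: closing_def prev_def)
      then show ?thesis by (rule card3)
    qed
  next
    case (4 i)
    have "{e \<in> edges G. v \<in> e} \<subseteq> {{a i, p i}, {p i, b i}, {p i, b i}}"
      using 4 by (intro incident_subset) (auto simp: closing_def prev_def)
    then show ?thesis by (rule card3)
  next
    case (5 i)
    have "{e \<in> edges G. v \<in> e} \<subseteq> {{b i, a (Suc i)}, {p i, b i}, shortcut i}"
      using 5 by (intro incident_subset) (auto simp: closing_def prev_def)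
    then show ?thesis by (rule card3)
  qed
qed

end

section \<open>Solutions and their values\<close>

context buco_chain
begin

definition removed :: "nat set set \<Rightarrow> nat set" where
  "removed S = {i. i < n \<and> shortcut i \<notin> S}"

definition solution :: "nat set \<Rightarrow> nat set set" where
  "solution X = edges G - {closing} - shortcut ` X"

definition detour :: "nat set \<Rightarrow> nat \<Rightarrow> nat" where
  "detour X i = (if i \<in> X then 2 * d i else 0)"

text \<open>The length of the chain from \<open>0\<close> to \<open>a i\<close> when the shortcuts
  in \<open>X\<close> are missing. The first summand is the length with all shortcuts present, the
  second the total excess of the detours.\<close>

definition reach :: "nat set \<Rightarrow> nat \<Rightarrow> nat" where
  "reach X i = 2 * 2 ^ (m + i) + (\<Sum>j<i. detour X j)"

lemma reach_Suc: "reach X (Suc i) = reach X i + 2 + detour X i + 2 * base m i"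
  using Suc_base[of m i] by (simp add: reach_def)

lemma reach_0: "reach X 0 = 2 + 2 * base m 0"
  using Suc_base[of m 0] by (simp add: reach_def)

lemma reach_n: "X \<subseteq> {..<n} \<Longrightarrow> reach X n = 2 * (2 ^ (m + n) + sum d X)"
  by (simp add: reach_def detour_def sum.If_cases sum_distrib_left Int_absorb1)

lemma finite_edges_G: "finite (edges G)"
  using finite_edges[OF msp_instance_G] .

lemma spine_subset: "spine \<subseteq> edges G"
  by (auto simp: spine_def)

lemma spine_cost: "e \<in> spine \<Longrightarrow> cost1 G e \<le> 0"
  unfolding spine_def
proof (elim DiffE)
  assume "e \<in> edges G" "e \<notin> {closing}" "e \<notin> shortcut ` {..<n}"
  then show ?thesis by (cases rule: edge_cases) auto
qed

lemma spanner_spine: "spanner G spine"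
  using connected_spine spine_subset by (simp add: spanner_def)

lemma spanner_superset: "spine \<subseteq> S \<Longrightarrow> S \<subseteq> edges G \<Longrightarrow> spanner G S"
  using spanner_mono[OF msp_instance_G spanner_spine] .

text \<open>Costs cancel inside every gadget, so only the closing edge contributes. The cost of a
  solution then follows by subtracting the few edges it leaves out.\<close>

lemma total_cost_edges: "total_cost G (edges G) = int (a n)"
proof -
  have "total_cost G (edges G) = sum_list (map (cost1 G) (map ends (edge_list m c d n)))"
    using sum_list_distinct_conv_sum_set[OF distinct_edges, of "cost1 G"]
    by (simp add: total_cost_def G_def msp_of_def)
  also have "map (cost1 G) (map ends (edge_list m c d n)) = map (\<lambda>(u, v, x, y). x) (edge_list m c d n)"
    using edge_costs(1) by (auto simp: ends_def)
  also have "sum_list \<dots> = int (a n)"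
  proof -
    have "sum_list (map (\<lambda>(u, v, x, y). x) (chain_edges m c d i)) = 0" for i
      by (induction i) (auto simp: gadget_def)
    then show ?thesis by (simp add: edge_list_def)
  qed
  finally show ?thesis .
qed

lemma total_cost_minus:
  assumes "R \<subseteq> edges G"
  shows "total_cost G (edges G - R) = int (a n) - total_cost G R"
  using sum.subset_diff[OF assms finite_edges_G, of "cost1 G"] total_cost_edges
  by (simp add: total_cost_def)

lemma total_cost_shortcuts:
  assumes "X \<subseteq> {..<n}"
  shows "total_cost G (shortcut ` X) = int (sum c X)"
proof -
  have "total_cost G (shortcut ` X) = (\<Sum>i\<in>X. cost1 G (shortcut i))"
    unfolding total_cost_def by (simp add: sum.reindex inj_on_def)
  also have "\<dots> = (\<Sum>i\<in>X. int (c i))" using assms by (intro sum.cong) auto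
  finally show ?thesis by simp
qed

lemma removed_cost_subset: "sum c X < 2 ^ m" if "X \<subseteq> {..<n}"
  using sum_mono2[of "{..<n}" X c] sum_c that by auto

lemma superset_cases:
  assumes "spine \<subseteq> S" and "S \<subseteq> edges G"
  shows "closing \<notin> S \<Longrightarrow> S = solution (removed S)"
    and "closing \<in> S \<Longrightarrow> S = edges G - shortcut ` removed S"
  using assms edges_intros(1) unfolding solution_def removed_def spine_def by auto

lemma removed_solution: "X \<subseteq> {..<n} \<Longrightarrow> removed (solution X) = X"
  by (auto simp: removed_def solution_def gadget_edges_intros)

lemma total_cost_solution:
  assumes "X \<subseteq> {..<n}"
  shows "total_cost G (solution X) = - int (sum c X)"
proof -
  have sub: "shortcut ` X \<subseteq> edges G" using assms gadget_edges_intros by auto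
  then have "finite (shortcut ` X)" using finite_edges_G finite_subset by blast
  then have "total_cost G (insert closing (shortcut ` X)) = int (a n) + int (sum c X)"
    using total_cost_shortcuts[OF assms] by (simp add: total_cost_def image_iff)
  moreover have "solution X = edges G - insert closing (shortcut ` X)"
    by (auto simp: solution_def)
  ultimately show ?thesis
    using total_cost_minus[of "insert closing (shortcut ` X)"] sub edges_intros(1) by simp
qed

lemma total_cost_closed:
  assumes "X \<subseteq> {..<n}"
  shows "0 < total_cost G (edges G - shortcut ` X)"
proof -
  have sub: "shortcut ` X \<subseteq> edges G" using assms gadget_edges_intros by auto
  have "sum c X < 2 ^ m" using removed_cost_subset assms .
  also have "(2::nat) ^ m \<le> 2 ^ (m + n)" by simp
  also have "\<dots> = Suc (base m n)" by (simp add: Suc_base)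
  also have "\<dots> \<le> a n" using base_ge_1[of n] by (simp add: va_def)
  finally show ?thesis
    using total_cost_minus[OF sub] total_cost_shortcuts[OF assms] by linarith
qed

section \<open>Distances and stretch in a spanner that contains the spine\<close>

context
  fixes S
  assumes S: "spine \<subseteq> S" "S \<subseteq> edges G"
begin

abbreviation "dist_S \<equiv> graph_dist (cost2 G) S"

lemma linked_S: "u \<in> verts G \<Longrightarrow> v \<in> verts G \<Longrightarrow> linked S u v"
  using spanner_superset[OF S] spanner_linked[OF msp_instance_G] by blast

lemma verts_intros: "0 \<in> verts G" "1 \<in> verts G" "i \<le> n \<Longrightarrow> a i \<in> verts G"
  "i < n \<Longrightarrow> p i \<in> verts G" "i < n \<Longrightarrow> b i \<in> verts G"
  unfolding verts_G by (cases "i = n"; auto)+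

lemma dist_spine_le: "{u, v} \<in> spine \<Longrightarrow> dist_S u v \<le> cost2 G {u, v}"
  using graph_dist_edge[OF subsetD[OF S(1)]] .

lemma dist_shortcut_le:
  assumes "i < n"
  shows "dist_S (a i) (b i) \<le> 2 + detour (removed S) i"
proof (cases "i \<in> removed S")
  case True
  have "dist_S (a i) (b i) \<le> dist_S (a i) (p i) + dist_S (p i) (b i)"
    using assms by (intro graph_dist_triangle linked_S verts_intros) auto
  then show ?thesis
    using True assms dist_spine_le[OF spine_edges(3)[OF assms]] dist_spine_le[OF spine_edges(4)[OF assms]]
    by (simp add: detour_def)
next
  case False
  then have "{a i, b i} \<in> S" using assms by (simp add: removed_def shortcut_def)
  then show ?thesis using graph_dist_edge[of "a i" "b i" S "cost2 G"] assms by simp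
qed

lemma dist_a_le: "i \<le> n \<Longrightarrow> dist_S 0 (a i) \<le> reach (removed S) i"
proof (induction i)
  case 0
  have "dist_S 0 (a 0) \<le> dist_S 0 1 + dist_S 1 (a 0)"
    by (intro graph_dist_triangle linked_S verts_intros) auto
  then show ?case
    using dist_spine_le[OF spine_edges(1)] dist_spine_le[OF spine_edges(2)] by (simp add: reach_0)
next
  case (Suc i)
  have "dist_S 0 (a (Suc i)) \<le> dist_S 0 (a i) + dist_S (a i) (a (Suc i))"
    using Suc by (intro graph_dist_triangle linked_S verts_intros) auto
  moreover have "dist_S (a i) (a (Suc i)) \<le> dist_S (a i) (b i) + dist_S (b i) (a (Suc i))"
    using Suc by (intro graph_dist_triangle linked_S verts_intros) auto
  moreover have "dist_S (b i) (a (Suc i)) \<le> 2 * base m i"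
    using dist_spine_le[OF spine_edges(5)] Suc by fastforce
  ultimately show ?case using Suc dist_shortcut_le[of i] by (simp add: reach_Suc)
qed

lemma dist_potential:
  assumes "u \<in> verts G" and "v \<in> verts G"
    and "\<And>x y. {x, y} \<in> S \<Longrightarrow> x < y \<Longrightarrow> \<bar>\<phi> x - \<phi> y\<bar> \<le> int (cost2 G {x, y})"
  shows "\<phi> u - \<phi> v \<le> int (dist_S u v)"
proof -
  have "\<phi> x \<le> \<phi> y + int (cost2 G {x, y})" if "{x, y} \<in> S" for x y
    using assms(3)[of x y] assms(3)[of y x] that by (cases x y rule: linorder_cases) (auto simp: insert_commute)
  then show ?thesis using graph_dist_potential[OF linked_S[OF assms(1,2)]] by fastforce
qed

text \<open>The potential is the distance from 0 along the chain. Without the closing edge, no edge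
  of \<open>S\<close> bridges more of it than its own length.\<close>

lemma dist_ends_ge:
  assumes "closing \<notin> S"
  shows "reach (removed S) n \<le> dist_S 0 (a n)"
proof -
  \<comment> \<open>Dividing a vertex name by 4 removes the residue of the corner, and injectivity
    of \<open>base m\<close> then returns the number of the gadget.\<close>
  define ix where "ix v = inv (base m) (v div 4)" for v
  have inj: "inj (base m)" by (auto simp: inj_def)
  have "a i div 4 = base m i" "p i div 4 = base m i" "b i div 4 = base m i" for i
    unfolding va_def vp_def vb_def by presburger+
  then have ix: "ix (a i) = i" "ix (p i) = i" "ix (b i) = i" for i
    by (simp_all add: ix_def inv_f_f[OF inj])
  \<comment> \<open>The only vertices below 4 are 0 and 1, at distances 0 and 2. For the others the
    residue modulo 4 tells \<open>a\<close>, \<open>p\<close> and \<open>b\<close> apart.\<close>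
  define \<phi> where "\<phi> v = (if v < 4 then 2 * int v else int (reach (removed S) (ix v)) +
      (if v mod 4 = 0 then 0 else if v mod 4 = 1 then 1 else 2 + int (detour (removed S) (ix v))))" for v
  have \<phi>: "\<phi> 0 = 0" "\<phi> 1 = 2" "\<phi> (a i) = int (reach (removed S) i)" "\<phi> (p i) = int (reach (removed S) i) + 1"
    "\<phi> (b i) = int (reach (removed S) i) + 2 + int (detour (removed S) i)" for i
  proof -
    have "\<not> a i < 4" "\<not> p i < 4" "\<not> b i < 4" using a_ge[of i] vertex_order[of i] by linarith+
    moreover have "a i mod 4 = 0" "p i mod 4 = 1" "b i mod 4 = 2"
      unfolding va_def vp_def vb_def by presburger+
    ultimately show "\<phi> (a i) = int (reach (removed S) i)" "\<phi> (p i) = int (reach (removed S) i) + 1"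
    "\<phi> (b i) = int (reach (removed S) i) + 2 + int (detour (removed S) i)" by (simp_all add: \<phi>_def ix)
  qed (simp_all add: \<phi>_def)
  \<comment> \<open>The sign is reversed because \<open>dist_potential\<close> bounds the potential
    of the first vertex minus that of the second, and here the first vertex is 0.\<close>
  have "\<bar>- \<phi> x - - \<phi> y\<bar> \<le> int (cost2 G {x, y})" if e: "{x, y} \<in> S" and lt: "x < y" for x y
  proof -
    have "{x, y} \<in> edges G" using e S by blast
    then show ?thesis using lt
    proof (cases rule: edge_cases_oriented)
      case 1
      then show ?thesis using e assms by (simp add: closing_def)
    next
      case (6 i)
      then have "detour (removed S) i = 0" using e by (simp add: detour_def removed_def shortcut_def)
      then show ?thesis using 6 by (simp add: \<phi>)
    next
      case (5 i)
      then show ?thesis by (simp add: \<phi> detour_def)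
    next
      case (7 i)
      then show ?thesis by (simp add: \<phi> reach_Suc)
    next
      case 2
      then show ?thesis using \<phi>(1,2) by simp
    next
      case 3
      then show ?thesis using \<phi>(2) \<phi>(3)[of 0] reach_0 by simp
    next
      case (4 i)
      then show ?thesis by (simp add: \<phi>)
    qed
  qed
  then have "- \<phi> 0 - - \<phi> (a n) \<le> int (dist_S 0 (a n))"
    by (intro dist_potential verts_intros) auto
  then show ?thesis by (simp add: \<phi>)
qed

text \<open>Even when the closing edge is present, the other way round the cycle is no shorter: the
  connecting edge at \<open>b i\<close> alone has length \<open>2 * base m i\<close>, which is at
  least \<open>2 + 2 * d i\<close>.\<close>

lemma dist_shortcut_ge:
  assumes "i \<in> removed S"
  shows "2 + 2 * d i \<le> dist_S (a i) (b i)"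
proof -
  have i: "i < n" "{a i, b i} \<notin> S" using assms by (auto simp: removed_def shortcut_def)
  have "Suc (d i) < 2 ^ m" using sum_d member_le_sum[of i "{..<n}" d] i(1) by auto
  also have "(2::nat) ^ m \<le> 2 ^ (m + i)" by simp
  finally have big: "1 + d i \<le> base m i" using Suc_base[of m i] by linarith
  \<comment> \<open>Only \<open>p i\<close> and \<open>b i\<close> are away from level 0, so apart
    from the missing shortcut just the two detour edges and the connecting edge at
    \<open>b i\<close> change the potential.\<close>
  define \<phi> where "\<phi> v = (if v = p i then -1 else if v = b i then - (2 + 2 * int (d i)) else 0)" for v
  have "\<bar>\<phi> x - \<phi> y\<bar> \<le> int (cost2 G {x, y})" if e: "{x, y} \<in> S" and lt: "x < y" for x y
  proof -
    have "{x, y} \<in> edges G" using e S by blast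
    then show ?thesis using lt
      by (cases rule: edge_cases_oriented) (use e i big in \<open>auto simp: \<phi>_def\<close>)
  qed
  then have "\<phi> (a i) - \<phi> (b i) \<le> int (dist_S (a i) (b i))"
    using i(1) by (intro dist_potential verts_intros) auto
  then show ?thesis by (simp add: \<phi>_def)
qed

text \<open>An edge of \<open>S\<close> has quotient at most 1. A missing edge is a shortcut or the
  closing edge; both have length 2, which explains the factors between the lengths and
  \<open>k\<close>.\<close>

lemma stretch_le_removed:
  assumes k: "1 \<le> k" "\<And>i. i \<in> removed S \<Longrightarrow> 1 + d i \<le> k"
    and reach: "closing \<notin> S \<Longrightarrow> reach (removed S) n \<le> 2 * k"
  shows "stretch G S \<le> of_nat k"
proof (rule stretch_le_edgewise[OF msp_instance_G spanner_superset[OF S]])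
  define r :: rat where "r = of_nat k"
  have r: "1 \<le> r" "\<And>i. i \<in> removed S \<Longrightarrow> rat_of_nat (1 + d i) \<le> r"
    using k by (simp_all only: r_def of_nat_le_iff one_of_nat_le_iff)
  have closing: "rat_of_nat (reach (removed S) n) \<le> 2 * r" if "closing \<notin> S"
    using of_nat_mono[OF reach[OF that], where 'a = rat] by (simp add: r_def)
  have main: "rat_of_nat (dist_S u v) \<le> r * rat_of_nat (cost2 G {u, v})"
    if e: "{u, v} \<in> edges G" and lt: "u < v" for u v
  proof (cases "{u, v} \<in> S")
    case True
    then have "rat_of_nat (dist_S u v) \<le> of_nat (cost2 G {u, v})"
      by (intro of_nat_mono graph_dist_edge True)
    also have "\<dots> \<le> r * of_nat (cost2 G {u, v})" using r(1) by (simp add: mult_le_cancel_right1)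
    finally show ?thesis .
  next
    case False
    have "{u, v} \<notin> spine" using False S by blast
    then consider "{u, v} = closing" | i where "i < n" "{u, v} = shortcut i"
      using e by (auto simp: spine_def)
    then show ?thesis
    proof cases
      case 1
      then have "u = 0" "v = a n" using lt by (auto simp: closing_def doubleton_eq_iff)
      then show ?thesis using closing False 1 dist_a_le[of n] by (simp add: mult.commute)
    next
      case (2 i)
      then have uv: "u = a i" "v = b i" using lt vertex_order[of i]
        by (auto simp: shortcut_def doubleton_eq_iff)
      have rem: "i \<in> removed S" using 2 False by (simp add: removed_def)
      have "dist_S u v \<le> 2 * (1 + d i)" using dist_shortcut_le[OF 2(1)] rem uv by (simp add: detour_def)
      then have "rat_of_nat (dist_S u v) \<le> of_nat (2 * (1 + d i))" by (rule of_nat_mono)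
      also have "\<dots> = 2 * of_nat (1 + d i)" by simp
      also have "\<dots> \<le> 2 * r" using r(2)[OF rem] by simp
      finally show ?thesis using 2 uv by (simp add: mult.commute)
    qed
  qed
  fix u v assume e: "{u, v} \<in> edges G"
  then have "card {u, v} = 2" and V: "u \<in> verts G" "v \<in> verts G"
    using msp_instance_G by (auto simp: msp_instance_def simple_graph_def)
  then have "u \<noteq> v" by auto
  then show "rat_of_nat (dist_S u v) \<le> of_nat k * rat_of_nat (cost2 G {u, v})"
    unfolding r_def[symmetric]
    using main[of u v] main[of v u] e graph_dist_sym[OF linked_S[OF V]]
    by (cases u v rule: linorder_cases) (auto simp: insert_commute)
qed

lemma stretch_ge_of_nat:
  assumes "u \<in> verts G" "v \<in> verts G" "u \<noteq> v" "{u, v} \<in> edges G"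
    and "cost2 G {u, v} = 2" and "2 * k \<le> dist_S u v"
  shows "of_nat k \<le> stretch G S"
proof (rule stretch_ge[OF msp_instance_G assms(1-3)])
  have "k * graph_dist (cost2 G) (edges G) u v \<le> k * 2"
    using graph_dist_edge[OF assms(4), of "cost2 G"] assms(5) by simp
  also have "\<dots> \<le> dist_S u v" using assms(6) by simp
  finally show "rat_of_nat k * of_nat (graph_dist (cost2 G) (edges G) u v) \<le> of_nat (dist_S u v)"
    by (metis of_nat_le_iff of_nat_mult)
qed

lemma stretch_open:
  assumes "closing \<notin> S"
  shows "stretch G S = of_nat (2 ^ (m + n) + sum d (removed S))"
proof (rule antisym)
  let ?X = "removed S"
  let ?r = "2 ^ (m + n) + sum d ?X"
  have X: "?X \<subseteq> {..<n}" by (auto simp: removed_def)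
  \<comment> \<open>Already the constant part \<open>2 ^ (m + n) \<ge> 1\<close> lifts the quotient
    of the closing edge to at least that of any removed shortcut.\<close>
  have "1 + d i \<le> ?r" if "i \<in> ?X" for i
    using member_le_sum[of i ?X d] that finite_subset[OF X] by (intro add_mono) auto
  then show "stretch G S \<le> of_nat ?r"
    using reach_n[OF X]
    by (intro stretch_le_removed) (auto simp: Suc_le_eq)
  show "of_nat ?r \<le> stretch G S"
    using dist_ends_ge[OF assms] reach_n[OF X] edges_intros(1)
    by (intro stretch_ge_of_nat) (auto simp: closing_def verts_intros)
qed

text \<open>The stretch is the largest quotient of a removed shortcut, or 1 if none is removed. What
  counts later is that it lies in a set of at most \<open>n + 1\<close> numbers that does not depend
  on \<open>S\<close>.\<close>

lemma stretch_closed: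
  assumes "closing \<in> S"
  shows "stretch G S \<in> of_nat ` insert 1 ((\<lambda>i. 1 + d i) ` {..<n})"
proof -
  let ?X = "removed S"
  let ?A = "insert 1 ((\<lambda>i. 1 + d i) ` ?X)"
  have X: "?X \<subseteq> {..<n}" by (auto simp: removed_def)
  then have fin: "finite ?A" using finite_subset by blast
  have in_A: "Max ?A \<in> ?A" using fin by (intro Max_in) auto
  have "stretch G S = of_nat (Max ?A)"
  proof (rule antisym)
    have "1 + d i \<le> Max ?A" if "i \<in> ?X" for i using fin that by (intro Max_ge) auto
    moreover have "1 \<le> Max ?A" using fin by (intro Max_ge) auto
    ultimately show "stretch G S \<le> of_nat (Max ?A)"
      using assms by (intro stretch_le_removed) auto
    consider "Max ?A = 1" | i where "i \<in> ?X" "Max ?A = 1 + d i" using in_A by blast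
    then show "of_nat (Max ?A) \<le> stretch G S"
    proof cases
      case 1
      then show ?thesis using stretch_ge_1[OF msp_instance_G spanner_superset[OF S]] by simp
    next
      case (2 i)
      then have i: "i < n" using X by auto
      show ?thesis unfolding 2
        using i dist_shortcut_ge[OF 2(1)] gadget_edges_intros(3)[OF i]
        by (intro stretch_ge_of_nat) (auto simp: shortcut_def verts_intros)
    qed
  qed
  then show ?thesis using in_A X by auto
qed

end

section \<open>Comparison of the nondominated sets\<close>

definition open_value :: "nat set \<Rightarrow> int \<times> rat" where
  "open_value X = (- int (sum c X), of_nat (2 ^ (m + n) + sum d X))"

lemma open_value_le:
  "fst (open_value X) \<le> fst (open_value X') \<longleftrightarrow> sum c X' \<le> sum c X"
  "snd (open_value X) \<le> snd (open_value X') \<longleftrightarrow> sum d X \<le> sum d X'"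
  by (simp_all only: open_value_def fst_conv snd_conv of_nat_le_iff neg_le_iff_le add_le_cancel_left)

lemma open_value_eq: "open_value X = open_value X' \<longleftrightarrow> sum c X = sum c X' \<and> sum d X = sum d X'"
  by (simp only: open_value_def prod.inject of_nat_eq_iff neg_equal_iff_equal add_left_cancel)

lemma open_value_in: "X \<subseteq> {..<n} \<Longrightarrow> open_value X \<in> msp_values G"
proof -
  assume X: "X \<subseteq> {..<n}"
  have S: "spine \<subseteq> solution X" "solution X \<subseteq> edges G" using X by (auto simp: solution_def spine_def)
  have "closing \<notin> solution X" by (simp add: solution_def)
  from stretch_open[OF S this] show ?thesis
    using total_cost_solution[OF X] removed_solution[OF X] spanner_superset[OF S]
    unfolding msp_values_def open_value_def by force
qed

text \<open>Adding the spine improves any spanner weakly. The result is determined by its removed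
  shortcuts and by whether it contains the closing edge, which gives the two alternatives.\<close>

lemma msp_value_dominated:
  assumes "y \<in> msp_values G"
  obtains X where "X \<subseteq> {..<n}" "fst (open_value X) \<le> fst y" "snd (open_value X) \<le> snd y"
  | z where "z \<in> msp_values G" "fst z \<le> fst y" "snd z \<le> snd y" "0 < fst z"
      "snd z \<in> of_nat ` insert 1 ((\<lambda>i. 1 + d i) ` {..<n})"
proof -
  obtain S where S: "spanner G S" "y = (total_cost G S, stretch G S)"
    using assms by (auto simp: msp_values_def)
  let ?T = "S \<union> spine"
  have T: "spine \<subseteq> ?T" "?T \<subseteq> edges G" using S(1) spine_subset by (auto simp: spanner_def)
  note improve = msp_value_improve[OF msp_instance_G S(1) spine_subset spine_cost]
  have X: "removed ?T \<subseteq> {..<n}" by (auto simp: removed_def)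
  show ?thesis
  proof (cases "closing \<in> ?T")
    case False
    then have "?T = solution (removed ?T)" using superset_cases(1)[OF T] by blast
    then have "total_cost G ?T = - int (sum c (removed ?T))" using total_cost_solution[OF X] by metis
    then show ?thesis
      using that(1)[OF X] improve(2,3) S(2) stretch_open[OF T False] by (simp add: open_value_def)
  next
    case True
    then have "?T = edges G - shortcut ` removed ?T" using superset_cases(2)[OF T] by blast
    then have "0 < total_cost G ?T" using total_cost_closed[OF X] by metis
    moreover have "(total_cost G ?T, stretch G ?T) \<in> msp_values G"
      using spanner_superset[OF T] by (auto simp: msp_values_def)
    ultimately show ?thesis
      using that(2)[of "(total_cost G ?T, stretch G ?T)"] improve(2,3) S(2) stretch_closed[OF T True] by simp
  qed
qed

lemma nondominatedD:
  "y \<in> nondominated Y \<Longrightarrow> z \<in> Y \<Longrightarrow> fst z \<le> fst y \<Longrightarrow> snd z \<le> snd y \<Longrightarrow> z = y"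
  by (auto simp: nondominated_def dominates_def)

lemma nondominated_cases:
  assumes "y \<in> nondominated (msp_values G)"
  obtains X where "X \<subseteq> {..<n}" "y = open_value X"
  | "0 < fst y" "snd y \<in> of_nat ` insert 1 ((\<lambda>i. 1 + d i) ` {..<n})"
proof -
  have "y \<in> msp_values G" using assms by (simp add: nondominated_def)
  then show ?thesis
  proof (cases rule: msp_value_dominated)
    case (1 X)
    then show ?thesis using that(1) nondominatedD[OF assms open_value_in] by metis
  next
    case (2 z)
    then show ?thesis using that(2) nondominatedD[OF assms 2(1-3)] by simp
  qed
qed

definition buco_set :: "(int \<times> int) set" where
  "buco_set = {(- int (sum c X), int (sum d X)) | X. X \<subseteq> {..<n}}"

definition shift :: "int \<times> int \<Rightarrow> int \<times> rat" where
  "shift y = (fst y, of_int (2 ^ (m + n) + snd y))"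

lemma shift_value: "shift (- int (sum c X), int (sum d X)) = open_value X"
  by (simp add: shift_def open_value_def)

text \<open>\<open>shift\<close> preserves and reflects the order in both components, so domination
  among open values is domination in BUCO. Solutions with the closing edge cannot interfere: their
  first value is positive, hence never below that of an open value.\<close>

lemma nondominated_open:
  "{y \<in> nondominated (msp_values G). fst y \<le> 0} = shift ` nondominated buco_set"
proof (intro equalityI subsetI)
  fix y assume "y \<in> {y \<in> nondominated (msp_values G). fst y \<le> 0}"
  then have y: "y \<in> nondominated (msp_values G)" "fst y \<le> 0" by auto
  then obtain X where X: "X \<subseteq> {..<n}" "y = open_value X"
    by (elim nondominated_cases) auto
  let ?z = "(- int (sum c X), int (sum d X))"
  have "?z \<in> nondominated buco_set"
    unfolding nondominated_def
  proof (intro CollectI conjI notI)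
    show "?z \<in> buco_set" using X by (auto simp: buco_set_def)
    assume "\<exists>z'\<in>buco_set. dominates z' ?z"
    then obtain X' where X': "X' \<subseteq> {..<n}"
      "dominates (- int (sum c X'), int (sum d X')) ?z" by (auto simp: buco_set_def)
    then have "sum c X \<le> sum c X'" "sum d X' \<le> sum d X"
      and ne: "\<not> (sum c X' = sum c X \<and> sum d X' = sum d X)"
      by (auto simp: dominates_def simp del: of_nat_sum)
    then have "open_value X' = y"
      using nondominatedD[OF y(1) open_value_in[OF X'(1)]] X by (simp add: open_value_le)
    then show False using ne X by (simp add: open_value_eq)
  qed
  then show "y \<in> shift ` nondominated buco_set"
    using X shift_value[of X] by (metis image_eqI)
next
  fix y assume "y \<in> shift ` nondominated buco_set"
  then obtain X where X: "X \<subseteq> {..<n}" "y = open_value X"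
    and z: "(- int (sum c X), int (sum d X)) \<in> nondominated buco_set"
  proof -
    obtain z where z: "z \<in> nondominated buco_set" "y = shift z"
      using \<open>y \<in> shift ` nondominated buco_set\<close> by blast
    then obtain X where "X \<subseteq> {..<n}" "z = (- int (sum c X), int (sum d X))"
      by (auto simp: nondominated_def buco_set_def)
    then show ?thesis using that[of X] z shift_value[of X] by metis
  qed
  have y0: "fst y \<le> 0" using X by (simp add: open_value_def del: of_nat_sum)
  have "y \<in> nondominated (msp_values G)"
    unfolding nondominated_def
  proof (intro CollectI conjI notI)
    show "y \<in> msp_values G" using X open_value_in by simp
    assume "\<exists>y'\<in>msp_values G. dominates y' y"
    then obtain y' where y': "y' \<in> msp_values G" "y' \<noteq> y" "fst y' \<le> fst y" "snd y' \<le> snd y"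
      by (auto simp: dominates_def)
    from y'(1) show False
    proof (cases rule: msp_value_dominated)
      case (1 X')
      have "(- int (sum c X'), int (sum d X')) \<in> buco_set" using 1 by (auto simp: buco_set_def)
      moreover have "sum c X \<le> sum c X'" "sum d X' \<le> sum d X"
        using order_trans[OF 1(2) y'(3)] order_trans[OF 1(3) y'(4)] X by (simp_all add: open_value_le)
      ultimately have "sum c X' = sum c X" "sum d X' = sum d X"
        using nondominatedD[OF z] by (fastforce simp del: of_nat_sum)+
      then have "open_value X' = y" using X by (simp add: open_value_eq)
      then show False using y' 1 by (metis order_antisym prod_eq_iff)
    next
      case (2 z)
      then show False using y' y0 by linarith
    qed
  qed
  then show "y \<in> {y \<in> nondominated (msp_values G). fst y \<le> 0}" using y0 by simp
qed

lemma finite_buco_set: "finite buco_set"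
proof -
  have "buco_set = (\<lambda>X. (- int (sum c X), int (sum d X))) ` Pow {..<n}"
    by (auto simp: buco_set_def)
  then show ?thesis by simp
qed

lemma inj_shift: "inj shift"
  by (auto simp: inj_def shift_def prod_eq_iff)

text \<open>Nondominated points with equal second value are comparable and therefore equal. Hence
  there are at most as many points with positive first value as there are values of the stretch with
  the closing edge.\<close>

lemma card_nondominated:
  "card (nondominated (msp_values G)) \<le> card (nondominated buco_set) + (n + 1)"
proof -
  let ?N = "nondominated (msp_values G)"
  let ?V = "rat_of_nat ` insert 1 ((\<lambda>i. 1 + d i) ` {..<n})"
  have inj: "inj_on snd ?N"
  proof (rule inj_onI)
    fix y z assume yz: "y \<in> ?N" "z \<in> ?N" "snd y = snd z"
    then have "y \<in> msp_values G" "z \<in> msp_values G" by (auto simp: nondominated_def)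
    then show "y = z" using yz nondominatedD[of y _ z] nondominatedD[of z _ y] by (metis linear order_refl)
  qed
  have "card {y \<in> ?N. 0 < fst y} \<le> card ?V"
  proof (rule card_inj_on_le)
    show "inj_on snd {y \<in> ?N. 0 < fst y}" using inj by (rule inj_on_subset) auto
    show "snd ` {y \<in> ?N. 0 < fst y} \<subseteq> ?V"
      by (auto elim!: nondominated_cases simp: open_value_def simp del: of_nat_sum)
  qed auto
  also have "\<dots> \<le> card (insert 1 ((\<lambda>i. 1 + d i) ` {..<n}))" by (intro card_image_le) auto
  also have "\<dots> \<le> Suc (card ((\<lambda>i. 1 + d i) ` {..<n}))" by (rule card_insert_le_m1) auto
  also have "\<dots> \<le> n + 1" using card_image_le[of "{..<n}" "\<lambda>i. 1 + d i"] by simp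
  finally have pos: "card {y \<in> ?N. 0 < fst y} \<le> n + 1" .
  have "card {y \<in> ?N. fst y \<le> 0} \<le> card (nondominated buco_set)"
    unfolding nondominated_open using finite_buco_set
    by (intro card_image_le) (simp add: nondominated_def)
  moreover have "?N = {y \<in> ?N. fst y \<le> 0} \<union> {y \<in> ?N. 0 < fst y}" by auto
  ultimately show ?thesis using pos card_Un_le[of "{y \<in> ?N. fst y \<le> 0}" "{y \<in> ?N. 0 < fst y}"] by simp
qed

text \<open>A crude bound for the size of the output: \<open>a n < 4 * 2 ^ (m + n)\<close>, and the
  gadgets contribute \<open>2 * (\<Sum>i<n. c i) < 2 * 2 ^ m\<close> in absolute value, together
  less than \<open>8 * 2 ^ (m + n)\<close>.\<close>

lemma total_cost_abs:
  assumes "S \<subseteq> edges G"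
  shows "\<bar>total_cost G S\<bar> < 2 ^ (m + n + 3)"
proof -
  have "\<bar>total_cost G S\<bar> \<le> (\<Sum>e\<in>S. \<bar>cost1 G e\<bar>)"
    unfolding total_cost_def by (rule sum_abs)
  also have "\<dots> \<le> (\<Sum>e\<in>edges G. \<bar>cost1 G e\<bar>)"
    using finite_edges_G assms by (intro sum_mono2) auto
  also have "\<dots> = sum_list (map (\<lambda>e. \<bar>cost1 G e\<bar>) (map ends (edge_list m c d n)))"
    using sum_list_distinct_conv_sum_set[OF distinct_edges, of "\<lambda>e. \<bar>cost1 G e\<bar>"]
    by (simp add: G_def msp_of_def)
  also have "map (\<lambda>e. \<bar>cost1 G e\<bar>) (map ends (edge_list m c d n)) =
      map (\<lambda>(u, v, x, y). \<bar>x\<bar>) (edge_list m c d n)"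
    using edge_costs(1) by (auto simp: ends_def)
  also have "sum_list \<dots> = int (a n + 2 * (\<Sum>i<n. c i))"
  proof -
    have "sum_list (map (\<lambda>(u, v, x, y). \<bar>x\<bar>) (chain_edges m c d i)) = int (2 * (\<Sum>j<i. c j))" for i
      by (induction i) (auto simp: gadget_def)
    then show ?thesis by (simp add: edge_list_def)
  qed
  also have "\<dots> < int (2 ^ (m + n + 3))"
  proof -
    have "(2::nat) ^ m \<le> 2 ^ (m + n)" "(2::nat) ^ (m + n + 3) = 8 * 2 ^ (m + n)"
      by (simp_all add: power_add)
    then have "a n + 2 * (\<Sum>i<n. c i) < 2 ^ (m + n + 3)"
      using sum_c Suc_base[of m n] unfolding va_def by linarith
    then show ?thesis by (simp only: of_nat_less_iff)
  qed
  finally show ?thesis by simp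
qed

text \<open>Integrality of the stretch matters for the encoding: the denominator is 1, so bounds on
  two integers bound the size of an encoded value.\<close>

lemma nondominated_bounds:
  assumes "y \<in> nondominated (msp_values G)"
  obtains k where "snd y = of_nat k" "k < 2 ^ (m + n + 1)" "\<bar>fst y\<bar> < 2 ^ (m + n + 3)"
proof -
  obtain S where "S \<subseteq> edges G" "y = (total_cost G S, stretch G S)"
    using assms by (auto simp: nondominated_def msp_values_def spanner_def)
  then have cost: "\<bar>fst y\<bar> < 2 ^ (m + n + 3)" using total_cost_abs by simp
  have m: "(2::nat) ^ m \<le> 2 ^ (m + n)" by simp
  have sub: "Suc (sum d X) < 2 ^ m" if "X \<subseteq> {..<n}" for X
    using sum_mono2[of "{..<n}" X d] sum_d that by auto
  show ?thesis using assms
  proof (cases rule: nondominated_cases)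
    case (1 X)
    then have "2 ^ (m + n) + sum d X < 2 * 2 ^ (m + n)" using sub[of X] m by linarith
    then show ?thesis using that[OF _ _ cost] 1 by (simp add: open_value_def del: of_nat_sum of_nat_add)
  next
    case 2
    then obtain k where k: "snd y = of_nat k" "k = 1 \<or> (\<exists>i<n. k = 1 + d i)" by auto
    have "1 + d i < 2 ^ (m + n)" if "i < n" for i
    proof -
      have "Suc (d i) < 2 ^ m" using sub[of "{i}"] that by simp
      then show ?thesis using m by linarith
    qed
    moreover have "1 < (2::nat) ^ (m + n + 1)" by (rule one_less_power) simp_all
    moreover have "(2::nat) ^ (m + n) \<le> 2 ^ (m + n + 1)" by simp
    ultimately have "k < 2 ^ (m + n + 1)" using k(2) less_le_trans by blast
    then show ?thesis using that[OF k(1) _ cost] by blast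
  qed
qed

end

section \<open>Programs for the reduction\<close>

abbreviation tt :: data where "tt \<equiv> Node Leaf Leaf"

lemmas ptime_intros = ptime_id ptime_Leaf ptime_left ptime_right ptime_Node ptime_if

lemma sum_size_items: "sum_list (map size (take i (items d))) \<le> size d"
proof (induction d arbitrary: i)
  case (Node a b)
  then show ?case by (cases i) (auto simp: add.commute intro: le_SucI)
qed simp

section \<open>Writing down the constructed graph\<close>

definition add_ones :: "data \<Rightarrow> data" where
  "add_ones z = foldl (\<lambda>a x. Node tt a) (left z) (items (right z))"

text \<open>One bit 1 for every bit in the input lists, and one more from the start. This is the
  code of a number \<open>2 ^ k - 1\<close> that exceeds neither the input size nor polynomial time,
  and it is found by counting bits rather than by adding.\<close>

definition ones :: "data \<Rightarrow> data" where
  "ones d = foldl (\<lambda>a x. add_ones (Node a x))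
     (foldl (\<lambda>a x. add_ones (Node a x)) (Node tt Leaf) (items (left d))) (items (right d))"

lemma size_fold_tt: "size (foldl (\<lambda>a x. Node tt a) a xs) = size a + 2 * length xs"
  by (induction xs arbitrary: a) auto

lemma size_add_ones: "size (add_ones (Node a x)) \<le> size a + 2 * size x"
  using length_items[of x] by (simp add: add_ones_def size_fold_tt)

lemma ptime_add_ones: "ptime add_ones"
  unfolding add_ones_def[abs_def]
\<comment> \<open>The step in \<open>ptime_foldl\<close> takes a pair of accumulator and item. This
  \<open>g\<close> unpacks the pair, and \<open>simplified\<close> removes the unpacking
  again.\<close>
proof (rule ptime_foldl[where g = "\<lambda>z. Node tt (left z)", simplified])
  fix d i assume "i \<le> length (items (right d))"
  then show "size (foldl (\<lambda>a x. Node tt a) (left d) (take i (items (right d)))) \<le> (\<lambda>n. 3 * n) (size d)"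
    using length_items[of "right d"] size_right[of d] size_left[of d]
    by (simp add: size_fold_tt)
qed (intro ptime_intros ptime_left0 ptime_right0 poly_bounded_intros)+

lemma size_fold_add_ones:
  "size (foldl (\<lambda>a x. add_ones (Node a x)) a xs) \<le> size a + 2 * sum_list (map size xs)"
proof (induction xs arbitrary: a)
  case (Cons x xs)
  have "size (foldl (\<lambda>a x. add_ones (Node a x)) (add_ones (Node a x)) xs) \<le>
      size (add_ones (Node a x)) + 2 * sum_list (map size xs)" by (rule Cons)
  then show ?case using size_add_ones[of a x] by simp
qed simp

lemma size_fold_add_ones_items:
  "size (foldl (\<lambda>a x. add_ones (Node a x)) a (take i (items d))) \<le> size a + 2 * size d"
  using size_fold_add_ones[of a "take i (items d)"] sum_size_items[of i d] by linarith

lemma size_ones1: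
  "size (foldl (\<lambda>a x. add_ones (Node a x)) (Node tt Leaf) (items (left d))) \<le> 2 + 2 * size d"
  using size_fold_add_ones_items[of "Node tt Leaf" "length (items (left d))" "left d"] size_left[of d]
  by simp

lemma size_ones: "size (ones d) \<le> 2 + 4 * size d"
  unfolding ones_def
  using size_fold_add_ones_items[of _ "length (items (right d))" "right d"] size_ones1[of d]
    size_right[of d] by (simp add: le_trans[OF size_fold_add_ones_items[of _ "length (items (right d))" "right d", simplified]])

lemma ptime_ones: "ptime ones"
  unfolding ones_def[abs_def]
proof (rule ptime_foldl)
  show "ptime (\<lambda>d. foldl (\<lambda>a x. add_ones (Node a x)) (Node tt Leaf) (items (left d)))"
  proof (rule ptime_foldl)
    show "size (foldl (\<lambda>a x. add_ones (Node a x)) (Node tt Leaf) (take i (items (left d)))) \<le>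
        (\<lambda>n. 2 + 2 * n) (size d)" for d i
      using size_fold_add_ones_items[of "Node tt Leaf" i "left d"] size_left[of d] by simp
  qed (intro ptime_intros ptime_left0 ptime_add_ones poly_bounded_intros)+
  show "size (foldl (\<lambda>a x. add_ones (Node a x)) (foldl (\<lambda>a x. add_ones (Node a x)) (Node tt Leaf)
      (items (left d))) (take i (items (right d)))) \<le> (\<lambda>n. 2 + 4 * n) (size d)" for d i
    using le_trans[OF size_fold_add_ones_items add_mono[OF size_ones1[of d] mult_le_mono2[OF size_right[of d]]]]
    by (auto intro: le_trans)
qed (intro ptime_intros ptime_right0 ptime_add_ones poly_bounded_intros)+

text \<open>Bits come least significant first, so multiplying by 4 and adding 0, 1 or 2 amounts to
  prepending two bits.\<close>

definition data_a :: "data \<Rightarrow> data" where "data_a u = Node Leaf (Node Leaf u)"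
definition data_p :: "data \<Rightarrow> data" where "data_p u = Node tt (Node Leaf u)"
definition data_b :: "data \<Rightarrow> data" where "data_b u = Node Leaf (Node tt u)"

definition data_edge :: "data \<Rightarrow> data \<Rightarrow> data \<Rightarrow> data \<Rightarrow> data" where
  "data_edge u v x y = Node u (Node v (Node x y))"

text \<open>The negative of zero carries the sign bit false, hence the case distinction.\<close>

definition data_minus :: "data \<Rightarrow> data" where
  "data_minus x = (if x = Leaf then Node Leaf Leaf else Node tt x)"

text \<open>The fold runs over the first cost list; the second one is consumed in parallel from
  \<open>rest\<close>. The component \<open>u\<close> is the code of the current
  \<open>base m i\<close>.\<close>

definition data_state :: "data \<Rightarrow> data \<Rightarrow> data \<Rightarrow> data \<Rightarrow> data" where
  "data_state rest u vs es = Node rest (Node u (Node vs es))"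

text \<open>All arithmetic is prepending of bits: \<open>Node tt u\<close> is the next base,
  \<open>Node Leaf u\<close> is twice the current one, and \<open>Node tt (left rest)\<close> is
  \<open>2 * d i + 1\<close>.\<close>

definition chain_step :: "data \<Rightarrow> data \<Rightarrow> data \<Rightarrow> data \<Rightarrow> data \<Rightarrow> data" where
  "chain_step rest u vs es x = data_state (right rest) (Node tt u)
     (Node (data_a u) (Node (data_p u) (Node (data_b u) vs)))
     (Node (data_edge (data_a u) (data_p u) (data_minus x) (Node tt Leaf))
     (Node (data_edge (data_p u) (data_b u) (Node Leaf Leaf) (Node tt (left rest)))
     (Node (data_edge (data_a u) (data_b u) (Node Leaf x) (Node Leaf (Node tt Leaf)))
     (Node (data_edge (data_b u) (data_a (Node tt u)) (Node Leaf Leaf) (Node Leaf u)) es))))"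

definition step :: "data \<Rightarrow> data" where
  "step z = chain_step (left (left z)) (left (right (left z))) (left (right (right (left z))))
     (right (right (right (left z)))) (right z)"

definition start :: "data \<Rightarrow> data" where
  "start d = data_state (right d) (ones d) (Node Leaf (Node (Node tt Leaf) Leaf))
     (Node (data_edge Leaf (Node tt Leaf) (Node Leaf Leaf) (Node Leaf (Node tt Leaf)))
     (Node (data_edge (Node tt Leaf) (data_a (ones d)) (Node Leaf Leaf) (Node Leaf (ones d))) Leaf))"

definition chain :: "data \<Rightarrow> data" where
  "chain d = foldl (\<lambda>a x. step (Node a x)) (start d) (items (left d))"

definition finish :: "data \<Rightarrow> data" where
  "finish z = Node (Node (data_a (left (right z))) (left (right (right z))))
     (Node (data_edge Leaf (data_a (left (right z))) (Node Leaf (data_a (left (right z))))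
       (Node Leaf (Node tt Leaf))) (right (right (right z))))"

definition encode_chain :: "data \<Rightarrow> data" where
  "encode_chain d = finish (chain d)"

lemmas data_defs = data_a_def data_p_def data_b_def data_edge_def data_minus_def data_state_def

lemma step_state:
  "step (Node (data_state rest u vs es) x) = chain_step rest u vs es x"
  by (simp add: step_def data_state_def)

lemma ptime_step: "ptime step"
  unfolding step_def[abs_def] chain_step_def data_defs
  by (intro ptime_intros)

lemma ptime_start: "ptime start"
  unfolding start_def[abs_def] data_defs by (intro ptime_intros ptime_ones ptime_right0)

lemma ptime_finish: "ptime finish"
  unfolding finish_def[abs_def] data_defs by (intro ptime_intros)

text \<open>The base gains two nodes per step, so \<open>M\<close> has to cover
  \<open>size u + 2 * length xs\<close>. Each step adds a fixed number of trees of size about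
  \<open>M\<close> to the lists; \<open>30 * M + 100\<close> is a generous bound for them.\<close>

lemma size_chain_fold:
  assumes "size u + 2 * length xs \<le> M" and "size rest \<le> M" and "\<forall>x\<in>set xs. size x \<le> M"
  shows "size (foldl (\<lambda>a x. step (Node a x)) (data_state rest u vs es) xs) \<le>
    2 * M + 3 + size vs + size es + length xs * (30 * M + 100)"
  using assms
proof (induction xs arbitrary: rest u vs es)
  case Nil
  then show ?case by (simp add: data_state_def)
next
  case (Cons x xs)
  define vs' where "vs' = Node (data_a u) (Node (data_p u) (Node (data_b u) vs))"
  define es' where "es' = 
     (Node (data_edge (data_a u) (data_p u) (data_minus x) (Node tt Leaf))
     (Node (data_edge (data_p u) (data_b u) (Node Leaf Leaf) (Node tt (left rest)))
     (Node (data_edge (data_a u) (data_b u) (Node Leaf x) (Node Leaf (Node tt Leaf)))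
     (Node (data_edge (data_b u) (data_a (Node tt u)) (Node Leaf Leaf) (Node Leaf u)) es))))"
  have "size vs' + size es' \<le> size vs + size es + (30 * M + 100)"
    using Cons.prems size_left[of rest] by (auto simp: vs'_def es'_def data_defs)
  moreover have "size (foldl (\<lambda>a x. step (Node a x)) (data_state (right rest) (Node tt u) vs' es') xs) \<le>
    2 * M + 3 + size vs' + size es' + length xs * (30 * M + 100)"
    using Cons.prems size_right[of rest] by (intro Cons.IH) auto
  ultimately show ?case
    by (simp add: step_state chain_step_def vs'_def[symmetric] es'_def[symmetric])
qed

lemma ptime_encode_chain: "ptime encode_chain"
  unfolding encode_chain_def[abs_def]
proof (rule ptime_comp[OF ptime_finish])
  \<comment> \<open>\<open>2 + 4 * n\<close> for the code of the first base and \<open>2 * n\<close>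
    for its growth during the fold.\<close>
  let ?M = "\<lambda>n. 2 + 6 * n"
  show "ptime chain"
    unfolding chain_def[abs_def]
  proof (rule ptime_foldl)
    fix d i assume i: "i \<le> length (items (left d))"
    have len: "length (items (left d)) \<le> size d"
      using length_items[of "left d"] size_left[of d] by simp
    have "size (foldl (\<lambda>a x. step (Node a x)) (start d) (take i (items (left d)))) \<le>
        2 * ?M (size d) + 3 + size (Node Leaf (Node (Node tt Leaf) Leaf)) +
        size (Node (data_edge Leaf (Node tt Leaf) (Node Leaf Leaf) (Node Leaf (Node tt Leaf)))
          (Node (data_edge (Node tt Leaf) (data_a (ones d)) (Node Leaf Leaf) (Node Leaf (ones d))) Leaf)) +
        length (take i (items (left d))) * (30 * ?M (size d) + 100)"
      unfolding start_def
    proof (rule size_chain_fold)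
      show "size (ones d) + 2 * length (take i (items (left d))) \<le> ?M (size d)"
        using size_ones[of d] len by simp
      show "size (right d) \<le> ?M (size d)" using size_right[of d] by simp
      show "\<forall>x\<in>set (take i (items (left d))). size x \<le> ?M (size d)"
      proof
        fix x assume "x \<in> set (take i (items (left d)))"
        then have "size x \<le> size (left d)" by (intro size_items) (rule in_set_takeD)
        then show "size x \<le> ?M (size d)" using size_left[of d] by simp
      qed
    qed
    also have "\<dots> \<le> (\<lambda>n. 5 * ?M n + 100 + n * (30 * ?M n + 100)) (size d)"
    proof -
      have "length (take i (items (left d))) * (30 * ?M (size d) + 100) \<le>
          size d * (30 * ?M (size d) + 100)"
        using i len by (intro mult_le_mono1) simp
      moreover have "2 * ?M (size d) + 3 + size (Node Leaf (Node (Node tt Leaf) Leaf)) +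
          size (Node (data_edge Leaf (Node tt Leaf) (Node Leaf Leaf) (Node Leaf (Node tt Leaf)))
          (Node (data_edge (Node tt Leaf) (data_a (ones d)) (Node Leaf Leaf) (Node Leaf (ones d))) Leaf))
          \<le> 5 * ?M (size d) + 100"
        using size_ones[of d] by (simp add: data_defs)
      ultimately show ?thesis by (rule add_mono[rotated])
    qed
    finally show "size (foldl (\<lambda>a x. step (Node a x)) (start d) (take i (items (left d)))) \<le>
      (\<lambda>n. 5 * ?M n + 100 + n * (30 * ?M n + 100)) (size d)" .
  qed (intro ptime_start ptime_left0 ptime_step poly_bounded_intros)+
qed

section \<open>Recovering BUCO values from spanner values\<close>

definition data_rev :: "data \<Rightarrow> data" where
  "data_rev d = foldl (\<lambda>a x. Node x a) Leaf (items d)"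

text \<open>Builds a number from the most significant bit downwards. A zero is not put on the empty
  number, so no leading zeros arise.\<close>

definition push_bit :: "data \<Rightarrow> data \<Rightarrow> data" where
  "push_bit a x = (if a = Leaf then (if x = Leaf then Leaf else Node x a) else Node x a)"

text \<open>After reversal the top bit comes first and is cut off. Pushing the remaining bits
  restores their order and strips the zeros that have become leading.\<close>

definition drop_top :: "data \<Rightarrow> data" where
  "drop_top d = foldl push_bit Leaf (items (right (data_rev d)))"

text \<open>Reads the absolute value of the numerator of the stretch; the denominator is 1 for the
  values that are kept. The inserted \<open>Leaf\<close> is the sign bit of a nonnegative
  integer.\<close>

definition decode_value :: "data \<Rightarrow> data" where
  "decode_value y = Node (left y) (Node Leaf (drop_top (right (left (right y)))))"

text \<open>The sign bit \<open>Leaf\<close> means nonnegative, and a magnitude \<open>Leaf\<close>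
  means zero. Exactly the positive first values are discarded, that is, the points that use the
  closing edge.\<close>

definition push_value :: "data \<Rightarrow> data \<Rightarrow> data" where
  "push_value a y = (if left (left y) = Leaf
     then (if right (left y) = Leaf then Node (decode_value y) a else a)
     else Node (decode_value y) a)"

definition decode_values :: "data \<Rightarrow> data" where
  "decode_values d = foldl push_value Leaf (items d)"

lemma size_data_rev_fold:
  "size (foldl (\<lambda>a x. Node x a) a xs) = size a + length xs + sum_list (map size xs)"
  by (induction xs arbitrary: a) auto

lemma size_data_rev: "size (foldl (\<lambda>a x. Node x a) Leaf (take i (items d))) \<le> 2 * size d"
  using sum_size_items[of i d] length_items[of d] by (simp add: size_data_rev_fold)

lemma ptime_data_rev: "ptime data_rev"
  unfolding data_rev_def[abs_def]
proof (rule ptime_foldl[where g = "\<lambda>z. Node (right z) (left z)", simplified])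
  show "size (foldl (\<lambda>a x. Node x a) Leaf (take i (items d))) \<le> (\<lambda>n. 2 * n) (size d)" for d i
    using size_data_rev by simp
qed (intro ptime_intros ptime_left0 ptime_right0 poly_bounded_intros)+

lemma size_push_bit_fold:
  "size (foldl push_bit a xs) \<le> size a + length xs + sum_list (map size xs)"
proof (induction xs arbitrary: a)
  case (Cons x xs)
  have "size (push_bit a x) \<le> size a + size x + 1" by (simp add: push_bit_def)
  then show ?case using Cons[of "push_bit a x"] by simp
qed simp

lemma size_push_bit_items: "size (foldl push_bit Leaf (take i (items d))) \<le> 2 * size d"
  using size_push_bit_fold[of Leaf "take i (items d)"] sum_size_items[of i d] length_items[of d]
  by simp

lemma size_right_data_rev: "size (right (data_rev d)) \<le> 2 * size d"
  using size_data_rev[of "length (items d)" d] size_right[of "data_rev d"]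
  by (simp add: data_rev_def)

lemma ptime_drop_top: "ptime drop_top"
  unfolding drop_top_def[abs_def]
proof (rule ptime_foldl[where g = "\<lambda>z. push_bit (left z) (right z)", simplified])
  show "ptime (\<lambda>z. push_bit (left z) (right z))"
    unfolding push_bit_def by (intro ptime_intros ptime_left0 ptime_right0)
  show "size (foldl push_bit Leaf (take i (items (right (data_rev d))))) \<le> (\<lambda>n. 4 * n) (size d)" for d i
    using size_push_bit_items[of i "right (data_rev d)"] size_right_data_rev[of d] by simp
qed (intro ptime_intros ptime_data_rev poly_bounded_intros)+

lemma ptime_decode_value: "ptime decode_value"
  unfolding decode_value_def[abs_def]
  by (intro ptime_intros ptime_left0 ptime_right0 ptime_comp[OF ptime_drop_top])

lemma size_drop_top: "size (drop_top d) \<le> 4 * size d"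
  using size_push_bit_items[of "length (items (right (data_rev d)))" "right (data_rev d)"]
    size_right_data_rev[of d] by (simp add: drop_top_def)

lemma size_decode_value: "size (decode_value y) \<le> 5 * size y + 2"
proof -
  have "size (right (left (right y))) \<le> size y"
    using size_right[of y] size_left[of "right y"] size_right[of "left (right y)"] by linarith
  then show ?thesis using size_drop_top[of "right (left (right y))"] size_left[of y]
    by (simp add: decode_value_def)
qed

lemma size_push_value_fold:
  "size (foldl push_value a ys) \<le> size a + 3 * length ys + 5 * sum_list (map size ys)"
proof (induction ys arbitrary: a)
  case (Cons y ys)
  have "size (push_value a y) \<le> size a + 5 * size y + 3"
    using size_decode_value[of y] by (simp add: push_value_def)
  then show ?case using Cons[of "push_value a y"] by simp
qed simp

lemma ptime_decode_values: "ptime decode_values"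
  unfolding decode_values_def[abs_def]
proof (rule ptime_foldl[where g = "\<lambda>z. push_value (left z) (right z)", simplified])
  show "ptime (\<lambda>z. push_value (left z) (right z))"
    unfolding push_value_def
    by (intro ptime_intros ptime_left0 ptime_right0 ptime_comp[OF ptime_decode_value])
  show "size (foldl push_value Leaf (take i (items d))) \<le> (\<lambda>n. 8 * n) (size d)" for d i
    using size_push_value_fold[of Leaf "take i (items d)"] sum_size_items[of i d] length_items[of d]
    by simp
qed (intro ptime_intros poly_bounded_intros)+

section \<open>Correctness of the programs\<close>

lemma bits_0 [simp]: "bits 0 = []"
  by (simp add: bits.simps)

lemma bits_pos: "0 < n \<Longrightarrow> bits n = odd n # bits (n div 2)"
  by (subst bits.simps) simp

lemma bits_odd: "bits (2 * n + 1) = True # bits n"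
  by (subst bits.simps) simp

lemma bits_even: "0 < n \<Longrightarrow> bits (2 * n) = False # bits n"
  by (subst bits.simps) simp

lemma less_power_length_bits: "n < 2 ^ length (bits n)"
proof (induction n rule: less_induct)
  case (less n)
  show ?case
  proof (cases "n = 0")
    case False
    then have "n div 2 < 2 ^ length (bits (n div 2))" using less by simp
    then show ?thesis using False by (simp add: bits_pos)
  qed simp
qed

lemma length_bits_le: "n < 2 ^ k \<Longrightarrow> length (bits n) \<le> k"
proof (induction k arbitrary: n)
  case (Suc k)
  then have "length (bits (n div 2)) \<le> k" by (intro Suc.IH) auto
  then show ?case by (cases "n = 0") (simp_all add: bits_pos)
qed simp

lemma enc_nat_0 [simp]: "enc_nat 0 = Leaf"
  by (simp add: enc_nat_def)

lemma enc_nat_odd: "enc_nat (2 * n + 1) = Node tt (enc_nat n)"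
  unfolding enc_nat_def bits_odd by (simp add: enc_bool_def)

lemma enc_nat_even: "0 < n \<Longrightarrow> enc_nat (2 * n) = Node Leaf (enc_nat n)"
  unfolding enc_nat_def bits_even by (simp add: enc_bool_def)

lemma enc_nat_1: "enc_nat 1 = Node tt Leaf"
  using enc_nat_odd[of 0] by simp

lemma enc_nat_2: "enc_nat 2 = Node Leaf (Node tt Leaf)"
  using enc_nat_even[of 1] enc_nat_1 by simp

lemma enc_nat_eq_Leaf [simp]: "enc_nat n = Leaf \<longleftrightarrow> n = 0"
  by (cases "n = 0") (simp_all add: enc_nat_def bits_pos)

lemma size_enc_nat: "size (enc_nat n) \<le> 2 * length (bits n)"
proof -
  have "size (enc_list enc_bool bs) \<le> 2 * length bs" for bs
    by (induction bs) (auto simp: enc_bool_def)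
  then show ?thesis by (simp add: enc_nat_def)
qed

lemma length_bits_le_size: "length (bits n) \<le> size (enc_nat n)"
  using length_items[of "enc_nat n"] by (simp add: enc_nat_def items_enc_list)

lemma enc_int_of_nat: "enc_int (int n) = Node Leaf (enc_nat n)"
  by (simp add: enc_int_def enc_pair_def enc_bool_def)

lemma enc_int_minus: "enc_int (- int n) = data_minus (enc_nat n)"
  by (simp add: enc_int_def enc_pair_def enc_bool_def data_minus_def)

lemma enc_rat_of_nat: "enc_rat (of_nat n) = Node (enc_int (int n)) (enc_int 1)"
  using quotient_of_int[of "int n"] by (simp add: enc_rat_def enc_pair_def)

lemma size_enc_int: "\<bar>z\<bar> < 2 ^ k \<Longrightarrow> size (enc_int z) \<le> 2 * k + 2"
proof -
  assume "\<bar>z\<bar> < 2 ^ k"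
  then have "nat \<bar>z\<bar> < 2 ^ k" by (simp add: nat_less_iff)
  then have "size (enc_nat (nat \<bar>z\<bar>)) \<le> 2 * k"
    using size_enc_nat[of "nat \<bar>z\<bar>"] length_bits_le[of "nat \<bar>z\<bar>" k] by linarith
  moreover have "size (enc_int z) \<le> size (enc_nat (nat \<bar>z\<bar>)) + 2"
    by (cases "z < 0") (simp_all add: enc_int_def enc_pair_def enc_bool_def)
  ultimately show ?thesis by linarith
qed

lemma size_enc_list:
  "\<forall>x\<in>set xs. size (f x) \<le> B \<Longrightarrow> size (enc_list f xs) \<le> length xs * (B + 1)"
  by (induction xs) auto

text \<open>Induction on \<open>k\<close> removes the lowest bit, which after reversal is pushed
  last. Pushing it onto the code of \<open>s div 2\<close> yields the code of \<open>s\<close>; the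
  exceptional case is \<open>s = 0\<close>, where nothing may be pushed.\<close>

lemma foldl_push_bit:
  "s < 2 ^ k \<Longrightarrow> foldl push_bit Leaf (tl (rev (map enc_bool (bits (2 ^ k + s))))) = enc_nat s"
proof (induction k arbitrary: s)
  case 0
  then show ?case using bits_odd[of 0] by simp
next
  case (Suc k)
  let ?r = "2 ^ k + s div 2"
  have "s div 2 < 2 ^ k" using Suc.prems by auto
  note IH = Suc.IH[OF this]
  have "bits (2 ^ Suc k + s) = odd s # bits ?r"
    by (simp add: bits_pos)
  moreover have "bits ?r \<noteq> []" by (simp add: bits_pos)
  ultimately have "tl (rev (map enc_bool (bits (2 ^ Suc k + s)))) =
      tl (rev (map enc_bool (bits ?r))) @ [enc_bool (odd s)]" by simp
  then have "foldl push_bit Leaf (tl (rev (map enc_bool (bits (2 ^ Suc k + s))))) =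
      push_bit (enc_nat (s div 2)) (enc_bool (odd s))" using IH by simp
  also have "\<dots> = enc_nat s"
  proof (cases "s = 0")
    case True
    then show ?thesis by (simp add: push_bit_def enc_bool_def)
  next
    case False
    have "bits s = odd s # bits (s div 2)" using False by (simp add: bits_pos)
    then have "enc_nat s = Node (enc_bool (odd s)) (enc_nat (s div 2))" by (simp add: enc_nat_def)
    moreover have "odd s" if "s div 2 = 0" using that False by (cases "s = 1") auto
    ultimately show ?thesis by (auto simp: push_bit_def enc_bool_def)
  qed
  finally show ?case .
qed

lemma items_data_rev: "items (data_rev d) = rev (items d)"
proof -
  have "items (foldl (\<lambda>a x. Node x a) a xs) = rev xs @ items a" for a xs
    by (induction xs arbitrary: a) auto
  then show ?thesis by (simp add: data_rev_def)
qed

lemma items_right: "items (right d) = tl (items d)"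
  by (cases d) auto

lemma drop_top_enc_nat: "s < 2 ^ k \<Longrightarrow> drop_top (enc_nat (2 ^ k + s)) = enc_nat s"
  using foldl_push_bit[of s k]
  by (simp add: drop_top_def items_right items_data_rev enc_nat_def items_enc_list)

text \<open>Prepending reverses the list, hence \<open>rev\<close>. This is harmless because the
  values may be output in any order.\<close>

lemma foldl_push_value:
  assumes "\<And>y. y \<in> set ys \<Longrightarrow> fst y \<le> 0 \<Longrightarrow>
    decode_value (enc_pair enc_int enc_rat y) = enc_pair enc_int enc_int (f y)"
  shows "foldl push_value (enc_list (enc_pair enc_int enc_int) zs)
      (map (enc_pair enc_int enc_rat) ys) =
    enc_list (enc_pair enc_int enc_int) (rev (map f (filter (\<lambda>y. fst y \<le> 0) ys)) @ zs)"
  using assms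
proof (induction ys arbitrary: zs)
  case (Cons y ys)
  let ?e = "enc_pair enc_int enc_rat y" and ?L = "enc_list (enc_pair enc_int enc_int)"
  have "left (left ?e) = Leaf \<longleftrightarrow> 0 \<le> fst y" "right (left ?e) = Leaf \<longleftrightarrow> fst y = 0"
    by (auto simp: enc_pair_def enc_int_def enc_bool_def)
  then have "push_value (?L zs) ?e = (if fst y \<le> 0 then ?L (f y # zs) else ?L zs)"
    using Cons.prems[of y] by (auto simp: push_value_def)
  then show ?case using Cons.IH[of zs] Cons.IH[of "f y # zs"] Cons.prems by simp
qed simp

section \<open>Correctness of the translation\<close>

definition total_bits :: "nat list \<Rightarrow> nat" where
  "total_bits xs = sum_list (map (\<lambda>x. length (bits x)) xs)"

text \<open>The induction rests on \<open>x + s + 1 \<le> (x + 1) * (s + 1)\<close>. It provides a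
  sufficiently large power of two from bit counts alone.\<close>

lemma sum_list_less_total_bits: "sum_list xs < 2 ^ total_bits xs"
proof (induction xs)
  case (Cons x xs)
  let ?x = "2 ^ length (bits x)" and ?y = "2 ^ total_bits xs"
  have "x + sum_list xs + 1 \<le> (x + 1) * (sum_list xs + 1)" by simp
  also have "\<dots> \<le> ?x * ?y"
    using less_power_length_bits[of x] Cons by (intro mult_le_mono) auto
  finally show ?case by (simp add: total_bits_def power_add)
qed (simp add: total_bits_def)

lemma total_bits_le_size: "total_bits xs + length xs \<le> size (enc_list enc_nat xs)"
proof (induction xs)
  case (Cons x xs)
  then show ?case using length_bits_le_size[of x] by (simp add: total_bits_def)
qed (simp add: total_bits_def)

definition unary :: "nat \<Rightarrow> data" where
  "unary k = (Node tt ^^ k) Leaf"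

lemma enc_nat_unary: "enc_nat (2 ^ k - 1) = unary k"
proof (induction k)
  case (Suc k)
  have "(2::nat) ^ Suc k - 1 = 2 * (2 ^ k - 1) + 1"
    using base_Suc[of 0 k] by (simp add: base_def)
  then show ?case using Suc enc_nat_odd[of "2 ^ k - 1"] by (simp add: unary_def)
qed (simp add: unary_def)

lemma foldl_unary: "foldl (\<lambda>a x. Node tt a) (unary k) xs = unary (k + length xs)"
proof (induction xs arbitrary: k)
  case (Cons x xs)
  show ?case using Cons[of "Suc k"] by (simp add: unary_def)
qed simp

lemma foldl_add_ones:
  "foldl (\<lambda>a x. add_ones (Node a x)) (unary k) (map enc_nat xs) = unary (k + total_bits xs)"
proof (induction xs arbitrary: k)
  case (Cons x xs)
  then show ?case
    by (simp add: add_ones_def foldl_unary enc_nat_def items_enc_list total_bits_def add.assoc)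
qed (simp add: total_bits_def)

text \<open>The additional 1 comes from the initial bit in \<open>ones\<close>. It makes the
  exponent positive and provides the room for the \<open>Suc\<close> in the bound on the second cost
  vector.\<close>

definition exponent :: "nat list \<Rightarrow> nat list \<Rightarrow> nat" where
  "exponent c1 c2 = 1 + total_bits c1 + total_bits c2"

abbreviation enc_buco :: "nat list \<times> nat list \<Rightarrow> data" where
  "enc_buco \<equiv> enc_pair (enc_list enc_nat) (enc_list enc_nat)"

abbreviation enc_edge :: "edge \<Rightarrow> data" where
  "enc_edge \<equiv> enc_pair enc_nat (enc_pair enc_nat (enc_pair enc_int enc_nat))"

lemma ones_enc_buco: "ones (enc_buco (c1, c2)) = enc_nat (base (exponent c1 c2) 0)"
proof -
  have "Node tt Leaf = unary 1" by (simp add: unary_def)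
  then show ?thesis
    by (simp add: ones_def enc_pair_def items_enc_list foldl_add_ones base_def exponent_def
        enc_nat_unary del: One_nat_def)
qed

text \<open>A positive exponent makes \<open>base m i\<close> nonzero; for zero,
  \<open>data_a\<close> would produce leading zeros.\<close>

lemma enc_vertices:
  assumes "0 < m"
  shows "enc_nat (va m i) = data_a (enc_nat (base m i))"
    and "enc_nat (vp m i) = data_p (enc_nat (base m i))"
    and "enc_nat (vb m i) = data_b (enc_nat (base m i))"
proof -
  have "(2::nat) ^ 1 \<le> 2 ^ (m + i)" using assms by (intro power_increasing) auto
  then have pos: "0 < base m i" by (simp add: base_def)
  have "va m i = 2 * (2 * base m i)" "vp m i = 2 * (2 * base m i) + 1" "vb m i = 2 * (2 * base m i + 1)"
    by (simp_all add: va_def vp_def vb_def)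
  then show "enc_nat (va m i) = data_a (enc_nat (base m i))"
    and "enc_nat (vp m i) = data_p (enc_nat (base m i))"
    and "enc_nat (vb m i) = data_b (enc_nat (base m i))"
    using pos enc_nat_even[of "2 * base m i"] enc_nat_odd[of "2 * base m i"]
      enc_nat_even[of "2 * base m i + 1"] enc_nat_even[of "base m i"] enc_nat_odd[of "base m i"]
    by (simp_all add: data_a_def data_p_def data_b_def)
qed

lemma base_gt_0: "0 < m \<Longrightarrow> 0 < base m i"
  using one_less_power[of "2::nat" "m + i"] by (simp add: base_def)

lemma enc_nat_base_Suc: "enc_nat (base m (Suc i)) = Node tt (enc_nat (base m i))"
  using enc_nat_odd[of "base m i"] by (simp add: base_Suc)

lemma enc_edge_data:
  "enc_edge (u, v, x, y) = data_edge (enc_nat u) (enc_nat v) (enc_int x) (enc_nat y)"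
  by (simp add: enc_pair_def data_edge_def)

text \<open>The loop invariant: after \<open>i\<close> items, the state holds the unread part of
  \<open>c2\<close>, the current base, and the vertices and edges of the chain up to gadget
  \<open>i\<close>.\<close>

lemma chain_fold:
  assumes len: "length c1 = length c2" and m: "0 < m" and i: "i \<le> length c1"
  shows "foldl (\<lambda>a x. step (Node a x))
      (data_state (enc_list enc_nat c2) (enc_nat (base m 0)) (enc_list enc_nat (chain_verts m 0))
        (enc_list enc_edge (chain_edges m ((!) c1) ((!) c2) 0)))
      (map enc_nat (take i c1)) =
    data_state (enc_list enc_nat (drop i c2)) (enc_nat (base m i))
      (enc_list enc_nat (chain_verts m i)) (enc_list enc_edge (chain_edges m ((!) c1) ((!) c2) i))"
  using i
proof (induction i)
  case (Suc i)
  have take: "take (Suc i) c1 = take i c1 @ [c1 ! i]"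
    using Suc.prems by (simp add: take_Suc_conv_app_nth)
  have drop: "drop i c2 = c2 ! i # drop (Suc i) c2"
    using Suc.prems len by (simp add: Cons_nth_drop_Suc)
  have "enc_int 0 = Node Leaf Leaf" using enc_int_of_nat[of 0] by simp
  then show ?case
    using Suc enc_nat_odd[of "c2 ! i"] enc_nat_even[OF base_gt_0[OF m, of i]]
    by (simp add: take drop step_state chain_step_def gadget_def enc_edge_data enc_vertices[OF m]
        enc_nat_base_Suc enc_int_of_nat enc_int_minus enc_nat_1 enc_nat_2
        del: One_nat_def)
qed simp

lemma encode_chain_enc_buco:
  assumes len: "length c1 = length c2"
  shows "encode_chain (enc_buco (c1, c2)) = enc_pair (enc_list enc_nat) (enc_list enc_edge)
    (vert_list (exponent c1 c2) (length c1),
     edge_list (exponent c1 c2) ((!) c1) ((!) c2) (length c1))"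
proof -
  let ?m = "exponent c1 c2" and ?n = "length c1"
  have m: "0 < ?m" by (simp add: exponent_def)
  have e0: "enc_int 0 = Node Leaf Leaf" using enc_int_of_nat[of 0] by simp
  have "start (enc_buco (c1, c2)) = data_state (enc_list enc_nat c2) (enc_nat (base ?m 0))
      (enc_list enc_nat (chain_verts ?m 0)) (enc_list enc_edge (chain_edges ?m ((!) c1) ((!) c2) 0))"
    using enc_nat_even[OF base_gt_0[OF m, of 0]] enc_nat_1
    by (simp add: start_def ones_enc_buco, simp add: enc_pair_def data_edge_def e0 enc_nat_2 enc_vertices[OF m])
  then have "chain (enc_buco (c1, c2)) = data_state Leaf (enc_nat (base ?m ?n))
      (enc_list enc_nat (chain_verts ?m ?n)) (enc_list enc_edge (chain_edges ?m ((!) c1) ((!) c2) ?n))"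
    using chain_fold[OF len m, of ?n] len
    by (simp add: chain_def enc_pair_def items_enc_list)
  then show ?thesis
    by (simp add: encode_chain_def finish_def data_state_def enc_pair_def vert_list_def edge_list_def
        enc_vertices[OF m] enc_int_of_nat enc_nat_2 data_edge_def)
qed

lemma buco_values_eq:
  assumes "length c1 = length c2"
  shows "buco_values (c1, c2) =
    {(- int (sum ((!) c1) X), int (sum ((!) c2) X)) | X. X \<subseteq> {..<length c1}}" (is "?L = ?R")
proof (intro equalityI subsetI)
  let ?n = "length c1"
  fix y assume "y \<in> ?L"
  then obtain x :: "nat list" where x: "length x = ?n" "set x \<subseteq> {0, 1}"
    and y: "y = (- int (\<Sum>i<?n. c1 ! i * x ! i), int (\<Sum>i<?n. c2 ! i * x ! i))"
    by (auto simp: buco_values_def)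
  define X where "X = {i. i < ?n \<and> x ! i = 1}"
  have "(\<Sum>i<?n. f i * x ! i) = sum f X" for f :: "nat \<Rightarrow> nat"
  proof -
    have "x ! i = (if i \<in> X then 1 else 0)" if "i < ?n" for i
    proof -
      have "x ! i \<in> {0, 1}" using x that by (intro subsetD[OF x(2)] nth_mem) simp
      then show ?thesis using that by (auto simp: X_def)
    qed
    then have "(\<Sum>i<?n. f i * x ! i) = (\<Sum>i<?n. if i \<in> X then f i else 0)"
      by (intro sum.cong) auto
    also have "\<dots> = sum f X" by (simp add: sum.If_cases X_def Int_def conj_commute)
    finally show ?thesis .
  qed
  then have "y = (- int (sum ((!) c1) X), int (sum ((!) c2) X))" using y by simp
  moreover have "X \<subseteq> {..<?n}" by (auto simp: X_def)
  ultimately show "y \<in> ?R" by blast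
next
  let ?n = "length c1"
  fix y assume "y \<in> ?R"
  then obtain X where X: "X \<subseteq> {..<?n}" and y: "y = (- int (sum ((!) c1) X), int (sum ((!) c2) X))"
    by blast
  define x :: "nat list" where "x = map (\<lambda>i. if i \<in> X then 1 else 0) [0..<?n]"
  have "(\<Sum>i<?n. f i * x ! i) = sum f X" for f :: "nat \<Rightarrow> nat"
  proof -
    have "(\<Sum>i<?n. f i * x ! i) = (\<Sum>i<?n. if i \<in> X then f i else 0)"
      by (intro sum.cong) (auto simp: x_def)
    also have "\<dots> = sum f X" using X by (simp add: sum.If_cases Int_absorb1)
    finally show ?thesis .
  qed
  then have "y = (- int (\<Sum>i<?n. c1 ! i * x ! i), int (\<Sum>i<?n. c2 ! i * x ! i))" using y by simp
  moreover have "length x = ?n" "set x \<subseteq> {0, 1}" by (auto simp: x_def)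
  ultimately show "y \<in> ?L" unfolding buco_values_def by blast
qed

lemma buco_chain_lists:
  assumes "length c1 = length c2"
  shows "buco_chain (exponent c1 c2) (length c1) ((!) c1) ((!) c2)"
proof
  let ?m = "exponent c1 c2"
  have sum: "(\<Sum>i<length xs. xs ! i) = sum_list xs" for xs :: "nat list"
    by (simp add: sum_list_sum_nth atLeast0LessThan)
  have "(2::nat) ^ total_bits c1 \<le> 2 ^ ?m" by (intro power_increasing) (auto simp: exponent_def)
  then show "(\<Sum>i<length c1. c1 ! i) < 2 ^ ?m"
    unfolding sum by (rule less_le_trans[OF sum_list_less_total_bits])
  have "Suc (sum_list c2) \<le> 2 ^ total_bits c2" using sum_list_less_total_bits[of c2] by simp
  also have "(2::nat) ^ total_bits c2 < 2 ^ ?m"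
    by (intro power_strict_increasing) (auto simp: exponent_def)
  finally show "Suc (\<Sum>i<length c1. c2 ! i) < 2 ^ ?m" using assms sum[of c2] by simp
qed

context buco_chain
begin

lemma decode_value_shift:
  assumes "z \<in> buco_set"
  shows "decode_value (enc_pair enc_int enc_rat (shift z)) = enc_pair enc_int enc_int z"
proof -
  obtain X where X: "X \<subseteq> {..<n}" and z: "z = (- int (sum c X), int (sum d X))"
    using assms by (auto simp: buco_set_def)
  have "sum d X < 2 ^ (m + n)"
  proof -
    have "sum d X \<le> (\<Sum>i<n. d i)" using X by (intro sum_mono2) auto
    also have "\<dots> < 2 ^ m" using sum_d by simp
    also have "(2::nat) ^ m \<le> 2 ^ (m + n)" by simp
    finally show ?thesis .
  qed
  then have "drop_top (enc_nat (2 ^ (m + n) + sum d X)) = enc_nat (sum d X)"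
    by (rule drop_top_enc_nat)
  moreover have "shift z = (- int (sum c X), of_nat (2 ^ (m + n) + sum d X))"
    using shift_value[of X] by (simp only: z open_value_def)
  ultimately show ?thesis
    unfolding z by (simp only: enc_pair_def fst_conv snd_conv enc_rat_of_nat decode_value_def
        enc_int_of_nat left.simps right.simps)
qed

lemma size_enc_value:
  assumes "y \<in> nondominated (msp_values G)"
  shows "size (enc_pair enc_int enc_rat y) \<le> 4 * (m + n) + 19"
proof -
  obtain k where k: "snd y = of_nat k" "k < 2 ^ (m + n + 1)" and fst: "\<bar>fst y\<bar> < 2 ^ (m + n + 3)"
    using assms by (rule nondominated_bounds)
  have "size (enc_int (fst y)) \<le> 2 * (m + n + 3) + 2" using size_enc_int[OF fst] .
  moreover have "size (enc_nat k) \<le> 2 * (m + n + 1)"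
    by (rule le_trans[OF size_enc_nat mult_le_mono2[OF length_bits_le[OF k(2)]]])
  moreover have "enc_int 1 = Node Leaf (Node tt Leaf)"
    using enc_int_of_nat[of 1] enc_nat_1 by simp
  ultimately show ?thesis
    by (simp add: enc_pair_def k(1) enc_rat_of_nat enc_int_of_nat)
qed

lemma decode_values_correct:
  assumes "distinct ys" and "set ys = nondominated (msp_values G)"
  shows "\<exists>zs. decode_values (enc_list (enc_pair enc_int enc_rat) ys) =
      enc_list (enc_pair enc_int enc_int) zs \<and> distinct zs \<and> set zs = nondominated buco_set"
proof -
  let ?f = "inv shift"
  let ?zs = "rev (map ?f (filter (\<lambda>y. fst y \<le> 0) ys))"
  have filter: "set (filter (\<lambda>y. fst y \<le> 0) ys) = shift ` nondominated buco_set"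
    using nondominated_open assms(2) by auto
  have inv: "?f (shift z) = z" for z using inj_shift by simp
  have "decode_value (enc_pair enc_int enc_rat y) = enc_pair enc_int enc_int (?f y)"
    if "y \<in> set ys" "fst y \<le> 0" for y
  proof -
    have "y \<in> shift ` nondominated buco_set" using that filter by auto
    then obtain z where "z \<in> buco_set" "y = shift z" by (auto simp: nondominated_def)
    then show ?thesis using decode_value_shift inv by simp
  qed
  then have "decode_values (enc_list (enc_pair enc_int enc_rat) ys) =
      enc_list (enc_pair enc_int enc_int) ?zs"
    using foldl_push_value[of ys ?f "[]"] by (simp add: decode_values_def items_enc_list)
  moreover have "distinct ?zs"
  proof -
    have "inj_on ?f (shift ` nondominated buco_set)"
      by (rule inj_on_inv_into) auto
    then show ?thesis unfolding distinct_rev distinct_map filter using assms(1) by simp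
  qed
  moreover have "set ?zs = nondominated buco_set"
    unfolding set_rev set_map filter by (simp add: image_image inv)
  ultimately show ?thesis by blast
qed

lemma outerplanar_G: "outerplanar (verts G) (edges G)"
proof (rule outerplanar_noncrossing)
  show "card e = 2" if "e \<in> edges G" for e
    using that msp_instance_G by (auto simp: msp_instance_def simple_graph_def)
qed (rule noncrossing)

end

theorem theorem3:
  assumes "\<exists>c. solves_msp c
    (\<lambda>G. degree_bounded 3 (verts G) (edges G) \<and> outerplanar (verts G) (edges G))"
  shows "\<exists>c. solves_buco c"
proof -
  obtain c where c: "output_polynomial c
      (\<lambda>G. msp_instance G \<and> degree_bounded 3 (verts G) (edges G) \<and> outerplanar (verts G) (edges G))
      msp_code (\<lambda>G. nondominated (msp_values G)) (enc_pair enc_int enc_rat)"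
    using assms unfolding solves_msp_def by blast
  \<comment> \<open>At most \<open>2 * N + 1\<close> values are listed and each contributes at most
    \<open>4 * N + 30\<close> nodes, where \<open>N\<close> is the input size plus the number of
    BUCO values.\<close>
  define q :: "nat \<Rightarrow> nat" where "q N = (2 * N + 1) * (4 * N + 30)" for N
  show ?thesis
    unfolding solves_buco_def
  proof (rule output_polynomial_reduction[OF c ptime_encode_chain ptime_decode_values])
    show "poly_bounded q" unfolding q_def by (intro poly_bounded_intros)
  next
    fix I x assume "buco_instance I" and x: "buco_code I x"
    then obtain c1 c2 where I: "I = (c1, c2)" and len: "length c1 = length c2"
      by (cases I) (auto simp: buco_instance_def)
    let ?m = "exponent c1 c2" and ?n = "length c1"
    interpret buco_chain ?m ?n "(!) c1" "(!) c2" using len by (rule buco_chain_lists)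
    have Y: "buco_values I = buco_set" using buco_values_eq[OF len] I by (simp add: buco_set_def)
    let ?N = "size x + card (nondominated (buco_values I))"
    have xI: "x = enc_buco (c1, c2)" using x I by (simp add: buco_code_def)
    have mn: "?m + ?n \<le> size x + 1"
      using total_bits_le_size[of c1] total_bits_le_size[of c2]
      by (simp add: xI enc_pair_def exponent_def)
    have card: "card (nondominated (msp_values G)) \<le> 2 * ?N + 1"
      using card_nondominated mn by (simp add: Y exponent_def)
    show "\<exists>j. (msp_instance j \<and> degree_bounded 3 (verts j) (edges j) \<and> outerplanar (verts j) (edges j)) \<and>
        msp_code j (encode_chain x) \<and> card (nondominated (msp_values j)) \<le> q ?N \<and>
        (\<forall>ys. distinct ys \<and> set ys = nondominated (msp_values j) \<longrightarrow>
           size (enc_list (enc_pair enc_int enc_rat) ys) \<le> q ?N \<and>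
           (\<exists>ys'. decode_values (enc_list (enc_pair enc_int enc_rat) ys) =
              enc_list (enc_pair enc_int enc_int) ys' \<and> distinct ys' \<and>
              set ys' = nondominated (buco_values I)))"
    proof (intro exI[of _ G] conjI allI impI)
      show "msp_code G (encode_chain x)"
        unfolding xI encode_chain_enc_buco[OF len] G_def
        by (rule msp_code_msp_of[OF distinct_verts distinct_edges])
      show "card (nondominated (msp_values G)) \<le> q ?N"
        using card mult_le_mono[OF order_refl, of 1 "4 * ?N + 30" "2 * ?N + 1"] by (simp add: q_def)
    next
      fix ys assume ys: "distinct ys \<and> set ys = nondominated (msp_values G)"
      then have "length ys \<le> 2 * ?N + 1" using card distinct_card[of ys] by simp
      moreover have "4 * (?m + ?n) + 19 + 1 \<le> 4 * ?N + 30" using mn by simp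
      moreover have "size (enc_list (enc_pair enc_int enc_rat) ys) \<le> length ys * (4 * (?m + ?n) + 19 + 1)"
        using ys size_enc_value by (intro size_enc_list) auto
      ultimately show "size (enc_list (enc_pair enc_int enc_rat) ys) \<le> q ?N"
        unfolding q_def by (meson le_trans mult_le_mono)
      show "\<exists>ys'. decode_values (enc_list (enc_pair enc_int enc_rat) ys) =
              enc_list (enc_pair enc_int enc_int) ys' \<and> distinct ys' \<and>
              set ys' = nondominated (buco_values I)"
        unfolding Y using ys by (intro decode_values_correct) auto
    qed (rule msp_instance_G degree_bounded_G outerplanar_G)+
  qed
qed

end
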